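(* Suppose $\mathcal T\in\mathbb C^{n_1\times\cdots\times n_d}$ satisfies $$T(\alpha_1,\dots,\alpha_d)=\operatorname{tr}\bigl(Q_1^{(\alpha_1)}Q_2^{(\alpha_2)}\cdots Q_d^{(\alpha_d)}\bigr),\qquad \alpha_k\in[n_k],$$ where $d\ge 3$, $r\ge 2$, and $n_k\ge r^2$ for all $k\in[d]$. Assume that the elements of the cores $\mathcal Q_k\in\mathbb C^{n_k\times r\times r}$, $k\in[d]$, are randomly drawn from a measure $\mu$ that is absolutely continuous with respect to the standard Euclidean measure. Then with probability one, $\mathcal Q_1,\dots,\mathcal Q_d$ can be identified up to gauge invariance by the BLOSTR algorithm described in the context, run with any index pairs $(\alpha,\beta)$, $(\alpha',\beta')$ satisfying $\alpha\ne\beta$, $\alpha'\ne\beta'$, $\{\alpha,\beta\}\ne\{\alpha',\beta'\}$ and any $\gamma\in[n_1]\times\cdots\times[n_d]$. That is, its output $(\hat{\mathcal Q}_1,\dots,\hat{\mathcal Q}_d)$ satisfies, for some $L_1,\dots,L_d\in\mathrm{GL}(r,\mathbb C)$, $$\hat Q_k^{(\alpha_k)}=L_k^{-1}Q_k^{(\alpha_k)}L_{k+1}\quad\text{for all }k\in[d],\ \alpha_k\in[n_k],\qquad L_{d+1}:=L_1 .$$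
   Context: **Notation.** $[n]=\{1,\dots,n\}$. For a core $\mathcal Q\in\mathbb C^{n\times r\times r}$, $Q^{(a)}\in\mathbb C^{r\times r}$ is its $a$-th slice, $Q^{(a)}_{i,j}=\mathcal Q_{a,i,j}$. Its two unfoldings $Q_{\langle1\rangle},Q_{[1]}\in\mathbb C^{n\times r^2}$ are, for $i,j\in[r]$, $$Q_{\langle 1\rangle}(a,(i-1)r+j)=Q^{(a)}_{i,j},\qquad Q_{[1]}(a,(i-1)r+j)=Q^{(a)}_{j,i}.$$ $A^\top$ is the transpose, $A^\dagger$ the Moore–Penrose inverse, $\otimes$ the Kronecker product. For an $r^2\times r^2$ matrix $X$, $\Pi(X)$ is the $r^2\times r^2$ matrix with $$\Pi(X)_{(j_2-1)r+j_1,(k_2-1)r+k_1}=X_{(j_1-1)r+j_2,(k_1-1)r+k_2},\qquad j_1,j_2,k_1,k_2\in[r].$$ For a tuple $\alpha=(\alpha_2,\dots,\alpha_{d-1})\in[n_2]\times\cdots\times[n_{d-1}]$ and $\Gamma\subseteq[n_d]$ with $|\Gamma|=r^2$, $T(:,\alpha,\Gamma)$ is the $n_1\times r^2$ matrix with columns $T(:,\alpha_2,\dots,\alpha_{d-1},a)$, $a\in\Gamma$. For $2\le k\le d$, $\gamma\in[n_1]\times\cdots\times[n_d]$ and $\Gamma_{k-1}\subseteq[n_{k-1}]$ with $|\Gamma_{k-1}|=r^2$, let $S_k\in\mathbb C^{n_k\times r^2}$ be the matrix with rows indexed by $a\in[n_k]$, columns indexed by $b\in\Gamma_{k-1}$,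 whose $(a,b)$ entry is the entry of $\mathcal T$ whose mode-$k$ index is $a$, mode-$(k-1)$ index is $b$, and mode-$\ell$ index is $\gamma_\ell$ for all other $\ell$. **BLOSTR algorithm.** Input: the TR rank $r$, an index $\gamma\in[n_1]\times\cdots\times[n_d]$, and the entries of $\mathcal T$ used below. Here $\Gamma_\alpha,\Gamma_\beta,\Gamma_{\alpha'},\Gamma_{\beta'}\subseteq[n_d]$ and $\Gamma_k\subseteq[n_k]$ ($1\le k\le d-1$) are index subsets of cardinality $r^2$. 1. Choose two index pairs $(\alpha,\beta)$ and $(\alpha',\beta')$ in $([n_2]\times\cdots\times[n_{d-1}])^2$ with $\alpha\ne\beta$, $\alpha'\ne\beta'$, $\{\alpha,\beta\}\ne\{\alpha',\beta'\}$. 2. Compute the eigendecompositions of $T(:,\alpha,\Gamma_\alpha)\,T(:,\beta,\Gamma_\beta)^\dagger$ and $T(:,\alpha',\Gamma_{\alpha'})\,T(:,\beta',\Gamma_{\beta'})^\dagger$, and stack the eigenvectors for the nonzero spectrum as $E,E'\in\mathbb C^{n_1\times r^2}$ respectively. Arrange the columns of $E$ (resp. $E'$) in $r$ consecutive blocks of size $r$ so that each block contains eigenvectors corresponding to the $r$ distinct nonzero eigenvalues in a fixed order (so column $(j-1)r+k$ belongs to the $k$-th eigenvalue, $j,k\in[r]$). 3. Let $F=E^\dagger E'$ and, for $j,k\in[r]$, let $F^{(j,k)}\in\mathbb C^{r\times r}$ be the submatrix with $F^{(j,k)}_{p,q}=F_{(p-1)r+j,(q-1)r+k}$. 4. Set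 $\hat K_1=I_r$, $\hat K_\ell=F^{(1,1)}(F^{(\ell,1)})^{-1}$ for $2\le \ell\le r$, and $\hat K=\mathrm{blockdiag}(\hat K_1,\dots,\hat K_r)$. 5. Let $\hat{\mathcal Q}_1$ be the core with $\hat Q_{1\langle1\rangle}=E\,(\Pi(\hat K))^{-1}$. 6. For $k=2,\dots,d$, successively let $\hat{\mathcal Q}_k$ be the core with $$\hat Q_{k\langle1\rangle}=S_k\Bigl(\bigl(I_r\otimes(\hat Q_1^{(\gamma_1)}\cdots\hat Q_{k-2}^{(\gamma_{k-2})})\bigr)\,\bigl(\hat Q_{(k-1)[1]}^\top\bigr)(:,\Gamma_{k-1})\Bigr)^\dagger,$$ where the product in parentheses is $I_r$ if $k=2$, and $(\cdot)(:,\Gamma_{k-1})$ denotes restriction to the columns in $\Gamma_{k-1}$. Output: $(\hat{\mathcal Q}_1,\dots,\hat{\mathcal Q}_d)$.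
   Formalization: That the algorithm runs to completion is claimed only if Γ_α=Γ_β, Γ_α'=Γ_β' and the unordered index pairs still differ after deleting the trailing entries common to α,β (resp. α',β'); otherwise it almost surely cannot run. Any output is gauge equivalent in all cases. *)

theory Defs
  imports
    "HOL-Probability.Probability_Measure"
    "Jordan_Normal_Form.Schur_Decomposition"
    "Jordan_Normal_Form.Gauss_Jordan_Elimination"
    "Jordan_Normal_Form.DL_Submatrix"
begin

text \<open>
  Conventions. Modes are numbered \<open>1, \<dots>, d\<close> as in the mathematics. The values of a mode-\<open>k\<close> index
  are \<open>0, \<dots>, n k - 1\<close>, and all matrix rows and columns are counted from \<open>0\<close>, so that the position
  \<open>(i - 1) r + j\<close> with \<open>i, j \<in> {1, \<dots>, r}\<close> becomes \<open>i * r + j\<close> with \<open>i, j < r\<close>.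
  Multi-indices are extensional functions on a set of modes, so equality of tuples is equality of
  functions.
\<close>

definition multi_indices :: "nat set \<Rightarrow> (nat \<Rightarrow> nat) \<Rightarrow> (nat \<Rightarrow> nat) set" where
  "multi_indices K n = (\<Pi>\<^sub>E k\<in>K. {..<n k})"

definition index_subset :: "nat \<Rightarrow> nat \<Rightarrow> nat set \<Rightarrow> bool" where
  "index_subset m r G \<longleftrightarrow> G \<subseteq> {..<m} \<and> card G = r ^ 2"

subsection \<open>Matrix operations\<close>

definition mat_trace :: "complex mat \<Rightarrow> complex" where
  "mat_trace A = sum_list (diag_mat A)"

text \<open>Only meaningful for invertible \<open>A\<close>; every use in the algorithm below is accompanied by the
  requirement that the matrix is invertible.\<close>

definition mat_inv :: "complex mat \<Rightarrow> complex mat" where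
  "mat_inv A = the (mat_inverse A)"

definition is_pinv :: "complex mat \<Rightarrow> complex mat \<Rightarrow> bool" where
  "is_pinv A B \<longleftrightarrow> B \<in> carrier_mat (dim_col A) (dim_row A) \<and>
     A * B * A = A \<and> B * A * B = B \<and>
     mat_adjoint (A * B) = A * B \<and> mat_adjoint (B * A) = B * A"

text \<open>The Penrose equations have exactly one solution for every complex matrix.\<close>

definition pinv :: "complex mat \<Rightarrow> complex mat" where
  "pinv A = (THE B. is_pinv A B)"

definition kronecker :: "complex mat \<Rightarrow> complex mat \<Rightarrow> complex mat" where
  "kronecker A B = mat (dim_row A * dim_row B) (dim_col A * dim_col B)
     (\<lambda>(i, j). A $$ (i div dim_row B, j div dim_col B) * B $$ (i mod dim_row B, j mod dim_col B))"

definition Pi_perm :: "nat \<Rightarrow> complex mat \<Rightarrow> complex mat" where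
  "Pi_perm r X = mat (r * r) (r * r)
     (\<lambda>(p, q). X $$ ((p mod r) * r + p div r, (q mod r) * r + q div r))"

text \<open>Columns are restricted in increasing order of their index.\<close>

definition restrict_cols :: "complex mat \<Rightarrow> nat set \<Rightarrow> complex mat" where
  "restrict_cols A G = submatrix A UNIV G"

subsection \<open>Cores and tensor rings\<close>

text \<open>A core is given by its slices \<open>Q\<^sup>(\<^sup>a\<^sup>)\<close>; a family of cores is indexed by the mode.\<close>

type_synonym core = "nat \<Rightarrow> complex mat"

definition unfold_angle :: "nat \<Rightarrow> nat \<Rightarrow> core \<Rightarrow> complex mat" where
  "unfold_angle m r C = mat m (r * r) (\<lambda>(a, c). C a $$ (c div r, c mod r))"

definition unfold_square :: "nat \<Rightarrow> nat \<Rightarrow> core \<Rightarrow> complex mat" where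
  "unfold_square m r C = mat m (r * r) (\<lambda>(a, c). C a $$ (c mod r, c div r))"

text \<open>The ordered product of the slices selected by \<open>\<gamma>\<close> over a list of modes.\<close>

definition slice_prod :: "nat \<Rightarrow> (nat \<Rightarrow> core) \<Rightarrow> (nat \<Rightarrow> nat) \<Rightarrow> nat list \<Rightarrow> complex mat" where
  "slice_prod r Q \<gamma> ks = foldr (\<lambda>k A. Q k (\<gamma> k) * A) ks (1\<^sub>m r)"

definition tr_tensor :: "nat \<Rightarrow> nat \<Rightarrow> (nat \<Rightarrow> core) \<Rightarrow> (nat \<Rightarrow> nat) \<Rightarrow> complex" where
  "tr_tensor d r Q \<alpha> = mat_trace (slice_prod r Q \<alpha> [1..<Suc d])"

text \<open>The entries of all cores, as one point of \<open>\<complex>\<^sup>N\<close>: coordinate \<open>(k, a, i, j)\<close> is the entry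
  \<open>(i, j)\<close> of the \<open>a\<close>-th slice of the \<open>k\<close>-th core.\<close>

definition entry_index :: "nat \<Rightarrow> (nat \<Rightarrow> nat) \<Rightarrow> nat \<Rightarrow> (nat \<times> nat \<times> nat \<times> nat) set" where
  "entry_index d n r = {(k, a, i, j). k \<in> {1..d} \<and> a < n k \<and> i < r \<and> j < r}"

definition entry_lebesgue ::
    "nat \<Rightarrow> (nat \<Rightarrow> nat) \<Rightarrow> nat \<Rightarrow> (nat \<times> nat \<times> nat \<times> nat \<Rightarrow> complex) measure" where
  "entry_lebesgue d n r = (\<Pi>\<^sub>M x\<in>entry_index d n r. lborel)"

definition cores_of :: "nat \<Rightarrow> (nat \<times> nat \<times> nat \<times> nat \<Rightarrow> complex) \<Rightarrow> nat \<Rightarrow> core" where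
  "cores_of r \<omega> k a = mat r r (\<lambda>(i, j). \<omega> (k, a, i, j))"

definition gauge_equivalent ::
    "nat \<Rightarrow> (nat \<Rightarrow> nat) \<Rightarrow> nat \<Rightarrow> (nat \<Rightarrow> core) \<Rightarrow> (nat \<Rightarrow> core) \<Rightarrow> bool" where
  "gauge_equivalent d n r Q Qh \<longleftrightarrow>
     (\<exists>L :: nat \<Rightarrow> complex mat.
        (\<forall>k\<in>{1..d+1}. L k \<in> carrier_mat r r \<and> invertible_mat (L k)) \<and> L (d + 1) = L 1 \<and>
        (\<forall>k\<in>{1..d}. \<forall>a<n k. Qh k a = mat_inv (L k) * Q k a * L (k + 1)))"

subsection \<open>The BLOSTR algorithm\<close>

text \<open>\<open>T(:, \<alpha>, \<Gamma>)\<close>, for \<open>\<alpha>\<close> a multi-index on the modes \<open>2, \<dots>, d - 1\<close>.\<close>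

definition fiber_mat :: "nat \<Rightarrow> (nat \<Rightarrow> nat) \<Rightarrow> ((nat \<Rightarrow> nat) \<Rightarrow> complex) \<Rightarrow> (nat \<Rightarrow> nat)
    \<Rightarrow> nat set \<Rightarrow> complex mat" where
  "fiber_mat d n T \<alpha> G = restrict_cols (mat (n 1) (n d) (\<lambda>(a, b). T (\<alpha>(1 := a, d := b)))) G"

definition quotient_mat :: "nat \<Rightarrow> (nat \<Rightarrow> nat) \<Rightarrow> ((nat \<Rightarrow> nat) \<Rightarrow> complex) \<Rightarrow> (nat \<Rightarrow> nat) \<Rightarrow> nat set
    \<Rightarrow> (nat \<Rightarrow> nat) \<Rightarrow> nat set \<Rightarrow> complex mat" where
  "quotient_mat d n T \<alpha> G\<^sub>\<alpha> \<beta> G\<^sub>\<beta> = fiber_mat d n T \<alpha> G\<^sub>\<alpha> * pinv (fiber_mat d n T \<beta> G\<^sub>\<beta>)"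

definition eigendecomposition :: "complex mat \<Rightarrow> complex mat \<Rightarrow> (nat \<Rightarrow> complex) \<Rightarrow> bool" where
  "eigendecomposition N X ev \<longleftrightarrow>
     (\<exists>m. N \<in> carrier_mat m m \<and> X \<in> carrier_mat m m \<and> invertible_mat X \<and>
          N = X * mat_diag m ev * mat_inv X)"

text \<open>\<open>E\<close> is an admissible stack of eigenvectors of \<open>N\<close>, with column \<open>j * r + k\<close> belonging to the
  \<open>k\<close>-th nonzero eigenvalue: \<open>\<sigma>\<close> lists the eigenvectors (columns of \<open>X\<close>)
  that belong to nonzero eigenvalues, without omission or repetition, and \<open>\<nu>\<close> is the chosen order of
  the \<open>r\<close> distinct nonzero eigenvalues.\<close>

definition eigenvector_stack :: "nat \<Rightarrow> complex mat \<Rightarrow> complex mat \<Rightarrow> bool" where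
  "eigenvector_stack r N E \<longleftrightarrow> E \<in> carrier_mat (dim_row N) (r * r) \<and>
     (\<exists>X ev \<sigma> \<nu>. eigendecomposition N X ev \<and>
        bij_betw \<sigma> {..<r * r} {i. i < dim_row N \<and> ev i \<noteq> 0} \<and>
        (\<forall>c<r * r. col E c = col X (\<sigma> c)) \<and>
        inj_on \<nu> {..<r} \<and> (\<forall>j<r. \<forall>k<r. ev (\<sigma> (j * r + k)) = \<nu> k))"

definition block_F :: "nat \<Rightarrow> complex mat \<Rightarrow> nat \<Rightarrow> nat \<Rightarrow> complex mat" where
  "block_F r F j k = mat r r (\<lambda>(p, q). F $$ (p * r + j, q * r + k))"

definition K_hat :: "nat \<Rightarrow> complex mat \<Rightarrow> complex mat" where
  "K_hat r F = diag_block_mat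
     (map (\<lambda>l. if l = 0 then 1\<^sub>m r else block_F r F 0 0 * mat_inv (block_F r F l 0)) [0..<r])"

text \<open>\<open>S\<^sub>k\<close>, with columns restricted to \<open>G \<subseteq> [n\<^sub>k\<^sub>-\<^sub>1]\<close>.\<close>

definition S_mat :: "(nat \<Rightarrow> nat) \<Rightarrow> ((nat \<Rightarrow> nat) \<Rightarrow> complex) \<Rightarrow> (nat \<Rightarrow> nat) \<Rightarrow> nat set \<Rightarrow> nat
    \<Rightarrow> complex mat" where
  "S_mat n T \<gamma> G k =
     restrict_cols (mat (n k) (n (k - 1)) (\<lambda>(a, b). T (\<gamma>(k := a, k - 1 := b)))) G"

text \<open>Started from the eigenvector stacks \<open>E\<close> and \<open>E'\<close>, the rest of the algorithm can be carried out (all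
  the matrices to be inverted are invertible) and produces the cores \<open>Qh\<close>.\<close>

definition blostr_steps :: "nat \<Rightarrow> (nat \<Rightarrow> nat) \<Rightarrow> nat \<Rightarrow> ((nat \<Rightarrow> nat) \<Rightarrow> complex) \<Rightarrow> (nat \<Rightarrow> nat)
    \<Rightarrow> (nat \<Rightarrow> nat set) \<Rightarrow> complex mat \<Rightarrow> complex mat \<Rightarrow> (nat \<Rightarrow> core) \<Rightarrow> bool" where
  "blostr_steps d n r T \<gamma> G E E' Qh \<longleftrightarrow>
     (\<forall>k\<in>{1..d}. \<forall>a<n k. Qh k a \<in> carrier_mat r r) \<and>
     (let F = pinv E * E' in
        (\<forall>l\<in>{1..<r}. invertible_mat (block_F r F l 0)) \<and>
        invertible_mat (Pi_perm r (K_hat r F)) \<and>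
        unfold_angle (n 1) r (Qh 1) = E * mat_inv (Pi_perm r (K_hat r F))) \<and>
     (\<forall>k\<in>{2..d}.
        unfold_angle (n k) r (Qh k) =
          S_mat n T \<gamma> (G (k - 1)) k *
          pinv (kronecker (1\<^sub>m r) (slice_prod r Qh \<gamma> [1..<k - 1]) *
                restrict_cols (transpose_mat (unfold_square (n (k - 1)) r (Qh (k - 1)))) (G (k - 1))))"

text \<open>
  Let \<open>T\<close> be a tensor ring and \<open>M\<^sub>\<alpha>\<close> the product of the slices selected by \<open>\<alpha>\<close> over the modes
  \<open>2, \<dots>, d - 1\<close>. For \<open>G\<^sub>\<alpha> = G\<^sub>\<beta>\<close> and generic cores, \<open>quotient_mat\<close> has the nonzero eigenvalues of
  \<open>M\<^sub>\<alpha> M\<^sub>\<beta>\<^sup>-\<^sup>1\<close>, each \<open>r\<close> times; for \<open>G\<^sub>\<alpha> \<noteq> G\<^sub>\<beta>\<close> this structure is lost. The trailing entries on which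
  \<open>\<alpha>\<close> and \<open>\<beta>\<close> agree cancel in \<open>M\<^sub>\<alpha> M\<^sub>\<beta>\<^sup>-\<^sup>1\<close>, and \<open>strip_common d \<alpha> \<beta>\<close> is what remains of \<open>\<alpha>\<close>. Two index
  pairs that agree after this cancellation give the same product, or two mutually inverse ones.
  Then \<open>E\<close> and \<open>E'\<close> have the same eigenspaces and one of the inverses taken in \<open>blostr_steps\<close> does
  not exist. For \<open>d = 3\<close> nothing cancels.
\<close>

definition strip_common :: "nat \<Rightarrow> (nat \<Rightarrow> nat) \<Rightarrow> (nat \<Rightarrow> nat) \<Rightarrow> nat list" where
  "strip_common d \<alpha> \<beta> = map \<alpha> [2..<Suc (Max {k \<in> {2..d-1}. \<alpha> k \<noteq> \<beta> k})]"

definition independent_pairs ::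
    "nat \<Rightarrow> (nat \<Rightarrow> nat) \<Rightarrow> (nat \<Rightarrow> nat) \<Rightarrow> (nat \<Rightarrow> nat) \<Rightarrow> (nat \<Rightarrow> nat) \<Rightarrow> bool" where
  "independent_pairs d \<alpha> \<beta> \<alpha>' \<beta>' \<longleftrightarrow>
     {strip_common d \<alpha> \<beta>, strip_common d \<beta> \<alpha>} \<noteq> {strip_common d \<alpha>' \<beta>', strip_common d \<beta>' \<alpha>'}"

end

theory Submission
  imports Defs
begin

text \<open>
  Write \<open>M\<^sub>\<alpha>\<close> for the product of the slices selected by \<open>\<alpha>\<close> over the modes \<open>2, \<dots>, d - 1\<close> and \<open>A\<close> for the
  first unfolding of the first core. A fibre matrix factors as \<open>A (I \<otimes> M\<^sub>\<alpha>) B\<close> with \<open>B\<close> the selected columns of the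
  last core, so for equal column sets the quotient matrix acts on the range of \<open>A\<close> as \<open>I \<otimes> H\<close>,
  \<open>H = M\<^sub>\<alpha> M\<^sub>\<beta>\<^sup>-\<^sup>1\<close>. Every admissible stack is then \<open>A (I \<otimes> \<Lambda>) Z\<close>, where the columns of \<open>\<Lambda>\<close> are eigenvectors of
  \<open>H\<close> and \<open>Z\<close> is block diagonal up to a permutation; comparing two stacks reveals the blocks of \<open>Z\<close> up to one common
  matrix and scalars, which is a gauge. The remaining cores are solutions of invertible linear systems.

  Each genericity condition says that a polynomial in the entries does not vanish, so it suffices to
  exhibit one point where it does not. The condition that makes all blocks of \<open>F\<close> invertible is that the matrices
  \<open>H\<^sup>a H'\<^sup>b\<close> with \<open>a, b < r\<close> are linearly independent: it forbids a left eigenvector of \<open>H\<close> orthogonal to a right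
  eigenvector of \<open>H'\<close>, and it holds for \<open>H\<close> diagonal and \<open>H'\<close> its conjugate by an involution without zero entries.
\<close>

unbundle no vec_syntax and no inner_syntax

text \<open>Correctness is claimed for every run that completes, executability only for equal column
  sets and independent index pairs, and the two halves need different arguments. With different
  column sets a generic quotient has no admissible stack, so there is no run at all: an eigenvalue
  repeated \<open>r\<close> times, with \<open>r\<close> at least 2, would be insensitive to one
  column, which a polynomial condition excludes. For a run that completes, the inverses taken along
  the way already force the first column of \<Lambda>^-1 \<Lambda>' to have no zero entry, where
  \<Lambda> and \<Lambda>' are the eigenvector matrices of the two quotients; this is exactly what
  the recovery of the first core requires. Independence of the pairs produces the same property in
  advance. To stay polynomial, the conditions avoid division and discriminants: adjugates replace
  inverses, and simplicity of the eigenvalues is expressed by p'(H) being invertible, with p the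
  characteristic polynomial. All conditions range over finitely many indices and column sets, so one
  null set serves every run.\<close>

lemma pair_index_less: "i < r \<Longrightarrow> j < r \<Longrightarrow> i * r + j < r * (r::nat)"
proof -
  assume "i < r" "j < r"
  then have "i * r + j < i * r + r" by simp
  also have "\<dots> = Suc i * r" by simp
  also have "\<dots> \<le> r * r" using \<open>i < r\<close> by (intro mult_le_mono1) simp
  finally show ?thesis .
qed

lemma pair_index_div_mod [simp]: "j < r \<Longrightarrow> (i * r + j) div r = i" "j < r \<Longrightarrow> (i * r + j) mod r = (j::nat)"
  by auto

lemma pair_index_eq_iff: "j < r \<Longrightarrow> l < r \<Longrightarrow> i * r + j = k * r + l \<longleftrightarrow> i = k \<and> j = (l::nat)"
  by (metis pair_index_div_mod)

lemma pair_index_div_less: "c < r * r \<Longrightarrow> c div r < (r::nat)" "c < r * r \<Longrightarrow> c mod r < (r::nat)"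
  by (auto simp: less_mult_imp_div_less intro!: mod_less_divisor gr0I)

lemma sum_pair_index: "(\<Sum>c<r * r. f c) = (\<Sum>i<r. \<Sum>j<r. f (i * r + j :: nat))"
proof -
  have "(\<Sum>c<r * r. f c) = (\<Sum>i<r. sum f {i * r..<i * r + r})"
    by (rule sum.nat_group[symmetric])
  also have "\<dots> = (\<Sum>i<r. \<Sum>j<r. f (i * r + j))"
  proof (rule sum.cong)
    fix i
    have "sum f {i * r..<i * r + r} = (\<Sum>j\<in>{0..<r}. f (j + i * r))"
      using sum.shift_bounds_nat_ivl[of f 0 "i * r" r] by (simp add: add.commute)
    then show "sum f {i * r..<i * r + r} = (\<Sum>j<r. f (i * r + j))"
      by (simp add: add.commute atLeast0LessThan)
  qed simp
  finally show ?thesis .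
qed

lemma all_pair_indexI:
  assumes "\<And>i j. i < r \<Longrightarrow> j < r \<Longrightarrow> P (i * r + j)" and "c < r * (r::nat)"
  shows "P c"
  using assms(1)[of "c div r" "c mod r"] pair_index_div_less[OF assms(2)] by simp

lemma eq_mat_pair_index:
  assumes "A \<in> carrier_mat (r * r) (r * r)" "B \<in> carrier_mat (r * r) (r * r)"
    and eq: "\<And>i l j k. i < r \<Longrightarrow> l < r \<Longrightarrow> j < r \<Longrightarrow> k < r \<Longrightarrow>
      A $$ (i * r + l, j * r + k) = B $$ (i * r + l, j * r + k)"
  shows "A = B"
proof (rule eq_matI)
  fix p q assume "p < dim_row B" "q < dim_col B"
  then have pq: "p < r * r" "q < r * r" using assms by auto
  show "A $$ (p, q) = B $$ (p, q)"
    using eq[of "p div r" "p mod r" "q div r" "q mod r"] pair_index_div_less[OF pq(1)]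
      pair_index_div_less[OF pq(2)] by simp
qed (use assms in auto)

lemma mult_mat_entry:
  assumes "A \<in> carrier_mat m n" "B \<in> carrier_mat n k" "i < m" "j < k"
  shows "(A * B) $$ (i, j) = (\<Sum>l<n. A $$ (i, l) * B $$ (l, j))"
  using assms by (auto simp: scalar_prod_def atLeast0LessThan intro!: sum.cong)

lemma mult_mat_vec_entry:
  assumes "A \<in> carrier_mat m n" "v \<in> carrier_vec n" "i < m"
  shows "(A *\<^sub>v v) $ i = (\<Sum>l<n. A $$ (i, l) * v $ l)"
  using assms by (auto simp: scalar_prod_def atLeast0LessThan intro!: sum.cong)

lemma mult_mat_pair_entry:
  assumes "A \<in> carrier_mat m (r * r)" "B \<in> carrier_mat (r * r) k" "i < m" "j < k"
  shows "(A * B) $$ (i, j) = (\<Sum>p<r. \<Sum>q<r. A $$ (i, p * r + q) * B $$ (p * r + q, j))"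
  by (simp only: mult_mat_entry[OF assms] sum_pair_index)

subsection \<open>Inverses\<close>

lemma det_nonzero_if_left_inverse:
  assumes "(A :: complex mat) \<in> carrier_mat n n" "B \<in> carrier_mat n n" "B * A = 1\<^sub>m n"
  shows "det A \<noteq> 0"
  using det_mult[OF assms(2,1)] assms(3) by auto

lemma det_nonzero_if_right_inverse:
  assumes "(A :: complex mat) \<in> carrier_mat n n" "B \<in> carrier_mat n n" "A * B = 1\<^sub>m n"
  shows "det A \<noteq> 0"
  using det_mult[OF assms(1,2)] assms(3) by auto

lemma mat_inv:
  assumes A: "A \<in> carrier_mat n n" and "det A \<noteq> 0"
  shows "mat_inv A \<in> carrier_mat n n" "A * mat_inv A = 1\<^sub>m n" "mat_inv A * A = 1\<^sub>m n"
proof -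
  have "A \<in> Units (ring_mat TYPE(complex) n ())" using det_non_zero_imp_unit[OF assms] .
  then obtain B where "mat_inverse A = Some B"
    using mat_inverse(1)[OF A, where b = "()"] by (cases "mat_inverse A") auto
  then show "mat_inv A \<in> carrier_mat n n" "A * mat_inv A = 1\<^sub>m n" "mat_inv A * A = 1\<^sub>m n"
    using mat_inverse(2)[OF A] by (auto simp: mat_inv_def)
qed

lemma mat_inv_eqI:
  assumes A: "A \<in> carrier_mat n n" and B: "B \<in> carrier_mat n n" and AB: "A * B = 1\<^sub>m n"
  shows "mat_inv A = B"
proof -
  note i = mat_inv[OF A det_nonzero_if_right_inverse[OF A B AB]]
  have "mat_inv A = mat_inv A * (A * B)" using AB i(1) by simp
  also have "\<dots> = (mat_inv A * A) * B" using assoc_mult_mat[OF i(1) A B] by simp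
  finally show ?thesis using i(3) B by simp
qed

lemma invertible_mat_iff_det:
  assumes "(A :: complex mat) \<in> carrier_mat n n"
  shows "invertible_mat A \<longleftrightarrow> det A \<noteq> 0"
proof
  assume "invertible_mat A"
  then obtain B where "A * B = 1\<^sub>m n" "B * A = 1\<^sub>m (dim_row B)"
    using assms by (auto simp: invertible_mat_def inverts_mat_def)
  moreover from this have "B \<in> carrier_mat n n"
    using assms by (metis carrier_matD carrier_matI index_mult_mat(2,3) index_one_mat(2,3))
  ultimately show "det A \<noteq> 0" using det_nonzero_if_right_inverse assms by blast
next
  assume "det A \<noteq> 0"
  from mat_inv[OF assms this] show "invertible_mat A"
    using assms unfolding invertible_mat_def inverts_mat_def by (auto intro!: exI[of _ "mat_inv A"])
qed

lemma det_mat_inv: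
  assumes "A \<in> carrier_mat n n" "det A \<noteq> 0"
  shows "det (mat_inv A) \<noteq> 0"
  using det_nonzero_if_left_inverse mat_inv[OF assms] assms by blast

lemma det_nonzero_iff_inj:
  assumes "(A :: complex mat) \<in> carrier_mat n n"
  shows "det A \<noteq> 0 \<longleftrightarrow> (\<forall>v\<in>carrier_vec n. A *\<^sub>v v = 0\<^sub>v n \<longrightarrow> v = 0\<^sub>v n)"
  using det_0_iff_vec_prod_zero_field[OF assms] by auto

subsection \<open>The Moore-Penrose inverse\<close>

lemma mat_adjoint_entry:
  assumes "A \<in> carrier_mat m n" "i < n" "j < m"
  shows "mat_adjoint A $$ (i, j) = cnj (A $$ (j, i))"
  using assms by (auto simp: mat_adjoint_def mat_of_rows_def)

lemma mat_adjoint_carrier [simp]: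
  "A \<in> carrier_mat m n \<Longrightarrow> mat_adjoint (A :: complex mat) \<in> carrier_mat n m"
  by (auto simp: mat_adjoint_def)

lemma dim_mat_adjoint [simp]:
  "dim_row (mat_adjoint (A :: complex mat)) = dim_col A" "dim_col (mat_adjoint A) = dim_row A"
  by (auto simp: mat_adjoint_def)

lemma mat_adjoint_mult:
  assumes "(A :: complex mat) \<in> carrier_mat m n" "B \<in> carrier_mat n k"
  shows "mat_adjoint (A * B) = mat_adjoint B * mat_adjoint A"
proof (rule eq_matI)
  fix i j assume "i < dim_row (mat_adjoint B * mat_adjoint A)" "j < dim_col (mat_adjoint B * mat_adjoint A)"
  then have ij: "i < k" "j < m" using assms by auto
  have "mat_adjoint (A * B) $$ (i, j) = cnj ((A * B) $$ (j, i))"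
    using mat_adjoint_entry[of "A * B" m k] assms ij by simp
  also have "\<dots> = (\<Sum>l<n. mat_adjoint B $$ (i, l) * mat_adjoint A $$ (l, j))"
    using mat_adjoint_entry[OF assms(1)] mat_adjoint_entry[OF assms(2)] ij
    by (auto simp: mult_mat_entry[OF assms] mult.commute)
  also have "\<dots> = (mat_adjoint B * mat_adjoint A) $$ (i, j)"
    using mult_mat_entry[OF mat_adjoint_carrier mat_adjoint_carrier] assms ij by simp
  finally show "mat_adjoint (A * B) $$ (i, j) = (mat_adjoint B * mat_adjoint A) $$ (i, j)" .
qed (use assms in auto)

lemma mat_adjoint_adjoint [simp]: "mat_adjoint (mat_adjoint A) = (A :: complex mat)"
proof -
  have A: "A \<in> carrier_mat (dim_row A) (dim_col A)" by simp
  note A' = mat_adjoint_carrier[OF A]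
  show ?thesis
    by (rule eq_matI) (auto simp: mat_adjoint_entry[OF A'] mat_adjoint_entry[OF A])
qed

text \<open>\<open>A * B\<close> and \<open>A * C\<close> are Hermitian idempotents with the same
  range, that of \<open>A\<close>, hence equal; dually \<open>B * A = C * A\<close>. Then
  \<open>B = B * A * B\<close> turns into \<open>C * A * C = C\<close>. This makes the definite
  description in \<open>pinv\<close> meaningful.\<close>

lemma is_pinv_unique:
  assumes "is_pinv A B" "is_pinv A C"
  shows "B = C"
proof -
  define m n where "m = dim_row A" and "n = dim_col A"
  have A: "A \<in> carrier_mat m n" by (simp add: m_def n_def)
  have B: "B \<in> carrier_mat n m" and C: "C \<in> carrier_mat n m"
    using assms by (auto simp: is_pinv_def m_def n_def)
  note carr = A B C
  have AB: "A * B \<in> carrier_mat m m" and AC: "A * C \<in> carrier_mat m m"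
    and BA: "B * A \<in> carrier_mat n n" and CA: "C * A \<in> carrier_mat n n" using carr by auto
  note eqs = assms[unfolded is_pinv_def]
  have "A * B = (A * C * A) * B" using eqs by simp
  also have "\<dots> = (A * C) * (A * B)" using assoc_mult_mat[OF AC A B] by simp
  also have "\<dots> = mat_adjoint (A * C) * mat_adjoint (A * B)" using eqs by simp
  also have "\<dots> = mat_adjoint ((A * B) * (A * C))" using mat_adjoint_mult[OF AB AC] by simp
  also have "(A * B) * (A * C) = A * C"
    using assoc_mult_mat[OF AB A C] eqs by simp
  finally have 1: "A * B = A * C" using eqs by simp
  have "B * A = B * (A * C * A)" using eqs by simp
  also have "A * C * A = A * (C * A)" using assoc_mult_mat[OF A C A] .
  also have "B * (A * (C * A)) = (B * A) * (C * A)" using assoc_mult_mat[OF B A CA] by simp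
  also have "\<dots> = mat_adjoint (B * A) * mat_adjoint (C * A)" using eqs by simp
  also have "\<dots> = mat_adjoint ((C * A) * (B * A))" using mat_adjoint_mult[OF CA BA] by simp
  also have "(C * A) * (B * A) = C * (A * (B * A))" using assoc_mult_mat[OF C A BA] .
  also have "A * (B * A) = A" using assoc_mult_mat[OF A B A] eqs by simp
  finally have 2: "B * A = C * A" using eqs by simp
  have "B = (B * A) * B" using eqs by simp
  also have "\<dots> = C * (A * B)" using 2 assoc_mult_mat[OF C A B] by simp
  also have "\<dots> = (C * A) * C" using 1 assoc_mult_mat[OF C A C] by simp
  finally show ?thesis using eqs by simp
qed

text \<open>A left inverse makes the Gram matrix G = X^* X invertible, and G^-1 X^* satisfies the
  Penrose equations. Every later use of \<open>pinv\<close> rests on the left inverse property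
  obtained here.\<close>

lemma pinv_left_inverse:
  assumes X: "(X :: complex mat) \<in> carrier_mat m k" and L: "L \<in> carrier_mat k m" and LX: "L * X = 1\<^sub>m k"
  shows "pinv X \<in> carrier_mat k m" "pinv X * X = 1\<^sub>m k"
proof -
  let ?G = "mat_adjoint X * X"
  have Xa: "mat_adjoint X \<in> carrier_mat k m" using X by simp
  have G: "?G \<in> carrier_mat k k" using X Xa by auto
  have "v = 0\<^sub>v k" if v: "v \<in> carrier_vec k" and z: "?G *\<^sub>v v = 0\<^sub>v k" for v
  proof -
    let ?w = "X *\<^sub>v v"
    have w: "?w \<in> carrier_vec m" using X v by auto
    have z': "mat_adjoint X *\<^sub>v ?w = 0\<^sub>v k" using z assoc_mult_mat_vec[OF Xa X v] by simp
    \<comment> \<open>The squared norm of \<open>X v\<close> equals v^* X^* X v, which is zero;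
      applying \<open>L\<close> to \<open>X v = 0\<close> then gives \<open>v = 0\<close>.\<close>
    have "complex_of_real (\<Sum>j<m. (cmod (?w $ j))\<^sup>2) = (\<Sum>j<m. cnj (?w $ j) * ?w $ j)"
      by (simp add: of_real_sum complex_norm_square mult.commute del: of_real_power)
    also have "\<dots> = (\<Sum>j<m. \<Sum>i<k. cnj (v $ i) * (cnj (X $$ (j, i)) * ?w $ j))"
    proof (rule sum.cong)
      fix j assume "j \<in> {..<m}"
      then have "cnj (?w $ j) = (\<Sum>i<k. cnj (X $$ (j, i) * v $ i))"
        by (simp only: mult_mat_vec_entry[OF X v] lessThan_iff cnj_sum)
      then show "cnj (?w $ j) * ?w $ j = (\<Sum>i<k. cnj (v $ i) * (cnj (X $$ (j, i)) * ?w $ j))"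
        by (simp add: sum_distrib_left mult_ac del: index_mult_mat_vec)
    qed simp
    also have "\<dots> = (\<Sum>i<k. cnj (v $ i) * (\<Sum>j<m. cnj (X $$ (j, i)) * ?w $ j))"
      by (subst sum.swap) (simp add: sum_distrib_left)
    also have "\<dots> = (\<Sum>i<k. cnj (v $ i) * (mat_adjoint X *\<^sub>v ?w) $ i)"
      by (intro sum.cong refl arg_cong2[where f = times])
        (auto simp: mult_mat_vec_entry[OF Xa w] mat_adjoint_entry[OF X])
    also have "\<dots> = 0" using z' by simp
    finally have "(\<Sum>j<m. (cmod (?w $ j))\<^sup>2) = 0" by (metis of_real_eq_0_iff)
    then have "\<forall>j<m. ?w $ j = 0" by (simp add: sum_nonneg_eq_0_iff)
    then have "?w = 0\<^sub>v m" using w by (intro eq_vecI) (auto simp: carrier_vecD simp del: index_mult_mat_vec dim_mult_mat_vec)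
    then have "L *\<^sub>v ?w = 0\<^sub>v k" using L by (auto simp: scalar_prod_def)
    then show ?thesis using assoc_mult_mat_vec[OF L X v] LX v by simp
  qed
  then have dG: "det ?G \<noteq> 0" using det_nonzero_iff_inj[OF G] by blast
  let ?I = "mat_inv ?G"
  note I = mat_inv[OF G dG]
  define B where "B = ?I * mat_adjoint X"
  have B: "B \<in> carrier_mat k m" using I Xa by (auto simp: B_def)
  have BX: "B * X = 1\<^sub>m k" using assoc_mult_mat[OF I(1) Xa X] I(3) by (simp add: B_def)
  have Ia: "mat_adjoint ?I = ?I"
  proof -
    have Ic: "mat_adjoint ?I \<in> carrier_mat k k" using I(1) by simp
    have Gs: "mat_adjoint ?G = ?G" using mat_adjoint_mult[OF Xa X] by simp
    have "mat_adjoint (?I * ?G) = ?G * mat_adjoint ?I" using mat_adjoint_mult[OF I(1) G] Gs by simp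
    moreover have "mat_adjoint (1\<^sub>m k :: complex mat) = 1\<^sub>m k"
      by (rule eq_matI) (auto simp: mat_adjoint_entry[of _ k k])
    ultimately have "?G * mat_adjoint ?I = 1\<^sub>m k" using I(3) by simp
    from mat_inv_eqI[OF G Ic this] show ?thesis by simp
  qed
  have XB: "mat_adjoint (X * B) = X * B"
  proof -
    have "mat_adjoint (X * B) = mat_adjoint B * mat_adjoint X" using mat_adjoint_mult[OF X B] .
    also have "mat_adjoint B = X * ?I" unfolding B_def using mat_adjoint_mult[OF I(1) Xa] Ia by simp
    also have "X * ?I * mat_adjoint X = X * B" unfolding B_def using assoc_mult_mat[OF X I(1) Xa] by simp
    finally show ?thesis .
  qed
  have one: "mat_adjoint (B * X) = B * X"
    unfolding BX by (rule eq_matI) (auto simp: mat_adjoint_entry[of _ k k])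
  have "is_pinv X B" unfolding is_pinv_def
    using X B BX XB one assoc_mult_mat[OF X B X] by auto
  then have "pinv X = B" unfolding pinv_def using is_pinv_unique by blast
  then show "pinv X \<in> carrier_mat k m" "pinv X * X = 1\<^sub>m k" using B BX by auto
qed

lemma pinv_eq_mat_inv:
  assumes X: "X \<in> carrier_mat k k" and d: "det X \<noteq> 0"
  shows "pinv X = mat_inv X"
proof -
  note i = mat_inv[OF assms]
  note p = pinv_left_inverse[OF X i(1,3)]
  show ?thesis using mat_inv_eqI[OF X p(1)] p mat_mult_left_right_inverse[OF p(1) X p(2)] by simp
qed

subsection \<open>Kronecker products and traces\<close>

lemma kronecker_carrier:
  "A \<in> carrier_mat a b \<Longrightarrow> B \<in> carrier_mat c d \<Longrightarrow> kronecker A B \<in> carrier_mat (a * c) (b * d)"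
  by (auto simp: kronecker_def)

lemma kronecker_entry:
  assumes "A \<in> carrier_mat r r" "B \<in> carrier_mat r r" "i < r" "l < r" "j < r" "k < r"
  shows "kronecker A B $$ (i * r + l, j * r + k) = A $$ (i, j) * B $$ (l, k)"
  using assms pair_index_less[of i r l] pair_index_less[of j r k] by (auto simp: kronecker_def)

lemma kronecker_mult:
  assumes "A \<in> carrier_mat r r" "B \<in> carrier_mat r r" "C \<in> carrier_mat r r" "D \<in> carrier_mat r r"
  shows "kronecker A B * kronecker C D = kronecker (A * C) (B * D)"
proof (rule eq_mat_pair_index[of _ r])
  fix i l j k assume ix: "i < r" "l < r" "j < r" "k < r"
  have "(kronecker A B * kronecker C D) $$ (i * r + l, j * r + k) =
    (\<Sum>p<r. \<Sum>q<r. kronecker A B $$ (i * r + l, p * r + q) * kronecker C D $$ (p * r + q, j * r + k))"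
    using ix assms by (intro mult_mat_pair_entry[of _ "r * r" _ _ "r * r"] kronecker_carrier pair_index_less)
  also have "\<dots> = (\<Sum>p<r. \<Sum>q<r. (A $$ (i, p) * C $$ (p, j)) * (B $$ (l, q) * D $$ (q, k)))"
    using ix assms by (intro sum.cong refl) (auto simp: kronecker_entry)
  also have "\<dots> = (A * C) $$ (i, j) * (B * D) $$ (l, k)"
    using ix by (simp add: mult_mat_entry[OF assms(1,3)] mult_mat_entry[OF assms(2,4)] sum_product)
  finally show "(kronecker A B * kronecker C D) $$ (i * r + l, j * r + k) =
      kronecker (A * C) (B * D) $$ (i * r + l, j * r + k)"
    using ix assms by (simp add: kronecker_entry[OF mult_carrier_mat mult_carrier_mat])
qed (use assms in \<open>auto intro!: kronecker_carrier mult_carrier_mat\<close>)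

lemma kronecker_one: "kronecker (1\<^sub>m r) (1\<^sub>m r) = 1\<^sub>m (r * r)"
  by (rule eq_mat_pair_index[of _ r])
    (auto simp: kronecker_entry pair_index_less pair_index_eq_iff intro!: kronecker_carrier)

lemma mat_trace_mult:
  assumes "A \<in> carrier_mat r r" "B \<in> carrier_mat r r"
  shows "mat_trace (A * B) = (\<Sum>i<r. \<Sum>j<r. A $$ (i, j) * B $$ (j, i))"
proof -
  have "mat_trace (A * B) = (\<Sum>i<r. (A * B) $$ (i, i))"
    using assms by (auto simp: mat_trace_def diag_mat_def interv_sum_list_conv_sum_set_nat atLeast0LessThan)
  then show ?thesis using mult_mat_entry[OF assms] by simp
qed

lemma mat_trace_mult_commute:
  assumes "A \<in> carrier_mat r r" "B \<in> carrier_mat r r"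
  shows "mat_trace (A * B) = mat_trace (B * A)"
  unfolding mat_trace_mult[OF assms] mat_trace_mult[OF assms(2,1)]
  by (subst sum.swap) (simp add: mult.commute)

subsection \<open>Polynomial functions of finitely many complex variables\<close>

text \<open>What is used of polynomials is closure under sums and products, measurability and
  restriction to a coordinate line; with an inductive predicate each of these is a single induction.
  The functions live on the whole space \<open>'i \<Rightarrow> complex\<close> but depend on the
  coordinates in \<open>I\<close> alone.\<close>

inductive polyfun :: "'i set \<Rightarrow> (('i \<Rightarrow> complex) \<Rightarrow> complex) \<Rightarrow> bool" for I where
  const: "polyfun I (\<lambda>w. c)"
| coord: "x \<in> I \<Longrightarrow> polyfun I (\<lambda>w. w x)"
| add: "polyfun I f \<Longrightarrow> polyfun I g \<Longrightarrow> polyfun I (\<lambda>w. f w + g w)"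
| mult: "polyfun I f \<Longrightarrow> polyfun I g \<Longrightarrow> polyfun I (\<lambda>w. f w * g w)"

lemma polyfun_sum: "(\<And>x. x \<in> S \<Longrightarrow> polyfun I (f x)) \<Longrightarrow> polyfun I (\<lambda>w. \<Sum>x\<in>S. f x w)"
  by (induction S rule: infinite_finite_induct) (auto intro: polyfun.intros)

lemma polyfun_prod: "(\<And>x. x \<in> S \<Longrightarrow> polyfun I (f x)) \<Longrightarrow> polyfun I (\<lambda>w. \<Prod>x\<in>S. f x w)"
  by (induction S rule: infinite_finite_induct) (auto intro: polyfun.intros)

lemma polyfun_cong: "polyfun I f \<Longrightarrow> (\<And>x. x \<in> I \<Longrightarrow> w x = w' x) \<Longrightarrow> f w = f w'"
  by (induction rule: polyfun.induct) auto

lemma polyfun_measurable: "polyfun I f \<Longrightarrow> f \<in> borel_measurable (\<Pi>\<^sub>M i\<in>I. lborel)"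
proof (induction rule: polyfun.induct)
  case (coord x)
  then show ?case using measurable_component_singleton[of x I "\<lambda>_. lborel"]
    by (simp add: measurable_lborel1 cong: measurable_cong_sets)
qed auto

lemma polyfun_fix_coordinate:
  "polyfun I f \<Longrightarrow> I \<subseteq> insert i J \<Longrightarrow> polyfun J (\<lambda>w. f (w(i := c)))"
proof (induction rule: polyfun.induct)
  case (coord x)
  then show ?case by (cases "x = i") (auto intro: polyfun.intros)
qed (auto intro: polyfun.intros)

lemma polyfun_univariate: "polyfun I f \<Longrightarrow> \<exists>p. \<forall>z. f (w(i := z)) = poly p z"
proof (induction rule: polyfun.induct)
  case (const c) show ?case by (intro exI[of _ "[:c:]"]) simp
next
  case (coord x)
  show ?case
  proof (cases "x = i")
    case True then show ?thesis by (intro exI[of _ "[:0, 1:]"]) simp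
  next
    case False then show ?thesis by (intro exI[of _ "[:w x:]"]) simp
  qed
next
  case (add f g) then show ?case by (metis poly_add)
next
  case (mult f g) then show ?case by (metis poly_mult)
qed

text \<open>Induction on the number of variables with Tonelli. Freezing coordinate \<open>i\<close>
  at its value in the witness leaves a polynomial that is nonzero at the same witness; wherever that
  one does not vanish, the restriction to the line in direction \<open>i\<close> is a nonzero
  univariate polynomial and has finitely many roots.\<close>

lemma AE_polyfun_nonzero:
  assumes "finite I" "polyfun I f" "f w\<^sub>0 \<noteq> 0"
  shows "AE w in (\<Pi>\<^sub>M i\<in>I. lborel). f w \<noteq> 0"
  using assms
proof (induction I arbitrary: f rule: finite_induct)
  case empty
  have "f w \<noteq> 0" for w using polyfun_cong[OF empty(1), of w w\<^sub>0] empty(2) by simp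
  then show ?case by simp
next
  case (insert i J)
  interpret product_sigma_finite "\<lambda>_. lborel :: complex measure" by unfold_locales
  let ?M = "\<lambda>I. \<Pi>\<^sub>M i\<in>I. (lborel :: complex measure)"
  have f[measurable]: "f \<in> borel_measurable (?M (insert i J))" by (rule polyfun_measurable) fact
  let ?h = "\<lambda>w. indicator {0} (f w) :: ennreal"
  have inner: "(\<integral>\<^sup>+ y. ?h (x(i := y)) \<partial>lborel) = 0" if x: "f (x(i := w\<^sub>0 i)) \<noteq> 0" for x
  proof -
    obtain p where p: "\<And>z. f (x(i := z)) = poly p z"
      using polyfun_univariate[OF insert.prems(1)] by blast
    have "p \<noteq> 0" using x p by auto
    then have fin: "finite {z. poly p z = 0}" by (rule poly_roots_finite)
    have "AE z in lborel. z \<notin> {z. poly p z = 0}"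
      using fin by (intro AE_not_in finite_imp_null_set_lborel)
    then have "AE z in lborel. ?h (x(i := z)) = 0"
      by eventually_elim (simp add: p)
    then show ?thesis by (subst nn_integral_cong_AE[of _ "\<lambda>_. 0"]) auto
  qed
  have "AE x in ?M J. f (x(i := w\<^sub>0 i)) \<noteq> 0"
    using insert.prems by (intro insert.IH polyfun_fix_coordinate[of "insert i J"]) auto
  then have ae: "AE x in ?M J. (\<integral>\<^sup>+ y. ?h (x(i := y)) \<partial>lborel) = 0"
    by eventually_elim (rule inner)
  have "(\<integral>\<^sup>+ w. ?h w \<partial>?M (insert i J)) = (\<integral>\<^sup>+ x. (\<integral>\<^sup>+ y. ?h (x(i := y)) \<partial>lborel) \<partial>?M J)"
    using insert.hyps by (intro product_nn_integral_insert) auto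
  also have "\<dots> = (\<integral>\<^sup>+ x. 0 \<partial>?M J)" by (rule nn_integral_cong_AE) fact
  finally have "(\<integral>\<^sup>+ w. ?h w \<partial>?M (insert i J)) = 0" by simp
  then have "AE w in ?M (insert i J). ?h w = 0"
    by (subst (asm) nn_integral_0_iff_AE) auto
  then show ?case by eventually_elim (auto simp: indicator_def split: if_splits)
qed

section \<open>Matrices with polynomial entries\<close>

definition polymat :: "'i set \<Rightarrow> nat \<Rightarrow> nat \<Rightarrow> (('i \<Rightarrow> complex) \<Rightarrow> complex mat) \<Rightarrow> bool" where
  "polymat I m k M \<longleftrightarrow>
     (\<forall>w. M w \<in> carrier_mat m k) \<and> (\<forall>i<m. \<forall>j<k. polyfun I (\<lambda>w. M w $$ (i, j)))"

lemma polymatI: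
  assumes "\<And>w. M w \<in> carrier_mat m k"
    and "\<And>i j. i < m \<Longrightarrow> j < k \<Longrightarrow> polyfun I (\<lambda>w. M w $$ (i, j))"
  shows "polymat I m k M"
  using assms by (simp add: polymat_def)

lemma polymatD:
  assumes "polymat I m k M"
  shows "M w \<in> carrier_mat m k" "i < m \<Longrightarrow> j < k \<Longrightarrow> polyfun I (\<lambda>w. M w $$ (i, j))"
  using assms by (simp_all add: polymat_def)

lemma polymat_mult:
  assumes M: "polymat I m n M" and N: "polymat I n k N"
  shows "polymat I m k (\<lambda>w. M w * N w)"
proof (rule polymatI)
  show "M w * N w \<in> carrier_mat m k" for w using polymatD(1)[OF M, of w] polymatD(1)[OF N, of w] by auto
  fix i j assume "i < m" "j < k"
  then show "polyfun I (\<lambda>w. (M w * N w) $$ (i, j))"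
    by (subst mult_mat_entry[OF polymatD(1)[OF M] polymatD(1)[OF N]])
      (auto intro!: polyfun_sum polyfun.mult polymatD(2)[OF M] polymatD(2)[OF N])
qed

lemma polymat_const: "A \<in> carrier_mat m k \<Longrightarrow> polymat I m k (\<lambda>w. A)"
  by (auto intro!: polymatI polyfun.const)

lemma polymat_det:
  assumes M: "polymat I n n M"
  shows "polyfun I (\<lambda>w. det (M w))"
proof -
  have "det (M w) = (\<Sum>p\<in>{p. p permutes {0..<n}}. signof p * (\<Prod>i=0..<n. M w $$ (i, p i)))" for w
    by (rule det_def'[OF polymatD(1)[OF M]])
  then show ?thesis
    by (auto intro!: polyfun_sum polyfun.mult polyfun.const polyfun_prod polymatD(2)[OF M]
)
qed

lemma polymat_adj:
  assumes M: "polymat I n n M"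
  shows "polymat I n n (\<lambda>w. adj_mat (M w))"
proof (rule polymatI)
  note c = polymatD(1)[OF M]
  show "adj_mat (M w) \<in> carrier_mat n n" for w by (rule adj_mat(1)[OF c])
  fix i j assume ij: "i < n" "j < n"
  have "polymat I (n - 1) (n - 1) (\<lambda>w. mat_delete (M w) j i)"
  proof (rule polymatI)
    show "mat_delete (M w) j i \<in> carrier_mat (n - 1) (n - 1)" for w
      by (rule mat_delete_carrier[OF c])
    fix i' j' assume "i' < n - 1" "j' < n - 1"
    then show "polyfun I (\<lambda>w. mat_delete (M w) j i $$ (i', j'))"
      using c by (auto simp: mat_delete_def carrier_matD[OF c] intro!: polymatD(2)[OF M])
  qed
  from polymat_det[OF this] show "polyfun I (\<lambda>w. adj_mat (M w) $$ (i, j))"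
    using ij by (auto simp: adj_mat_def cofactor_def carrier_matD[OF c] intro!: polyfun.intros)
qed

lemma polymat_pow: "polymat I n n M \<Longrightarrow> polymat I n n (\<lambda>w. M w ^\<^sub>m k)"
proof (induction k)
  case 0
  have "M w ^\<^sub>m 0 = 1\<^sub>m n" for w by (simp add: carrier_matD[OF polymatD(1)[OF 0]])
  then show ?case by (simp add: polymat_const)
next
  case (Suc k)
  then show ?case by (simp add: polymat_mult)
qed

lemma polymat_kronecker:
  assumes M: "polymat I r r M" and N: "polymat I r r N"
  shows "polymat I (r * r) (r * r) (\<lambda>w. kronecker (M w) (N w))"
proof (rule polymatI)
  show "kronecker (M w) (N w) \<in> carrier_mat (r * r) (r * r)" for w
    by (intro kronecker_carrier polymatD(1)[OF M] polymatD(1)[OF N])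
  fix i j assume ij: "i < r * r" "j < r * r"
  note less = pair_index_div_less[OF ij(1)] pair_index_div_less[OF ij(2)]
  show "polyfun I (\<lambda>w. kronecker (M w) (N w) $$ (i, j))"
    using ij less by (auto simp: kronecker_def carrier_matD[OF polymatD(1)[OF M]]
        carrier_matD[OF polymatD(1)[OF N]] intro!: polyfun.mult polymatD(2)[OF M] polymatD(2)[OF N])
qed

lemma coeff_mult_polyfun:
  assumes "\<And>i. polyfun I (\<lambda>w. coeff (F w) i)" "\<And>i. polyfun I (\<lambda>w. coeff (G w) i)"
  shows "polyfun I (\<lambda>w. coeff (F w * G w) i)"
  unfolding coeff_mult by (intro polyfun_sum polyfun.mult assms)

lemma coeff_prod_polyfun:
  assumes "\<And>x i. x \<in> S \<Longrightarrow> polyfun I (\<lambda>w. coeff (F x w) i)"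
  shows "polyfun I (\<lambda>w. coeff (\<Prod>x\<in>S. F x w) i)"
  using assms
proof (induction S arbitrary: i rule: infinite_finite_induct)
  case (insert x S)
  then show ?case by (simp add: coeff_mult_polyfun)
qed (auto intro: polyfun.const)

text \<open>The Leibniz formula is applied over the ring of univariate polynomials, so the
  coefficients of the determinant are built from coefficients of entries by sums and products. Two
  of the genericity conditions evaluate a characteristic polynomial at a matrix and need
  this.\<close>

lemma coeff_char_poly_polyfun:
  assumes M: "polymat I n n M"
  shows "polyfun I (\<lambda>w. coeff (char_poly (M w)) i)"
proof -
  note c = polymatD(1)[OF M]
  have entry: "char_poly_matrix (M w) $$ (a, b) = (if a = b then [:0, 1:] else 0) + [: - (M w $$ (a, b)) :]"
    if "a < n" "b < n" for w a b
    using that c[of w] by (auto simp: char_poly_matrix_def)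
  have e: "polyfun I (\<lambda>w. coeff (char_poly_matrix (M w) $$ (a, b)) i)" if "a < n" "b < n" for a b i
  proof -
    have "coeff (char_poly_matrix (M w) $$ (a, b)) i =
       coeff (if a = b then [:0, 1:] else 0) i + (if i = 0 then -1 else 0) * M w $$ (a, b)" for w
      by (simp only: entry[OF that] coeff_add) (simp add: coeff_pCons split: nat.splits)
    then show ?thesis using that
      by (simp only:) (intro polyfun.add polyfun.mult polyfun.const polymatD(2)[OF M])
  qed
  have "char_poly (M w) = (\<Sum>p\<in>{p. p permutes {0..<n}}.
      signof p * (\<Prod>a=0..<n. char_poly_matrix (M w) $$ (a, p a)))" for w
    unfolding char_poly_def using c by (intro det_def') simp
  moreover have "polyfun I (\<lambda>w. coeff (signof p * (\<Prod>a=0..<n. char_poly_matrix (M w) $$ (a, p a))) i)"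
    if "p permutes {0..<n}" for p
    using that by (intro coeff_mult_polyfun coeff_prod_polyfun polyfun.const e) auto
  ultimately show ?thesis
    by (simp only: coeff_sum) (auto intro!: polyfun_sum)
qed

subsection \<open>Polynomials in a matrix\<close>

text \<open>The range of summation is fixed by \<open>N\<close> rather than by the degree of
  \<open>p\<close>, so that the entries remain polynomial functions when \<open>p\<close> and
  \<open>A\<close> both vary with the point. The value is p(A) as soon as \<open>N\<close> bounds
  the degree.\<close>

definition mat_poly :: "nat \<Rightarrow> complex poly \<Rightarrow> complex mat \<Rightarrow> complex mat" where
  "mat_poly N p A = mat (dim_row A) (dim_row A) (\<lambda>(i, j). \<Sum>k\<le>N. coeff p k * (A ^\<^sub>m k) $$ (i, j))"

lemma mat_poly_carrier [simp]: "A \<in> carrier_mat n n \<Longrightarrow> mat_poly N p A \<in> carrier_mat n n"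
  by (auto simp: mat_poly_def)

lemma polymat_mat_poly:
  assumes "polymat I n n M" "\<And>i. polyfun I (\<lambda>w. coeff (p w) i)"
  shows "polymat I n n (\<lambda>w. mat_poly N (p w) (M w))"
proof (rule polymatI)
  show "mat_poly N (p w) (M w) \<in> carrier_mat n n" for w using polymatD(1)[OF assms(1)] by simp
  fix i j assume ij: "i < n" "j < n"
  then show "polyfun I (\<lambda>w. mat_poly N (p w) (M w) $$ (i, j))"
    by (auto simp: mat_poly_def carrier_matD[OF polymatD(1)[OF assms(1)]]
        intro!: polyfun_sum polyfun.mult assms(2) polymatD(2)[OF polymat_pow[OF assms(1)]])
qed

lemma pow_mat_eigenvector:
  assumes A: "(A :: complex mat) \<in> carrier_mat n n" and v: "v \<in> carrier_vec n" and e: "A *\<^sub>v v = x \<cdot>\<^sub>v v"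
  shows "(A ^\<^sub>m k) *\<^sub>v v = x ^ k \<cdot>\<^sub>v v"
proof (induction k)
  case 0 then show ?case using A v by auto
next
  case (Suc k)
  have Ak: "A ^\<^sub>m k \<in> carrier_mat n n" using A by simp
  have "(A ^\<^sub>m Suc k) *\<^sub>v v = (A ^\<^sub>m k) *\<^sub>v (A *\<^sub>v v)"
    using assoc_mult_mat_vec[OF Ak A v] by simp
  also have "\<dots> = x \<cdot>\<^sub>v ((A ^\<^sub>m k) *\<^sub>v v)" unfolding e using mult_mat_vec[OF Ak v] by simp
  finally show ?case using Suc v by (auto simp: smult_smult_assoc)
qed

lemma mat_poly_eigenvector:
  assumes A: "A \<in> carrier_mat n n" and v: "v \<in> carrier_vec n" and e: "A *\<^sub>v v = x \<cdot>\<^sub>v v"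
    and deg: "degree p \<le> N"
  shows "mat_poly N p A *\<^sub>v v = poly p x \<cdot>\<^sub>v v"
proof (rule eq_vecI)
  fix i assume "i < dim_vec (poly p x \<cdot>\<^sub>v v)"
  then have i: "i < n" using v by simp
  have pow_entry: "((A ^\<^sub>m k) *\<^sub>v v) $ i = (\<Sum>j<n. (A ^\<^sub>m k) $$ (i, j) * v $ j)" for k
    using A by (intro mult_mat_vec_entry[OF _ v i]) simp
  have "(mat_poly N p A *\<^sub>v v) $ i = (\<Sum>j<n. (\<Sum>k\<le>N. coeff p k * (A ^\<^sub>m k) $$ (i, j)) * v $ j)"
    using i A by (subst mult_mat_vec_entry[OF mat_poly_carrier[OF A] v i]) (auto simp: mat_poly_def)
  also have "\<dots> = (\<Sum>k\<le>N. coeff p k * (\<Sum>j<n. (A ^\<^sub>m k) $$ (i, j) * v $ j))"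
    by (simp add: sum_distrib_right sum_distrib_left mult_ac) (rule sum.swap)
  also have "\<dots> = (\<Sum>k\<le>N. coeff p k * ((A ^\<^sub>m k) *\<^sub>v v) $ i)"
    by (simp only: pow_entry)
  also have "\<dots> = (\<Sum>k\<le>N. coeff p k * x ^ k) * v $ i"
    using i v by (simp add: pow_mat_eigenvector[OF A v e] sum_distrib_left mult_ac)
  also have "(\<Sum>k\<le>N. coeff p k * x ^ k) = poly p x"
    unfolding poly_altdef by (rule sum.mono_neutral_right) (use deg in \<open>auto simp: coeff_eq_0\<close>)
  finally show "(mat_poly N p A *\<^sub>v v) $ i = (poly p x \<cdot>\<^sub>v v) $ i" using i v by simp
qed (use A v in \<open>auto simp: mat_poly_def\<close>)

subsection \<open>Tensor rings\<close>

lemma slice_prod_Nil [simp]: "slice_prod r Q \<gamma> [] = 1\<^sub>m r"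
  and slice_prod_Cons [simp]: "slice_prod r Q \<gamma> (k # ks) = Q k (\<gamma> k) * slice_prod r Q \<gamma> ks"
  by (simp_all add: slice_prod_def)

lemma slice_prod_carrier:
  "(\<And>k. k \<in> set ks \<Longrightarrow> Q k (\<gamma> k) \<in> carrier_mat r r) \<Longrightarrow> slice_prod r Q \<gamma> ks \<in> carrier_mat r r"
  by (induction ks) (auto intro!: mult_carrier_mat)

lemma slice_prod_append:
  assumes "\<And>k. k \<in> set (xs @ ys) \<Longrightarrow> Q k (\<gamma> k) \<in> carrier_mat r r"
  shows "slice_prod r Q \<gamma> (xs @ ys) = slice_prod r Q \<gamma> xs * slice_prod r Q \<gamma> ys"
  using assms
proof (induction xs)
  case Nil
  then have "slice_prod r Q \<gamma> ys \<in> carrier_mat r r" by (intro slice_prod_carrier) auto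
  then show ?case by simp
next
  case (Cons x xs)
  have "Q x (\<gamma> x) \<in> carrier_mat r r" "slice_prod r Q \<gamma> xs \<in> carrier_mat r r"
    "slice_prod r Q \<gamma> ys \<in> carrier_mat r r" using Cons.prems by (auto intro!: slice_prod_carrier)
  then show ?case using Cons by (simp add: assoc_mult_mat[of _ r r])
qed

lemma slice_prod_cong:
  "(\<And>k. k \<in> set ks \<Longrightarrow> Q k (\<gamma> k) = Q' k (\<gamma>' k)) \<Longrightarrow> slice_prod r Q \<gamma> ks = slice_prod r Q' \<gamma>' ks"
  by (induction ks) auto

lemma det_slice_prod:
  assumes "\<And>k. k \<in> set ks \<Longrightarrow> Q k (\<gamma> k) \<in> carrier_mat r r"
    and "\<And>k. k \<in> set ks \<Longrightarrow> det (Q k (\<gamma> k)) \<noteq> 0"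
  shows "det (slice_prod r Q \<gamma> ks) \<noteq> 0"
  using assms
proof (induction ks)
  case (Cons k ks)
  have "Q k (\<gamma> k) \<in> carrier_mat r r" "slice_prod r Q \<gamma> ks \<in> carrier_mat r r"
    using Cons.prems(1) by (auto intro!: slice_prod_carrier)
  then show ?case using Cons by (simp add: det_mult[of _ r])
qed simp

lemma mat_inv_mult_cancel:
  assumes "L \<in> carrier_mat n n" "det L \<noteq> 0" "B \<in> carrier_mat n k"
  shows "L * (mat_inv L * B) = B" "mat_inv L * (L * B) = B"
  using assoc_mult_mat[OF assms(1) mat_inv(1)[OF assms(1,2)] assms(3)]
    assoc_mult_mat[OF mat_inv(1)[OF assms(1,2)] assms(1,3)] mat_inv[OF assms(1,2)] assms by auto

text \<open>Telescoping: each \<open>L (Suc k)\<close> meets its inverse in the next slice and only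
  the two outermost matrices survive. The induction peels slices off the left end, because
  \<open>slice_prod\<close> is a right fold.\<close>

lemma slice_prod_gauge:
  assumes Q: "\<And>k. Q k (\<gamma> k) \<in> carrier_mat r r"
    and L: "\<And>k. a \<le> k \<Longrightarrow> k \<le> b \<Longrightarrow> L k \<in> carrier_mat r r \<and> det (L k) \<noteq> 0"
    and Qh: "\<And>k. a \<le> k \<Longrightarrow> k < b \<Longrightarrow> Qh k (\<gamma> k) = mat_inv (L k) * Q k (\<gamma> k) * L (Suc k)"
    and "a \<le> b"
  shows "slice_prod r Qh \<gamma> [a..<b] = mat_inv (L a) * slice_prod r Q \<gamma> [a..<b] * L b"
  using \<open>a \<le> b\<close> L Qh
proof (induction a rule: inc_induct)
  case base
  then have "L b \<in> carrier_mat r r" "det (L b) \<noteq> 0" by auto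
  then show ?case using mat_inv[of "L b" r] by simp
next
  case (step a)
  let ?P = "slice_prod r Q \<gamma> [Suc a..<b]"
  have IH: "slice_prod r Qh \<gamma> [Suc a..<b] = mat_inv (L (Suc a)) * ?P * L b"
    using step by (intro step.IH) auto
  have La: "L a \<in> carrier_mat r r" "det (L a) \<noteq> 0" and Lb: "L b \<in> carrier_mat r r"
    and LS: "L (Suc a) \<in> carrier_mat r r" "det (L (Suc a)) \<noteq> 0"
    using step.hyps step.prems(1)[of a] step.prems(1)[of b] step.prems(1)[of "Suc a"] by auto
  note ia = mat_inv(1)[OF La] and iS = mat_inv(1)[OF LS]
  have P: "?P \<in> carrier_mat r r" using Q by (intro slice_prod_carrier)
  have c: "mat_inv (L a) * Q a (\<gamma> a) \<in> carrier_mat r r" "?P * L b \<in> carrier_mat r r"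
    using ia Q[of a] P Lb by auto
  have "slice_prod r Qh \<gamma> [a..<b] = Qh a (\<gamma> a) * slice_prod r Qh \<gamma> [Suc a..<b]"
    using step.hyps by (simp add: upt_conv_Cons)
  also have "\<dots> = (mat_inv (L a) * Q a (\<gamma> a) * L (Suc a)) * (mat_inv (L (Suc a)) * (?P * L b))"
    using step.prems(2)[of a] step.hyps IH assoc_mult_mat[OF iS P Lb] by simp
  also have "\<dots> = (mat_inv (L a) * Q a (\<gamma> a)) * (L (Suc a) * (mat_inv (L (Suc a)) * (?P * L b)))"
    by (rule assoc_mult_mat[OF c(1) LS(1) mult_carrier_mat[OF iS c(2)]])
  also have "\<dots> = (mat_inv (L a) * Q a (\<gamma> a)) * (?P * L b)"
    by (simp add: mat_inv_mult_cancel(1)[OF LS c(2)])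
  also have "\<dots> = mat_inv (L a) * (Q a (\<gamma> a) * ?P) * L b"
    using assoc_mult_mat[OF c(1) P Lb] assoc_mult_mat[OF ia Q[of a] P] by simp
  finally show ?case using step.hyps by (simp add: upt_conv_Cons)
qed

section \<open>Unfoldings and selected columns\<close>

lemma unfold_angle_carrier [simp]: "unfold_angle m r C \<in> carrier_mat m (r * r)"
  by (simp add: unfold_angle_def)

lemma unfold_angle_entry:
  "a < m \<Longrightarrow> i < r \<Longrightarrow> j < r \<Longrightarrow> unfold_angle m r C $$ (a, i * r + j) = C a $$ (i, j)"
  by (simp add: unfold_angle_def pair_index_less)

lemma unfold_angle_eqD:
  assumes "unfold_angle m r C = unfold_angle m r C'" "a < m"
    "C a \<in> carrier_mat r r" "C' a \<in> carrier_mat r r"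
  shows "C a = C' a"
proof (rule eq_matI)
  fix i j assume "i < dim_row (C' a)" "j < dim_col (C' a)"
  then have "i < r" "j < r" using assms by auto
  then show "C a $$ (i, j) = C' a $$ (i, j)"
    using unfold_angle_entry[OF assms(2), of i r j] assms(1) by metis
qed (use assms in auto)

lemma pick_index_subset:
  assumes "index_subset m r G" "q < r * r"
  shows "pick G q \<in> G" "pick G q < m"
proof -
  show "pick G q \<in> G" using assms by (intro pick_in_set_le) (simp add: index_subset_def power2_eq_square)
  then show "pick G q < m" using assms by (auto simp: index_subset_def)
qed

lemma restrict_cols_carrier:
  assumes "index_subset m r G" "A \<in> carrier_mat k m"
  shows "restrict_cols A G \<in> carrier_mat k (r * r)"
proof -
  have "{j. j < m \<and> j \<in> G} = G" using assms by (auto simp: index_subset_def)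
  then show ?thesis using assms
    by (intro carrier_matI) (auto simp: restrict_cols_def dim_submatrix index_subset_def power2_eq_square)
qed

lemma restrict_cols_entry:
  assumes "index_subset m r G" "A \<in> carrier_mat k m" "i < k" "q < r * r"
  shows "restrict_cols A G $$ (i, q) = A $$ (i, pick G q)"
proof -
  have "{j. j < m \<and> j \<in> G} = G" using assms by (auto simp: index_subset_def)
  then show ?thesis using assms
    by (auto simp: restrict_cols_def submatrix_index pick_UNIV index_subset_def power2_eq_square)
qed

text \<open>Column \<open>q\<close> lists the slice \<open>C (pick G q)\<close> column by column,
  that is, it is the usual vec of that slice. The matrix is square because \<open>G\<close> has
  \<open>r * r\<close> elements.\<close>

abbreviation slice_columns :: "nat \<Rightarrow> nat \<Rightarrow> core \<Rightarrow> nat set \<Rightarrow> complex mat" where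
  "slice_columns m r C G \<equiv> restrict_cols (transpose_mat (unfold_square m r C)) G"

lemma slice_columns_carrier: "index_subset m r G \<Longrightarrow> slice_columns m r C G \<in> carrier_mat (r * r) (r * r)"
  by (intro restrict_cols_carrier[of m]) (auto simp: unfold_square_def)

lemma slice_columns_entry:
  assumes "index_subset m r G" "i < r" "j < r" "q < r * r"
  shows "slice_columns m r C G $$ (i * r + j, q) = C (pick G q) $$ (j, i)"
  using assms pick_index_subset[OF assms(1,4)] pair_index_less[OF assms(2,3)]
  by (subst restrict_cols_entry[OF assms(1), of _ "r * r"]) (auto simp: unfold_square_def)

text \<open>The identity vec(M X L) = (L^T \<otimes> M) vec X, applied to every selected
  slice.\<close>

lemma kronecker_slice_columns_entry:
  assumes G: "index_subset m r G" and ix: "i < r" "j < r" "q < r * r"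
    and L: "L \<in> carrier_mat r r" and M: "M \<in> carrier_mat r r" and C: "C (pick G q) \<in> carrier_mat r r"
  shows "(kronecker (transpose_mat L) M * slice_columns m r C G) $$ (i * r + j, q) =
    (M * C (pick G q) * L) $$ (j, i)"
proof -
  have LT: "transpose_mat L \<in> carrier_mat r r" using L by simp
  have "(kronecker (transpose_mat L) M * slice_columns m r C G) $$ (i * r + j, q) =
    (\<Sum>p<r. \<Sum>l<r. kronecker (transpose_mat L) M $$ (i * r + j, p * r + l) *
       slice_columns m r C G $$ (p * r + l, q))"
    using ix by (intro mult_mat_pair_entry[OF kronecker_carrier[OF LT M] slice_columns_carrier[OF G]])
      (auto simp: pair_index_less)
  also have "\<dots> = (\<Sum>p<r. \<Sum>l<r. (M $$ (j, l) * C (pick G q) $$ (l, p)) * L $$ (p, i))"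
    using ix L by (intro sum.cong refl) (auto simp: kronecker_entry[OF LT M] slice_columns_entry[OF G])
  also have "\<dots> = (\<Sum>p<r. (M * C (pick G q)) $$ (j, p) * L $$ (p, i))"
    using ix by (simp add: mult_mat_entry[OF M C] sum_distrib_right)
  also have "\<dots> = (M * C (pick G q) * L) $$ (j, i)"
    using ix M C L by (subst mult_mat_entry[of _ r r _ r]) auto
  finally show ?thesis .
qed

lemma kronecker_one_slice_columns_entry:
  assumes G: "index_subset m r G" and ix: "i < r" "j < r" "q < r * r"
    and M: "M \<in> carrier_mat r r" and C: "C (pick G q) \<in> carrier_mat r r"
  shows "(kronecker (1\<^sub>m r) M * slice_columns m r C G) $$ (i * r + j, q) = (M * C (pick G q)) $$ (j, i)"
  using kronecker_slice_columns_entry[where C = C, OF G ix one_carrier_mat M C] M C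
  by (simp add: right_mult_one_mat[of _ r r] transpose_one)

lemma slice_columns_gauge:
  assumes G: "index_subset m r G" and L: "L \<in> carrier_mat r r" and M: "M \<in> carrier_mat r r"
    and C: "\<And>a. a < m \<Longrightarrow> C a \<in> carrier_mat r r" and C': "\<And>a. a < m \<Longrightarrow> C' a = M * C a * L"
  shows "slice_columns m r C' G = kronecker (transpose_mat L) M * slice_columns m r C G"
proof (rule eq_mat_pair_index[of _ r])
  fix i l j k assume ix: "i < r" "l < r" "j < r" "k < r"
  have q: "j * r + k < r * r" using ix by (simp add: pair_index_less)
  note p = pick_index_subset[OF G q]
  show "slice_columns m r C' G $$ (i * r + l, j * r + k) =
    (kronecker (transpose_mat L) M * slice_columns m r C G) $$ (i * r + l, j * r + k)"
    unfolding kronecker_slice_columns_entry[where C = C, OF G ix(1,2) q L M C[OF p(2)]]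
      slice_columns_entry[OF G ix(1,2) q] C'[OF p(2)] ..
qed (use slice_columns_carrier[OF G] kronecker_carrier[of "transpose_mat L" r r M r r] L M in
    \<open>auto intro!: mult_carrier_mat\<close>)

lemma det_kronecker_nonzero:
  assumes A: "A \<in> carrier_mat r r" "det A \<noteq> 0" and B: "B \<in> carrier_mat r r" "det B \<noteq> 0"
  shows "det (kronecker A B) \<noteq> 0"
proof (rule det_nonzero_if_right_inverse)
  note a = mat_inv[OF A] and b = mat_inv[OF B]
  show "kronecker A B * kronecker (mat_inv A) (mat_inv B) = 1\<^sub>m (r * r)"
    using kronecker_mult[OF A(1) B(1) a(1) b(1)] a b by (simp add: kronecker_one)
qed (use assms mat_inv[OF A] mat_inv[OF B] in \<open>auto intro!: kronecker_carrier\<close>)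

text \<open>A row of the first unfolding lists a slice by rows, a column of the second factor lists
  a matrix by columns; their scalar product is therefore the trace of a product. This is why the
  algorithm works with two different unfoldings.\<close>

lemma unfold_angle_slice_columns_entry:
  assumes G: "index_subset m' r G" and a: "a < m" and q: "q < r * r"
    and C: "C a \<in> carrier_mat r r" and M: "M \<in> carrier_mat r r" and P: "P (pick G q) \<in> carrier_mat r r"
  shows "(unfold_angle m r C * (kronecker (1\<^sub>m r) M * slice_columns m' r P G)) $$ (a, q) =
    mat_trace (C a * (M * P (pick G q)))"
proof -
  have "kronecker (1\<^sub>m r) M * slice_columns m' r P G \<in> carrier_mat (r * r) (r * r)"
    using M by (intro mult_carrier_mat[OF kronecker_carrier slice_columns_carrier[OF G]]) auto
  from mult_mat_pair_entry[OF unfold_angle_carrier this a q]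
  have "(unfold_angle m r C * (kronecker (1\<^sub>m r) M * slice_columns m' r P G)) $$ (a, q) =
    (\<Sum>i<r. \<Sum>j<r. C a $$ (i, j) * (M * P (pick G q)) $$ (j, i))"
    using a q by (simp add: unfold_angle_entry kronecker_one_slice_columns_entry[where C = P, OF G _ _ q M P])
  then show ?thesis using mat_trace_mult[OF C, of "M * P (pick G q)"] M P by simp
qed

text \<open>The pointwise setting: one point of the parameter space at which the conditions that do
  not mention index pairs hold. Conditions on index pairs are passed to the individual lemmas. Full
  column rank of the first unfolding is recorded by the determinant of its leading
  \<open>r * r\<close> rows, which is a polynomial.\<close>

locale tensor_ring =
  fixes d r :: nat and n :: "nat \<Rightarrow> nat" and Q :: "nat \<Rightarrow> core" and T :: "(nat \<Rightarrow> nat) \<Rightarrow> complex"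
  assumes d: "3 \<le> d" and r: "2 \<le> r" and n: "k \<in> {1..d} \<Longrightarrow> r\<^sup>2 \<le> n k"
    and Q [simp]: "Q k a \<in> carrier_mat r r"
    and T: "\<delta> \<in> multi_indices {1..d} n \<Longrightarrow> T \<delta> = tr_tensor d r Q \<delta>"
    and det_slice: "k \<in> {1..d} \<Longrightarrow> a < n k \<Longrightarrow> det (Q k a) \<noteq> 0"
    and det_slice_columns: "k \<in> {1..d} \<Longrightarrow> index_subset (n k) r G \<Longrightarrow> det (slice_columns (n k) r (Q k) G) \<noteq> 0"
    and det_unfold_angle: "det (unfold_angle (r * r) r (Q 1)) \<noteq> 0"
begin

lemma slice_prod_Q [simp]: "slice_prod r Q \<gamma> ks \<in> carrier_mat r r"
  by (intro slice_prod_carrier) simp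

lemma det_slice_prod_Q:
  assumes "set ks \<subseteq> {1..d}" "\<And>k. k \<in> set ks \<Longrightarrow> \<gamma> k < n k"
  shows "det (slice_prod r Q \<gamma> ks) \<noteq> 0"
proof (rule det_slice_prod)
  fix k assume "k \<in> set ks"
  then show "det (Q k (\<gamma> k)) \<noteq> 0" using assms by (intro det_slice) auto
qed simp

lemma fiber_mat_factor:
  assumes \<alpha>: "\<alpha> \<in> multi_indices {2..d-1} n" and G: "index_subset (n d) r G"
  shows "fiber_mat d n T \<alpha> G = unfold_angle (n 1) r (Q 1) *
    (kronecker (1\<^sub>m r) (slice_prod r Q \<alpha> [2..<d]) * slice_columns (n d) r (Q d) G)"
    (is "?F = ?A * ?J")
proof (rule eq_matI)
  have J: "?J \<in> carrier_mat (r * r) (r * r)"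
    by (intro mult_carrier_mat[OF kronecker_carrier slice_columns_carrier[OF G]]) auto
  have F: "?F \<in> carrier_mat (n 1) (r * r)"
    unfolding fiber_mat_def by (intro restrict_cols_carrier[OF G]) auto
  have AJ: "?A * ?J \<in> carrier_mat (n 1) (r * r)" by (rule mult_carrier_mat[OF unfold_angle_carrier J])
  show "dim_row ?F = dim_row (?A * ?J)" "dim_col ?F = dim_col (?A * ?J)"
    using carrier_matD[OF F] carrier_matD[OF AJ] by simp_all
  fix a q assume "a < dim_row (?A * ?J)" "q < dim_col (?A * ?J)"
  then have a: "a < n 1" and q: "q < r * r" unfolding carrier_matD[OF AJ] .
  define b where "b = pick G q"
  have b: "b < n d" using pick_index_subset[OF G q] by (simp add: b_def)
  let ?\<delta> = "\<alpha>(1 := a, d := b)"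
  have ks: "[1..<Suc d] = 1 # [2..<d] @ [d]" using d
    by (simp add: upt_rec[of 1] upt_conv_Cons numeral_2_eq_2)
  have \<delta>: "?\<delta> \<in> multi_indices {1..d} n"
  proof -
    have "{1..d} = insert d (insert 1 {2..d-1})" using d by auto
    then show ?thesis using \<alpha> a b unfolding multi_indices_def
      by (auto simp: PiE_iff extensional_def)
  qed
  have "slice_prod r Q ?\<delta> [1..<Suc d] = Q 1 a * (slice_prod r Q ?\<delta> [2..<d] * Q d b)"
    unfolding ks using d slice_prod_append[of "[2..<d]" "[d]" Q ?\<delta> r]
    by (simp add: right_mult_one_mat[OF Q])
  also have "slice_prod r Q ?\<delta> [2..<d] = slice_prod r Q \<alpha> [2..<d]"
    by (intro slice_prod_cong) auto
  finally have "T ?\<delta> = mat_trace (Q 1 a * (slice_prod r Q \<alpha> [2..<d] * Q d b))"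
    using T[OF \<delta>] by (simp only: tr_tensor_def)
  moreover have "?F $$ (a, q) = T ?\<delta>"
    unfolding fiber_mat_def b_def using a b q
    by (subst restrict_cols_entry[OF G, of _ "n 1"]) (auto simp: b_def)
  ultimately show "?F $$ (a, q) = (?A * ?J) $$ (a, q)"
    using unfold_angle_slice_columns_entry[OF G a q, of "Q 1" "slice_prod r Q \<alpha> [2..<d]" "Q d"]
    by (simp add: b_def)
qed

text \<open>Cyclicity of the trace moves the slices up to mode \<open>k - 1\<close> behind the
  others, which puts the core to be recovered first.\<close>

lemma S_mat_entry:
  assumes k: "k \<in> {2..d}" and \<gamma>: "\<gamma> \<in> multi_indices {1..d} n" and G: "index_subset (n (k - 1)) r G"
    and a: "a < n k" and q: "q < r * r"
  shows "S_mat n T \<gamma> G k $$ (a, q) = mat_trace (Q k a * slice_prod r Q \<gamma> [Suc k..<Suc d] *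
    (slice_prod r Q \<gamma> [1..<k - 1] * Q (k - 1) (pick G q)))"
proof -
  define b where "b = pick G q"
  have b: "b < n (k - 1)" using pick_index_subset[OF G q] by (simp add: b_def)
  let ?\<delta> = "\<gamma>(k := a, k - 1 := b)"
  let ?P = "slice_prod r Q \<gamma> [1..<k - 1]" and ?R = "slice_prod r Q \<gamma> [Suc k..<Suc d]"
  have ks: "[1..<Suc d] = [1..<k - 1] @ (k - 1) # k # [Suc k..<Suc d]"
  proof -
    have e: "(k - 1) + (Suc d - (k - 1)) = Suc d" "1 \<le> k - 1" using k by auto
    have "[1..<Suc d] = [1..<k - 1] @ [k - 1..<Suc d]"
      by (rule upt_add_eq_append[OF e(2), of "Suc d - (k - 1)", unfolded e(1)])
    also have "[k - 1..<Suc d] = (k - 1) # k # [Suc k..<Suc d]"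
    proof -
      have "k - 1 < Suc d" "k < Suc d" "Suc (k - 1) = k" using k by auto
      then show ?thesis by (simp only: upt_conv_Cons)
    qed
    finally show ?thesis .
  qed
  have \<delta>: "?\<delta> \<in> multi_indices {1..d} n"
    using \<gamma> a b k by (auto simp: multi_indices_def PiE_iff extensional_def)
  have "slice_prod r Q ?\<delta> [1..<Suc d] =
      slice_prod r Q ?\<delta> [1..<k - 1] * (Q (k - 1) b * (Q k a * slice_prod r Q ?\<delta> [Suc k..<Suc d]))"
    unfolding ks using k by (subst slice_prod_append) auto
  also have "slice_prod r Q ?\<delta> [1..<k - 1] = ?P" by (intro slice_prod_cong) auto
  also have "slice_prod r Q ?\<delta> [Suc k..<Suc d] = ?R" using k by (intro slice_prod_cong) auto
  also have "?P * (Q (k - 1) b * (Q k a * ?R)) = (?P * Q (k - 1) b) * (Q k a * ?R)"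
    by (rule assoc_mult_mat[OF slice_prod_Q Q mult_carrier_mat[OF Q slice_prod_Q], symmetric])
  finally have "T ?\<delta> = mat_trace ((?P * Q (k - 1) b) * (Q k a * ?R))"
    using T[OF \<delta>] by (simp only: tr_tensor_def)
  also have "\<dots> = mat_trace (Q k a * ?R * (?P * Q (k - 1) b))"
    by (rule mat_trace_mult_commute[OF mult_carrier_mat[OF slice_prod_Q Q] mult_carrier_mat[OF Q slice_prod_Q]])
  also have "T ?\<delta> = S_mat n T \<gamma> G k $$ (a, q)"
    unfolding S_mat_def b_def using a b q
    by (subst restrict_cols_entry[OF G, of _ "n k"]) (auto simp: b_def)
  finally show ?thesis by (simp add: b_def)
qed

text \<open>The gauge that the successive least-squares steps produce: it is determined by its first two
  matrices, because step \<open>k\<close> absorbs the slices behind mode \<open>k\<close> into \<open>L (k + 1)\<close>.\<close>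

definition gauge :: "(nat \<Rightarrow> nat) \<Rightarrow> complex mat \<Rightarrow> complex mat \<Rightarrow> nat \<Rightarrow> complex mat" where
  "gauge \<gamma> L1 L2 k = (if k \<le> 1 then L1 else if k = 2 then L2 else slice_prod r Q \<gamma> [k..<Suc d] * L1)"

context
  fixes \<gamma> :: "nat \<Rightarrow> nat" and L1 L2 :: "complex mat"
  assumes \<gamma>: "\<gamma> \<in> multi_indices {1..d} n"
    and L1: "L1 \<in> carrier_mat r r" "det L1 \<noteq> 0" and L2: "L2 \<in> carrier_mat r r" "det L2 \<noteq> 0"
begin

lemma gauge_carrier: "gauge \<gamma> L1 L2 k \<in> carrier_mat r r"
  using L1 L2 by (auto simp: gauge_def intro!: mult_carrier_mat)

lemma \<gamma>_less: "k \<in> {1..d} \<Longrightarrow> \<gamma> k < n k"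
  using \<gamma> by (auto simp: multi_indices_def PiE_iff)

lemma det_gauge: "det (gauge \<gamma> L1 L2 k) \<noteq> 0"
proof (cases "k \<ge> 3")
  case True
  then have "det (slice_prod r Q \<gamma> [k..<Suc d]) \<noteq> 0"
    by (intro det_slice_prod_Q) (auto intro!: \<gamma>_less)
  then show ?thesis using True L1 by (simp add: gauge_def det_mult[of _ r])
qed (use L1 L2 in \<open>auto simp: gauge_def\<close>)

lemma gauge_end: "gauge \<gamma> L1 L2 (Suc d) = L1"
  using d L1 by (simp add: gauge_def)

text \<open>When all earlier cores are correct up to the gauge, the matrix \<open>?X\<close> under
  \<open>pinv\<close> is square and invertible, and \<open>S_mat\<close> factors as the unfolding of
  the gauged core times \<open>?X\<close>. The pseudoinverse is then a true inverse and isolates the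
  core.\<close>

lemma blostr_step:
  assumes k: "k \<in> {2..d}" and G: "index_subset (n (k - 1)) r G"
    and Qh: "\<And>l a. 1 \<le> l \<Longrightarrow> l < k \<Longrightarrow> a < n l \<Longrightarrow>
      Qh l a = mat_inv (gauge \<gamma> L1 L2 l) * Q l a * gauge \<gamma> L1 L2 (Suc l)"
  shows "S_mat n T \<gamma> G k * pinv (kronecker (1\<^sub>m r) (slice_prod r Qh \<gamma> [1..<k - 1]) *
      slice_columns (n (k - 1)) r (Qh (k - 1)) G) =
    unfold_angle (n k) r (\<lambda>a. mat_inv (gauge \<gamma> L1 L2 k) * Q k a * gauge \<gamma> L1 L2 (Suc k))"
proof -
  let ?L = "gauge \<gamma> L1 L2"
  let ?Ph = "slice_prod r Qh \<gamma> [1..<k - 1]" and ?P = "slice_prod r Q \<gamma> [1..<k - 1]"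
    and ?R = "slice_prod r Q \<gamma> [Suc k..<Suc d]"
  let ?X = "kronecker (1\<^sub>m r) ?Ph * slice_columns (n (k - 1)) r (Qh (k - 1)) G"
  note Lc = gauge_carrier and Ld = det_gauge
  note Li = mat_inv[OF Lc Ld]
  have Ph: "?Ph = mat_inv L1 * ?P * ?L (k - 1)"
    using slice_prod_gauge[of Q \<gamma> r 1 "k - 1" ?L Qh] k Qh \<gamma>_less Lc Ld
    by (auto simp: gauge_def[of _ _ _ "Suc 0"])
  have i1: "mat_inv L1 \<in> carrier_mat r r" "det (mat_inv L1) \<noteq> 0" using mat_inv(1) det_mat_inv L1 by auto
  have Phc: "?Ph \<in> carrier_mat r r" unfolding Ph by (intro mult_carrier_mat[OF _ Lc] mult_carrier_mat[OF i1(1)]) simp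
  have dP: "det ?P \<noteq> 0" using k by (intro det_slice_prod_Q) (auto intro!: \<gamma>_less)
  have dPh: "det ?Ph \<noteq> 0"
    unfolding Ph using i1 dP Lc Ld by (simp add: det_mult[OF mult_carrier_mat[OF i1(1)] Lc] det_mult[of _ r])
  have Qh': "Qh (k - 1) a = mat_inv (?L (k - 1)) * Q (k - 1) a * ?L k" if "a < n (k - 1)" for a
  proof -
    have "1 \<le> k - 1" "k - 1 < k" "Suc (k - 1) = k" using k by auto
    with Qh[OF this(1,2) that] show ?thesis by (simp only:)
  qed
  have B: "slice_columns (n (k - 1)) r (Qh (k - 1)) G =
    kronecker (transpose_mat (?L k)) (mat_inv (?L (k - 1))) * slice_columns (n (k - 1)) r (Q (k - 1)) G"
    using Qh' by (intro slice_columns_gauge[OF G Lc Li(1)]) auto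
  have "det (kronecker (transpose_mat (?L k)) (mat_inv (?L (k - 1)))) \<noteq> 0"
    using Lc Ld Li det_mat_inv[OF Lc Ld] by (intro det_kronecker_nonzero[of _ r]) (auto simp: det_transpose[OF Lc])
  moreover have "det (slice_columns (n (k - 1)) r (Q (k - 1)) G) \<noteq> 0"
    using k by (intro det_slice_columns G) auto
  ultimately have dB: "det (slice_columns (n (k - 1)) r (Qh (k - 1)) G) \<noteq> 0"
    unfolding B using Lc Li slice_columns_carrier[OF G]
    by (subst det_mult[OF kronecker_carrier[of _ r r _ r r]]) auto
  have X: "?X \<in> carrier_mat (r * r) (r * r)"
    using Phc by (intro mult_carrier_mat[OF kronecker_carrier slice_columns_carrier[OF G]]) auto
  have dX: "det ?X \<noteq> 0"
    using det_kronecker_nonzero[OF one_carrier_mat _ Phc dPh] dB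
      det_mult[OF kronecker_carrier[OF one_carrier_mat Phc] slice_columns_carrier[OF G]] by simp
  let ?C = "\<lambda>a. mat_inv (?L k) * Q k a * ?L (Suc k)"
  have C: "?C a \<in> carrier_mat r r" for a by (intro mult_carrier_mat[OF mult_carrier_mat[OF Li(1)] Lc]) simp
  have S: "S_mat n T \<gamma> G k = unfold_angle (n k) r ?C * ?X"
  proof (rule eq_matI)
    have Sc: "S_mat n T \<gamma> G k \<in> carrier_mat (n k) (r * r)"
      unfolding S_mat_def by (intro restrict_cols_carrier[OF G]) simp
    have UX: "unfold_angle (n k) r ?C * ?X \<in> carrier_mat (n k) (r * r)"
      by (rule mult_carrier_mat[OF unfold_angle_carrier X])
    show "dim_row (S_mat n T \<gamma> G k) = dim_row (unfold_angle (n k) r ?C * ?X)"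
      "dim_col (S_mat n T \<gamma> G k) = dim_col (unfold_angle (n k) r ?C * ?X)"
      using carrier_matD[OF Sc] carrier_matD[OF UX] by simp_all
    fix a q assume "a < dim_row (unfold_angle (n k) r ?C * ?X)" "q < dim_col (unfold_angle (n k) r ?C * ?X)"
    then have a: "a < n k" and q: "q < r * r" using UX by auto
    define b where "b = pick G q"
    have b: "b < n (k - 1)" using pick_index_subset[OF G q] by (simp add: b_def)
    \<comment> \<open>Here \<open>Suc k\<close> is at least 3, so the product clause of
      \<open>gauge\<close> applies; for \<open>k = d\<close> the product is empty and the gauge
      closes up with \<open>L1\<close>.\<close>
    have LR: "?L (Suc k) = ?R * L1" using k by (auto simp: gauge_def)
    have bh: "Qh (k - 1) b \<in> carrier_mat r r"
      unfolding Qh'[OF b] by (intro mult_carrier_mat[OF mult_carrier_mat[OF Li(1)] Lc]) simp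
    let ?W = "mat_inv L1 * (?P * Q (k - 1) b)"
    have PQ: "?P * Q (k - 1) b \<in> carrier_mat r r" by (rule mult_carrier_mat[OF slice_prod_Q Q])
    have Wc: "?W \<in> carrier_mat r r" by (rule mult_carrier_mat[OF i1(1) PQ])
    have "?Ph * Qh (k - 1) b = mat_inv L1 * ?P * (?L (k - 1) * (mat_inv (?L (k - 1)) * (Q (k - 1) b * ?L k)))"
      unfolding Ph Qh'[OF b] using assoc_mult_mat[OF Li(1) Q Lc]
        assoc_mult_mat[OF mult_carrier_mat[OF i1(1) slice_prod_Q] Lc mult_carrier_mat[OF Li(1) mult_carrier_mat[OF Q Lc]]]
      by simp
    also have "\<dots> = mat_inv L1 * ?P * (Q (k - 1) b * ?L k)"
      by (subst mat_inv_mult_cancel(1)[OF Lc Ld mult_carrier_mat[OF Q Lc]]) (rule refl)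
    also have "\<dots> = ?W * ?L k"
      using assoc_mult_mat[OF mult_carrier_mat[OF i1(1) slice_prod_Q] Q Lc]
        assoc_mult_mat[OF i1(1) slice_prod_Q Q] by simp
    finally have PhQ: "?Ph * Qh (k - 1) b = ?W * ?L k" .
    have QR: "Q k a * ?R \<in> carrier_mat r r" by (rule mult_carrier_mat[OF Q slice_prod_Q])
    have QL: "Q k a * ?L (Suc k) \<in> carrier_mat r r" by (intro mult_carrier_mat[OF _ Lc]) simp
    \<comment> \<open>Two rotations of the trace: the first brings \<open>?L k\<close> next to its
      inverse, the second brings \<open>L1\<close> next to the inverse at the front of
      \<open>?W\<close>.\<close>
    have "mat_trace (?C a * (?Ph * Qh (k - 1) b)) = mat_trace ((?W * ?L k) * ?C a)"
      unfolding PhQ by (rule mat_trace_mult_commute[OF C mult_carrier_mat[OF Wc Lc]])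
    also have "(?W * ?L k) * ?C a = ?W * (Q k a * ?L (Suc k))"
      using assoc_mult_mat[OF Wc Lc C] assoc_mult_mat[OF Li(1) Q Lc] mat_inv_mult_cancel(1)[OF Lc Ld QL] by simp
    also have "Q k a * ?L (Suc k) = Q k a * ?R * L1"
      unfolding LR using assoc_mult_mat[OF Q slice_prod_Q L1(1)] by simp
    also have "mat_trace (?W * (Q k a * ?R * L1)) = mat_trace (Q k a * ?R * L1 * ?W)"
      by (rule mat_trace_mult_commute[OF Wc mult_carrier_mat[OF QR L1(1)]])
    also have "Q k a * ?R * L1 * ?W = Q k a * ?R * (?P * Q (k - 1) b)"
      using assoc_mult_mat[OF QR L1(1) Wc] mat_inv_mult_cancel(1)[OF L1 PQ] by simp
    finally show "S_mat n T \<gamma> G k $$ (a, q) = (unfold_angle (n k) r ?C * ?X) $$ (a, q)"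
      using S_mat_entry[OF k \<gamma> G a q] bh
        unfold_angle_slice_columns_entry[OF G a q C Phc, of "Qh (k - 1)"] by (simp add: b_def)
  qed
  have "S_mat n T \<gamma> G k * pinv ?X = unfold_angle (n k) r ?C * (?X * mat_inv ?X)"
    unfolding S pinv_eq_mat_inv[OF X dX]
    by (rule assoc_mult_mat[OF unfold_angle_carrier X mat_inv(1)[OF X dX]])
  then show ?thesis using mat_inv(2)[OF X dX] by (simp add: right_mult_one_mat[OF unfold_angle_carrier])
qed

end

end

subsection \<open>Stacks of eigenvectors\<close>

text \<open>Combining the equations with the coefficients of a polynomial \<open>p\<close> that
  vanishes at all nodes except \<open>\<nu> k\<close> isolates \<open>c k\<close>. The product of
  the other \<open>r - 1\<close> linear factors has degree below \<open>r\<close>, so the available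
  powers suffice.\<close>

lemma vandermonde_kernel:
  assumes inj: "inj_on \<nu> {..<r}" and zero: "\<And>a. a < r \<Longrightarrow> (\<Sum>k<r. c k * \<nu> k ^ a) = (0 :: complex)"
    and k: "k < r"
  shows "c k = 0"
proof -
  define p where "p = (\<Prod>j\<in>{..<r} - {k}. [:- \<nu> j, 1:])"
  have "degree p \<le> (\<Sum>j\<in>{..<r} - {k}. degree [:- \<nu> j, 1:])"
    using degree_prod_sum_le[of "{..<r} - {k}" "\<lambda>j. [:- \<nu> j, 1:]"] by (simp add: p_def o_def)
  then have deg: "degree p < r" using k by simp
  have "poly p x = (\<Sum>a<r. coeff p a * x ^ a)" for x
    unfolding poly_altdef by (rule sum.mono_neutral_left) (use deg in \<open>auto simp: coeff_eq_0\<close>)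
  then have "(\<Sum>l<r. c l * poly p (\<nu> l)) = (\<Sum>l<r. \<Sum>a<r. coeff p a * (c l * \<nu> l ^ a))"
    by (simp add: sum_distrib_left mult_ac)
  also have "\<dots> = (\<Sum>a<r. coeff p a * (\<Sum>l<r. c l * \<nu> l ^ a))"
    by (subst sum.swap) (simp add: sum_distrib_left)
  also have "\<dots> = 0" using zero by simp
  finally have "(\<Sum>l<r. c l * poly p (\<nu> l)) = 0" .
  moreover have "(\<Sum>l<r. c l * poly p (\<nu> l)) = (\<Sum>l\<in>{k}. c l * poly p (\<nu> l))"
    by (rule sum.mono_neutral_right) (use k in \<open>auto simp: p_def poly_prod\<close>)
  ultimately have "c k * poly p (\<nu> k) = 0" by simp
  moreover have "poly p (\<nu> k) \<noteq> 0"
    using inj k by (auto simp: p_def poly_prod inj_on_def)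
  ultimately show ?thesis by simp
qed

text \<open>Applying powers of \<open>H\<close> to a linear relation between the columns of
  \<Lambda> multiplies the \<open>k\<close>-th term by powers of \<open>\<nu> k\<close>; the
  Vandermonde argument, applied in each row, then kills every coefficient.\<close>

lemma det_eigenvectors_nonzero:
  assumes H: "(H :: complex mat) \<in> carrier_mat r r" and \<Lambda>: "\<Lambda> \<in> carrier_mat r r"
    and ev: "H * \<Lambda> = \<Lambda> * mat_diag r \<nu>" and inj: "inj_on \<nu> {..<r}"
    and nz: "\<And>k. k < r \<Longrightarrow> \<exists>l<r. \<Lambda> $$ (l, k) \<noteq> 0"
  shows "det \<Lambda> \<noteq> 0"
  unfolding det_nonzero_iff_inj[OF \<Lambda>]
proof (intro ballI impI)
  fix v assume v: "v \<in> carrier_vec r" and z: "\<Lambda> *\<^sub>v v = 0\<^sub>v r"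
  have ev': "(\<Sum>m<r. H $$ (l, m) * \<Lambda> $$ (m, k)) = \<Lambda> $$ (l, k) * \<nu> k" if "l < r" "k < r" for l k
    using that arg_cong[OF ev, of "\<lambda>M. M $$ (l, k)"]
    by (simp add: mult_mat_entry[OF H \<Lambda>] mat_diag_mult_right[OF \<Lambda>] del: index_mult_mat)
  have pw: "(\<Sum>k<r. \<Lambda> $$ (l, k) * v $ k * \<nu> k ^ a) = 0" if "l < r" for l a
    using that
  proof (induction a arbitrary: l)
    case 0
    then show ?case using arg_cong[OF z, of "\<lambda>w. w $ l"]
      by (simp add: mult_mat_vec_entry[OF \<Lambda> v] del: index_mult_mat_vec)
  next
    case (Suc a)
    have "(\<Sum>k<r. \<Lambda> $$ (l, k) * v $ k * \<nu> k ^ Suc a) =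
      (\<Sum>k<r. (\<Sum>m<r. H $$ (l, m) * \<Lambda> $$ (m, k)) * (v $ k * \<nu> k ^ a))"
      using Suc.prems by (simp add: ev' mult_ac)
    also have "\<dots> = (\<Sum>m<r. H $$ (l, m) * (\<Sum>k<r. \<Lambda> $$ (m, k) * v $ k * \<nu> k ^ a))"
      by (simp add: sum_distrib_left sum_distrib_right mult_ac) (rule sum.swap)
    also have "\<dots> = 0" using Suc.IH by simp
    finally show ?case .
  qed
  show "v = 0\<^sub>v r"
  proof (rule eq_vecI)
    fix k assume "k < dim_vec (0\<^sub>v r :: complex vec)"
    then have k: "k < r" by simp
    obtain l where l: "l < r" "\<Lambda> $$ (l, k) \<noteq> 0" using nz[OF k] by blast
    have "\<Lambda> $$ (l, k) * v $ k = 0"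
      by (rule vandermonde_kernel[OF inj _ k]) (rule pw[OF l(1)])
    then show "v $ k = 0\<^sub>v r $ k" using l k by simp
  qed (use v in simp)
qed

lemma mult_mat_zero_vec: "(A :: complex mat) \<in> carrier_mat m k \<Longrightarrow> A *\<^sub>v 0\<^sub>v k = 0\<^sub>v m"
  by (rule eq_vecI) (auto simp: mult_mat_vec_entry simp del: index_mult_mat_vec)

text \<open>Eigenvectors for nonzero eigenvalues lie in the range of \<open>N\<close>, hence in the
  range of \<open>A\<close>; their coordinates \<open>Y = Ap * E\<close> are eigenvectors of
  \<open>C\<close>. That \<open>Y\<close> is invertible follows from the linear independence of the
  selected columns of \<open>X\<close>.\<close>

lemma eigenvector_stackE:
  assumes A: "A \<in> carrier_mat m (r * r)" and Ap: "Ap \<in> carrier_mat (r * r) m" and ApA: "Ap * A = 1\<^sub>m (r * r)"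
    and C: "C \<in> carrier_mat (r * r) (r * r)" and N: "N = A * C * Ap" and S: "eigenvector_stack r N E"
  obtains Y \<nu> where "Y \<in> carrier_mat (r * r) (r * r)" "det Y \<noteq> 0" "E = A * Y"
    "C * Y = Y * mat_diag (r * r) (\<lambda>c. \<nu> (c mod r))" "inj_on \<nu> {..<r}" "\<And>k. k < r \<Longrightarrow> \<nu> k \<noteq> 0"
proof -
  have AC: "A * C \<in> carrier_mat m (r * r)" using A C by auto
  have Nc: "N \<in> carrier_mat m m" unfolding N using AC Ap by auto
  from S obtain X ev \<sigma> \<nu> where E: "E \<in> carrier_mat m (r * r)" and eig: "eigendecomposition N X ev"
    and bij: "bij_betw \<sigma> {..<r * r} {i. i < m \<and> ev i \<noteq> 0}"
    and cols: "\<And>c. c < r * r \<Longrightarrow> col E c = col X (\<sigma> c)" and inj: "inj_on \<nu> {..<r}"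
    and ev\<sigma>: "\<And>j k. j < r \<Longrightarrow> k < r \<Longrightarrow> ev (\<sigma> (j * r + k)) = \<nu> k"
    unfolding eigenvector_stack_def using carrier_matD[OF Nc] by auto
  have X: "X \<in> carrier_mat m m" and dX: "det X \<noteq> 0" and NX: "N = X * mat_diag m ev * mat_inv X"
    using eig Nc by (auto simp: eigendecomposition_def invertible_mat_iff_det)
  note Xi = mat_inv[OF X dX]
  define D where "D = mat_diag (r * r) (\<lambda>c. \<nu> (c mod r))"
  define Di where "Di = mat_diag (r * r) (\<lambda>c. inverse (\<nu> (c mod r)))"
  have D: "D \<in> carrier_mat (r * r) (r * r)" "Di \<in> carrier_mat (r * r) (r * r)" by (auto simp: D_def Di_def)
  have \<sigma>: "\<sigma> c < m" "ev (\<sigma> c) \<noteq> 0" "ev (\<sigma> c) = \<nu> (c mod r)" if "c < r * r" for c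
    using bij that ev\<sigma>[of "c div r" "c mod r"] pair_index_div_less[OF that] by (auto simp: bij_betw_def)
  have \<nu>: "\<nu> k \<noteq> 0" if "k < r" for k
    using \<sigma>(2,3)[of "0 * r + k"] that pair_index_less[of 0 r k] by simp
  have EX: "E $$ (i, c) = X $$ (i, \<sigma> c)" if "i < m" "c < r * r" for i c
    using arg_cong[OF cols[OF that(2)], of "\<lambda>v. v $ i"] that \<sigma>[OF that(2)] E X by simp
  have XD: "X * mat_diag m ev \<in> carrier_mat m m" using X by auto
  have "N * X = X * mat_diag m ev"
    unfolding NX using assoc_mult_mat[OF XD Xi(1) X] Xi(3) right_mult_one_mat[OF XD] by simp
  have NE: "N * E = E * D"
  proof (rule eq_matI)
    fix i c assume "i < dim_row (E * D)" "c < dim_col (E * D)"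
    then have i: "i < m" and c: "c < r * r" using E D by auto
    have "(N * E) $$ (i, c) = (N * X) $$ (i, \<sigma> c)"
      using i c \<sigma>[OF c] by (simp add: mult_mat_entry[OF Nc E] mult_mat_entry[OF Nc X] EX del: index_mult_mat)
    also have "\<dots> = (E * D) $$ (i, c)"
      unfolding \<open>N * X = _\<close> D_def mat_diag_mult_right[OF X] mat_diag_mult_right[OF E]
      using i c \<sigma>[OF c] by (simp add: EX)
    finally show "(N * E) $$ (i, c) = (E * D) $$ (i, c)" .
  qed (use Nc E D in auto)
  have DDi: "D * Di = 1\<^sub>m (r * r)"
  proof -
    have "D * Di = mat_diag (r * r) (\<lambda>c. 1)"
      unfolding D_def Di_def mat_diag_diag by (rule eq_matI) (auto simp: mat_diag_def \<nu> pair_index_div_less)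
    then show ?thesis by simp
  qed
  \<comment> \<open>Division by the nonzero eigenvalues: E = N (E D^-1), and \<open>N\<close> begins
    with the factor \<open>A\<close>, so \<open>V\<close> gives coordinates of \<open>E\<close> with
    respect to \<open>A\<close>.\<close>
  define V where "V = C * (Ap * (E * Di))"
  define Y where "Y = Ap * E"
  have EDi: "E * Di \<in> carrier_mat m (r * r)" and ApE: "Y \<in> carrier_mat (r * r) (r * r)"
    using E D Ap by (auto simp: Y_def)
  have ApEDi: "Ap * (E * Di) \<in> carrier_mat (r * r) (r * r)" using EDi Ap by auto
  have V: "V \<in> carrier_mat (r * r) (r * r)" using C ApEDi by (auto simp: V_def)
  have "A * V = A * C * (Ap * (E * Di))" unfolding V_def by (rule assoc_mult_mat[OF A C ApEDi, symmetric])
  also have "\<dots> = N * (E * Di)" unfolding N by (rule assoc_mult_mat[OF AC Ap EDi, symmetric])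
  also have "\<dots> = E * (D * Di)"
    using assoc_mult_mat[OF Nc E D(2)] assoc_mult_mat[OF E D] NE by simp
  finally have EV: "E = A * V" using DDi E by simp
  have "Y = V" unfolding Y_def EV using assoc_mult_mat[OF Ap A V] ApA V by simp
  with EV have EY: "E = A * Y" by simp
  have "Ap * N = C * Ap"
    unfolding N using assoc_mult_mat[OF Ap AC Ap] assoc_mult_mat[OF Ap A C] ApA C by simp
  then have "C * Y = Ap * (N * E)"
    unfolding Y_def using assoc_mult_mat[OF C Ap E] assoc_mult_mat[OF Ap Nc E] by simp
  also have "\<dots> = Y * D" unfolding NE Y_def by (rule assoc_mult_mat[OF Ap E D(1), symmetric])
  finally have CY: "C * Y = Y * D" .
  \<comment> \<open>The rows of the inverse of \<open>X\<close> that belong to the selected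
    eigenvectors form a left inverse of \<open>E\<close>.\<close>
  define R where "R = mat (r * r) m (\<lambda>(c, i). mat_inv X $$ (\<sigma> c, i))"
  have R: "R \<in> carrier_mat (r * r) m" by (simp add: R_def)
  have "R * E = 1\<^sub>m (r * r)"
  proof (rule eq_matI)
    fix c c' assume "c < dim_row (1\<^sub>m (r * r))" "c' < dim_col (1\<^sub>m (r * r))"
    then have c: "c < r * r" "c' < r * r" by auto
    have "(R * E) $$ (c, c') = (mat_inv X * X) $$ (\<sigma> c, \<sigma> c')"
      using c \<sigma>[OF c(1)] \<sigma>[OF c(2)]
      by (simp add: mult_mat_entry[OF R E] mult_mat_entry[OF Xi(1) X] EX del: index_mult_mat) (simp add: R_def)
    also have "\<dots> = 1\<^sub>m (r * r) $$ (c, c')"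
      unfolding Xi(3) using c \<sigma>[OF c(1)] \<sigma>[OF c(2)] bij by (auto simp: bij_betw_def inj_on_def)
    finally show "(R * E) $$ (c, c') = 1\<^sub>m (r * r) $$ (c, c')" .
  qed (use R E in auto)
  then have "(R * A) * Y = 1\<^sub>m (r * r)" using EY assoc_mult_mat[OF R A ApE] by simp
  then have "det Y \<noteq> 0" by (rule det_nonzero_if_left_inverse[OF ApE mult_carrier_mat[OF R A]])
  with ApE EY CY inj \<nu> show thesis by (intro that[of Y \<nu>]) (auto simp: D_def)
qed

text \<open>An eigendecomposition of all of \<open>N\<close> has to be exhibited, so the stack must
  be completed by a basis of the kernel. The columns of the complementary projection
  \<open>U\<close> lie in the kernel, and those with index at least \<open>s\<close> complete the
  basis: the range of \<open>A\<close> contains no nonzero vector supported on these last indices,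
  since the leading rows of \<open>A\<close> form an invertible matrix.\<close>

lemma eigenvector_stackI:
  assumes A: "A \<in> carrier_mat m (r * r)" and Ap: "Ap \<in> carrier_mat (r * r) m" and ApA: "Ap * A = 1\<^sub>m (r * r)"
    and m: "r * r \<le> m" and top: "det (mat (r * r) (r * r) (\<lambda>(i, j). A $$ (i, j))) \<noteq> 0"
    and C: "C \<in> carrier_mat (r * r) (r * r)" and N: "N = A * C * Ap"
    and Y: "Y \<in> carrier_mat (r * r) (r * r)" "det Y \<noteq> 0"
    and CY: "C * Y = Y * mat_diag (r * r) (\<lambda>c. \<nu> (c mod r))" and inj: "inj_on \<nu> {..<r}"
    and \<nu>: "\<And>k. k < r \<Longrightarrow> \<nu> k \<noteq> 0"
  shows "eigenvector_stack r N (A * Y)"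
proof -
  define s where "s = r * r"
  note [simp] = s_def[symmetric]
  note A = A[simplified] and Ap = Ap[simplified] and ApA = ApA[simplified] and m = m[simplified]
    and C = C[simplified] and Y = Y[simplified] and CY = CY[simplified] and top = top[simplified]
  define ev where "ev i = (if i < s then \<nu> (i mod r) else 0)" for i
  \<comment> \<open>\<open>P\<close> puts the stack into the first \<open>s\<close> columns of
    \<open>X\<close>, and \<open>P'\<close> keeps only the later columns of
    \<open>U\<close>.\<close>
  define P where "P = mat s m (\<lambda>(i, j). if i = j then 1 else 0 :: complex)"
  define P' where "P' = mat_diag m (\<lambda>i. if i < s then 0 else 1 :: complex)"
  define D where "D = mat_diag s (\<lambda>c. \<nu> (c mod r))"
  define U where "U = 1\<^sub>m m - A * Ap"
  define X where "X = A * Y * P + U * P'"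
  have P: "P \<in> carrier_mat s m" and P': "P' \<in> carrier_mat m m" and D: "D \<in> carrier_mat s s"
    by (auto simp: P_def P'_def D_def)
  have AAp: "A * Ap \<in> carrier_mat m m" using A Ap by auto
  have U: "U \<in> carrier_mat m m" unfolding U_def using minus_carrier_mat[OF AAp] by simp
  have AY: "A * Y \<in> carrier_mat m s" and YP: "Y * P \<in> carrier_mat s m" using A Y P by auto
  have AYP: "A * Y * P \<in> carrier_mat m m" and UP: "U * P' \<in> carrier_mat m m" using AY P U P' by auto
  have X: "X \<in> carrier_mat m m" using AYP UP by (auto simp: X_def)
  have AC: "A * C \<in> carrier_mat m s" using A C by auto
  have Nc: "N \<in> carrier_mat m m" unfolding N using AC Ap by auto
  have ApU: "Ap * U = 0\<^sub>m s m"
    unfolding U_def using mult_minus_distrib_mat[OF Ap one_carrier_mat AAp] assoc_mult_mat[OF Ap A Ap] ApA Ap by simp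
  have "Ap * (A * Y * P) = Y * P"
    using assoc_mult_mat[OF Ap AY P] assoc_mult_mat[OF Ap A Y(1)] ApA Y(1) by simp
  moreover have "Ap * (U * P') = 0\<^sub>m s m"
    using assoc_mult_mat[OF Ap U P'] ApU P' by simp
  ultimately have ApX: "Ap * X = Y * P"
    unfolding X_def mult_add_distrib_mat[OF Ap AYP UP] by (simp add: right_add_zero_mat[OF YP])
  have Pev: "P * mat_diag m ev = D * P"
    unfolding mat_diag_mult_right[OF P] D_def mat_diag_mult_left[OF P]
    by (rule eq_matI) (auto simp: P_def ev_def)
  have P'ev: "P' * mat_diag m ev = 0\<^sub>m m m"
    unfolding P'_def mat_diag_diag by (rule eq_matI) (auto simp: mat_diag_def ev_def)
  have "N * X = A * C * (Y * P)" unfolding N using assoc_mult_mat[OF AC Ap X] ApX by simp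
  also have "\<dots> = A * (Y * D * P)"
    using assoc_mult_mat[OF A C YP] assoc_mult_mat[OF C Y(1) P] CY by (simp add: D_def)
  also have "\<dots> = A * Y * (D * P)"
    using assoc_mult_mat[OF A Y(1) mult_carrier_mat[OF D P]] assoc_mult_mat[OF Y(1) D P] by simp
  also have "\<dots> = X * mat_diag m ev"
    unfolding X_def using add_mult_distrib_mat[OF AYP UP mat_diag_dim] assoc_mult_mat[OF AY P mat_diag_dim]
      assoc_mult_mat[OF U P' mat_diag_dim] Pev P'ev U mult_carrier_mat[OF AY mult_carrier_mat[OF D P]] by simp
  finally have NX: "N * X = X * mat_diag m ev" .
  have dX: "det X \<noteq> 0"
    unfolding det_nonzero_iff_inj[OF X]
  proof (intro ballI impI)
    fix v assume v: "v \<in> carrier_vec m" and z: "X *\<^sub>v v = 0\<^sub>v m"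
    have Pv: "P *\<^sub>v v \<in> carrier_vec s" by (rule mult_mat_vec_carrier[OF P v])
    have "Y *\<^sub>v (P *\<^sub>v v) = Ap *\<^sub>v (X *\<^sub>v v)"
      using assoc_mult_mat_vec[OF Ap X v] assoc_mult_mat_vec[OF Y(1) P v] ApX by simp
    also have "\<dots> = 0\<^sub>v s" unfolding z by (rule mult_mat_zero_vec[OF Ap])
    finally have Pv0: "P *\<^sub>v v = 0\<^sub>v s" using Y Pv det_nonzero_iff_inj by blast
    have low: "v $ i = 0" if i: "i < s" for i
    proof -
      have "(P *\<^sub>v v) $ i = (\<Sum>j<m. (if i = j then v $ j else 0))"
        unfolding mult_mat_vec_entry[OF P v i] using i by (intro sum.cong) (auto simp: P_def)
      then show ?thesis using i m Pv0 by simp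
    qed
    have P'v: "P' *\<^sub>v v = v"
    proof (rule eq_vecI)
      fix i assume "i < dim_vec v"
      then have i: "i < m" using v by simp
      have "(P' *\<^sub>v v) $ i = (\<Sum>j<m. (if i = j then (if i < s then 0 else v $ j) else 0))"
        unfolding mult_mat_vec_entry[OF P' v i] using i by (intro sum.cong) (auto simp: P'_def mat_diag_def)
      then show "(P' *\<^sub>v v) $ i = v $ i" using i low by simp
    qed (use P' v in auto)
    let ?u = "Ap *\<^sub>v v"
    have u: "?u \<in> carrier_vec s" by (rule mult_mat_vec_carrier[OF Ap v])
    have "0\<^sub>v m = A * Y *\<^sub>v (P *\<^sub>v v) + U *\<^sub>v (P' *\<^sub>v v)"
      using z add_mult_distrib_mat_vec[OF AYP UP v] assoc_mult_mat_vec[OF AY P v] assoc_mult_mat_vec[OF U P' v]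
      by (simp add: X_def)
    also have "A * Y *\<^sub>v (P *\<^sub>v v) = 0\<^sub>v m" unfolding Pv0 by (rule mult_mat_zero_vec[OF AY])
    also have "U *\<^sub>v (P' *\<^sub>v v) = v - A *\<^sub>v ?u"
      unfolding P'v U_def using minus_mult_distrib_mat_vec[OF one_carrier_mat AAp v] assoc_mult_mat_vec[OF A Ap v] v
      by simp
    finally have eq: "v - A *\<^sub>v ?u = 0\<^sub>v m" using v A by (metis left_zero_vec minus_carrier_vec mult_mat_vec_carrier u)
    have Au: "(A *\<^sub>v ?u) $ i = v $ i" if "i < m" for i
      using arg_cong[OF eq, of "\<lambda>w. w $ i"] that v A u by (simp del: index_mult_mat_vec)
    \<comment> \<open>Now \<open>v\<close> is supported on the last indices and equals
      \<open>A\<close> applied to \<open>?u\<close>, so the leading square block of \<open>A\<close>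
      annihilates \<open>?u\<close>.\<close>
    let ?B = "mat s s (\<lambda>(i, j). A $$ (i, j))"
    have "?B *\<^sub>v ?u = 0\<^sub>v s"
    proof (rule eq_vecI)
      fix i assume "i < dim_vec (0\<^sub>v s :: complex vec)"
      then have i: "i < s" by simp
      have Bc: "?B \<in> carrier_mat s s" by simp
      have "(?B *\<^sub>v ?u) $ i = (\<Sum>l<s. A $$ (i, l) * ?u $ l)"
        unfolding mult_mat_vec_entry[OF Bc u i] using i by (intro sum.cong) auto
      then have "(?B *\<^sub>v ?u) $ i = (A *\<^sub>v ?u) $ i"
        using mult_mat_vec_entry[OF A u, of i] i m by simp
      then show "(?B *\<^sub>v ?u) $ i = 0\<^sub>v s $ i" using i m Au[of i] low by simp
    qed simp
    then have "?u = 0\<^sub>v s" using top u det_nonzero_iff_inj[of ?B s] by simp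
    then show "v = 0\<^sub>v m" using Au v A by (intro eq_vecI) (auto simp: scalar_prod_def)
  qed
  have "X * mat_diag m ev * mat_inv X = N"
    unfolding NX[symmetric] using assoc_mult_mat[OF Nc X] mat_inv[OF X dX] Nc by simp
  then have eig: "eigendecomposition N X ev"
    unfolding eigendecomposition_def using Nc X dX invertible_mat_iff_det[OF X] by metis
  have bij: "bij_betw (\<lambda>c. c) {..<s} {i. i < m \<and> ev i \<noteq> 0}"
  proof -
    have "{i. i < m \<and> ev i \<noteq> 0} = {..<s}"
      using m \<nu> pair_index_div_less(2)[of _ r] by (auto simp: ev_def split: if_splits)
    then show ?thesis by (simp add: bij_betw_def)
  qed
  have cols: "col (A * Y) c = col X c" if c: "c < s" for c
  proof (rule eq_vecI)
    fix i assume "i < dim_vec (col X c)"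
    then have i: "i < m" using X by simp
    have "(A * Y * P) $$ (i, c) = (\<Sum>l<s. (if l = c then (A * Y) $$ (i, l) else 0))"
      unfolding mult_mat_entry[OF AY P i less_le_trans[OF c m]]
      by (rule sum.cong) (use c m in \<open>auto simp: P_def\<close>)
    then have 1: "(A * Y * P) $$ (i, c) = (A * Y) $$ (i, c)" using c by simp
    have 2: "(U * P') $$ (i, c) = 0"
      unfolding P'_def mat_diag_mult_right[OF U] using i c m by simp
    have "X $$ (i, c) = (A * Y * P) $$ (i, c) + (U * P') $$ (i, c)"
      unfolding X_def using i c m UP by (subst index_add_mat) auto
    then show "col (A * Y) c $ i = col X c $ i"
      using 1 2 i c m X AY by (simp add: carrier_matD[OF X] carrier_matD[OF AY] del: index_mult_mat)
  qed (use X AY in \<open>simp add: carrier_matD[OF X] carrier_matD[OF AY] del: index_mult_mat\<close>)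
  have "ev (j * r + k) = \<nu> k" if "j < r" "k < r" for j k
    using that pair_index_less[OF that] by (simp add: ev_def)
  then have "eigendecomposition N X ev \<and> bij_betw (\<lambda>c. c) {..<r * r} {i. i < dim_row N \<and> ev i \<noteq> 0} \<and>
      (\<forall>c<r * r. col (A * Y) c = col X c) \<and> inj_on \<nu> {..<r} \<and> (\<forall>j<r. \<forall>k<r. ev (j * r + k) = \<nu> k)"
    using eig bij cols inj carrier_matD[OF Nc] by simp
  then show ?thesis
    unfolding eigenvector_stack_def using AY carrier_matD[OF Nc] by auto
qed

subsection \<open>Interleaved block diagonal matrices\<close>

text \<open>Conjugation by the permutation behind \<open>Pi_perm\<close> turns these into block diagonal matrices; they
  are also the commutant of \<open>kronecker (1\<^sub>m r) (mat_diag r \<nu>)\<close> for distinct \<open>\<nu> k\<close>.\<close>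

definition interleaved :: "nat \<Rightarrow> complex mat \<Rightarrow> bool" where
  "interleaved r Z \<longleftrightarrow> Z \<in> carrier_mat (r * r) (r * r) \<and>
     (\<forall>i<r. \<forall>l<r. \<forall>j<r. \<forall>k<r. l \<noteq> k \<longrightarrow> Z $$ (i * r + l, j * r + k) = 0)"

definition interleaved_block :: "nat \<Rightarrow> complex mat \<Rightarrow> nat \<Rightarrow> complex mat" where
  "interleaved_block r Z k = mat r r (\<lambda>(i, j). Z $$ (i * r + k, j * r + k))"

lemma interleaved_block_carrier [simp]: "interleaved_block r Z k \<in> carrier_mat r r"
  by (simp add: interleaved_block_def)

lemma interleaved_entry:
  assumes "interleaved r Z" "i < r" "l < r" "j < r" "k < r"
  shows "Z $$ (i * r + l, j * r + k) = (if l = k then interleaved_block r Z k $$ (i, j) else 0)"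
  using assms by (auto simp: interleaved_def interleaved_block_def)

lemma interleaved_iff_commute:
  assumes Z: "Z \<in> carrier_mat (r * r) (r * r)" and inj: "inj_on \<nu> {..<r}"
  shows "interleaved r Z \<longleftrightarrow> mat_diag (r * r) (\<lambda>c. \<nu> (c mod r)) * Z = Z * mat_diag (r * r) (\<lambda>c. \<nu> (c mod r))"
    (is "_ \<longleftrightarrow> ?D * Z = Z * ?D")
proof -
  have l: "(?D * Z) $$ (i * r + l, j * r + k) = \<nu> l * Z $$ (i * r + l, j * r + k)"
    and r: "(Z * ?D) $$ (i * r + l, j * r + k) = Z $$ (i * r + l, j * r + k) * \<nu> k"
    if "i < r" "l < r" "j < r" "k < r" for i l j k
    unfolding mat_diag_mult_left[OF Z] mat_diag_mult_right[OF Z] using that by (auto simp: pair_index_less)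
  show ?thesis
  proof
    assume int: "interleaved r Z"
    show "?D * Z = Z * ?D"
    proof (rule eq_mat_pair_index[of _ r])
      fix i l j k assume ix: "i < r" "l < r" "j < r" "k < r"
      show "(?D * Z) $$ (i * r + l, j * r + k) = (Z * ?D) $$ (i * r + l, j * r + k)"
        unfolding l[OF ix] r[OF ix] interleaved_entry[OF int ix] by simp
    qed (use Z in \<open>auto intro!: mult_carrier_mat\<close>)
  next
    assume eq: "?D * Z = Z * ?D"
    have "Z $$ (i * r + l, j * r + k) = 0" if ix: "i < r" "l < r" "j < r" "k < r" and "l \<noteq> k" for i l j k
    proof -
      have "\<nu> l \<noteq> \<nu> k" using inj that by (auto simp: inj_on_def)
      moreover have "\<nu> l * Z $$ (i * r + l, j * r + k) = Z $$ (i * r + l, j * r + k) * \<nu> k"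
        unfolding l[OF ix, symmetric] r[OF ix, symmetric] eq ..
      ultimately show ?thesis by (simp add: mult.commute)
    qed
    then show "interleaved r Z" using Z by (auto simp: interleaved_def)
  qed
qed

text \<open>Membership in a commutant passes to inverses. The diagonal entries
  \<open>c mod r\<close> are just a convenient choice of distinct numbers.\<close>

lemma interleaved_inverse:
  assumes Z: "interleaved r Z" "det Z \<noteq> 0"
  shows "interleaved r (mat_inv Z)"
proof -
  define D where "D = mat_diag (r * r) (\<lambda>c. complex_of_nat (c mod r))"
  have inj: "inj_on complex_of_nat {..<r}" by (auto simp: inj_on_def)
  have Zc: "Z \<in> carrier_mat (r * r) (r * r)" and D: "D \<in> carrier_mat (r * r) (r * r)"
    using Z by (auto simp: interleaved_def D_def)
  note i = mat_inv[OF Zc Z(2)]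
  have DZ: "D * Z = Z * D" using interleaved_iff_commute[OF Zc inj] Z(1) by (simp add: D_def)
  have iD: "mat_inv Z * D \<in> carrier_mat (r * r) (r * r)" using i D by auto
  have "mat_inv Z * D = mat_inv Z * D * (Z * mat_inv Z)" unfolding i(2) by (simp add: right_mult_one_mat[OF iD])
  also have "\<dots> = mat_inv Z * (D * Z) * mat_inv Z"
    using assoc_mult_mat[OF iD Zc i(1)] assoc_mult_mat[OF i(1) D Zc] by simp
  also have "\<dots> = D * mat_inv Z"
    unfolding DZ using assoc_mult_mat[OF i(1) Zc D] i(3) D by simp
  finally show ?thesis using interleaved_iff_commute[OF i(1) inj] by (simp add: D_def)
qed

lemma interleaved_block_mult:
  assumes Z: "interleaved r Z" and W: "W \<in> carrier_mat (r * r) (r * r)" and ix: "i < r" "k < r" "l < r" "j < r"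
  shows "(Z * W) $$ (i * r + k, j * r + l) = (\<Sum>p<r. interleaved_block r Z k $$ (i, p) * W $$ (p * r + k, j * r + l))"
proof -
  have Zc: "Z \<in> carrier_mat (r * r) (r * r)" using Z by (simp add: interleaved_def)
  have "(Z * W) $$ (i * r + k, j * r + l) =
    (\<Sum>p<r. \<Sum>q<r. Z $$ (i * r + k, p * r + q) * W $$ (p * r + q, j * r + l))"
    using ix by (intro mult_mat_pair_entry[OF Zc W]) (auto simp: pair_index_less)
  also have "\<dots> = (\<Sum>p<r. \<Sum>q<r. if q = k then interleaved_block r Z k $$ (i, p) * W $$ (p * r + q, j * r + l) else 0)"
    using ix by (intro sum.cong refl) (auto simp: interleaved_entry[OF Z])
  finally show ?thesis using ix by simp
qed

lemma interleaved_block_inverse: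
  assumes Z: "interleaved r Z" "det Z \<noteq> 0" and k: "k < r"
  shows "interleaved_block r (mat_inv Z) k * interleaved_block r Z k = 1\<^sub>m r"
    "interleaved_block r Z k * interleaved_block r (mat_inv Z) k = 1\<^sub>m r"
proof -
  have Zc: "Z \<in> carrier_mat (r * r) (r * r)" using Z by (simp add: interleaved_def)
  note i = mat_inv[OF Zc Z(2)]
  have "interleaved_block r V k * interleaved_block r W k = 1\<^sub>m r"
    if V: "interleaved r V" and W: "interleaved r W" and VW: "V * W = 1\<^sub>m (r * r)" for V W
  proof (rule eq_matI)
    fix p q assume "p < dim_row (1\<^sub>m r)" "q < dim_col (1\<^sub>m r)"
    then have pq: "p < r" "q < r" by auto
    have Wc: "W \<in> carrier_mat (r * r) (r * r)" using W by (simp add: interleaved_def)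
    have "(interleaved_block r V k * interleaved_block r W k) $$ (p, q) =
      (\<Sum>l<r. interleaved_block r V k $$ (p, l) * W $$ (l * r + k, q * r + k))"
      using pq k by (subst mult_mat_entry[of _ r r _ r])
        (auto simp: interleaved_entry[OF W])
    also have "\<dots> = (V * W) $$ (p * r + k, q * r + k)"
      using interleaved_block_mult[OF V Wc] pq k by simp
    finally show "(interleaved_block r V k * interleaved_block r W k) $$ (p, q) = 1\<^sub>m r $$ (p, q)"
      using VW pq k by (simp add: pair_index_less pair_index_eq_iff)
  qed (simp_all add: interleaved_block_def)
  from this[OF interleaved_inverse[OF Z] Z(1) i(3)] this[OF Z(1) interleaved_inverse[OF Z] i(2)]
  show "interleaved_block r (mat_inv Z) k * interleaved_block r Z k = 1\<^sub>m r"
    "interleaved_block r Z k * interleaved_block r (mat_inv Z) k = 1\<^sub>m r" .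
qed

lemma mat_diag_entry: "i < n \<Longrightarrow> j < n \<Longrightarrow> mat_diag n f $$ (i, j) = (if i = j then f j else 0)"
  by (simp add: mat_diag_def)

lemma kronecker_one_diag:
  "kronecker (1\<^sub>m r) (mat_diag r \<nu>) = mat_diag (r * r) (\<lambda>c. \<nu> (c mod r))"
proof (rule eq_mat_pair_index[of _ r])
  fix i l j k assume ix: "i < r" "l < r" "j < r" "k < r"
  have "mat_diag (r * r) (\<lambda>c. \<nu> (c mod r)) $$ (i * r + l, j * r + k) = (if i = j \<and> l = k then \<nu> k else 0)"
    using ix by (subst mat_diag_entry) (auto simp: pair_index_less pair_index_eq_iff)
  moreover have "kronecker (1\<^sub>m r) (mat_diag r \<nu>) $$ (i * r + l, j * r + k) = (if i = j \<and> l = k then \<nu> k else 0)"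
    unfolding kronecker_entry[OF one_carrier_mat mat_diag_dim ix] mat_diag_entry[OF ix(2,4)] using ix by simp
  ultimately show "kronecker (1\<^sub>m r) (mat_diag r \<nu>) $$ (i * r + l, j * r + k) =
      mat_diag (r * r) (\<lambda>c. \<nu> (c mod r)) $$ (i * r + l, j * r + k)" by (simp only:)
qed (auto intro!: kronecker_carrier)

lemma kronecker_one_mult_entry:
  assumes M: "M \<in> carrier_mat r r" and Z: "Z \<in> carrier_mat (r * r) s" and ix: "i < r" "l < r" "c < s"
  shows "(kronecker (1\<^sub>m r) M * Z) $$ (i * r + l, c) = (\<Sum>q<r. M $$ (l, q) * Z $$ (i * r + q, c))"
proof -
  have "(kronecker (1\<^sub>m r) M * Z) $$ (i * r + l, c) =
    (\<Sum>p<r. \<Sum>q<r. kronecker (1\<^sub>m r) M $$ (i * r + l, p * r + q) * Z $$ (p * r + q, c))"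
    using ix M Z by (intro mult_mat_pair_entry[OF kronecker_carrier]) (auto simp: pair_index_less)
  also have "\<dots> = (\<Sum>p<r. if p = i then \<Sum>q<r. M $$ (l, q) * Z $$ (i * r + q, c) else 0)"
    using ix by (intro sum.cong refl) (auto simp: kronecker_entry[OF one_carrier_mat M])
  finally show ?thesis using ix by simp
qed

text \<open>Each column of \<open>Y\<close> splits into \<open>r\<close> segments, all of them
  eigenvectors of \<open>H\<close> or zero. One nonzero segment per eigenvalue yields \<Lambda>; in
  the basis \<Lambda> the matrix \<open>H\<close> is diagonal, and the remaining freedom is a matrix
  commuting with the diagonal matrix of repeated eigenvalues.\<close>

lemma eigenvectors_of_kronecker_one:
  assumes H: "H \<in> carrier_mat r r" and Y: "Y \<in> carrier_mat (r * r) (r * r)" "det Y \<noteq> 0"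
    and HY: "kronecker (1\<^sub>m r) H * Y = Y * mat_diag (r * r) (\<lambda>c. \<nu> (c mod r))" and inj: "inj_on \<nu> {..<r}"
  obtains \<Lambda> Z where "\<Lambda> \<in> carrier_mat r r" "det \<Lambda> \<noteq> 0" "H * \<Lambda> = \<Lambda> * mat_diag r \<nu>"
    "interleaved r Z" "det Z \<noteq> 0" "Y = kronecker (1\<^sub>m r) \<Lambda> * Z"
proof -
  let ?D = "mat_diag (r * r) (\<lambda>c. \<nu> (c mod r))"
  \<comment> \<open>An invertible \<open>Y\<close> has no zero column, so column \<open>k\<close>
    has a nonzero segment; \<iota> below selects one.\<close>
  have nz: "\<exists>i<r. \<exists>l<r. Y $$ (i * r + l, k) \<noteq> 0" if k: "k < r" for k
  proof (rule ccontr)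
    assume contra: "\<not> ?thesis"
    have z: "Y $$ (c, k) = 0" if "c < r * r" for c
      by (rule all_pair_indexI[of r "\<lambda>c. Y $$ (c, k) = 0", OF _ that]) (use contra in blast)
    have kr: "k < r * r" using pair_index_less[of 0 r k] k by simp
    have "Y *\<^sub>v unit_vec (r * r) k = 0\<^sub>v (r * r)"
      using Y z kr by (intro eq_vecI) (auto simp: mult_mat_vec_entry[OF Y(1)] unit_vec_def simp del: index_mult_mat_vec)
    then have "unit_vec (r * r) k = (0\<^sub>v (r * r) :: complex vec)"
      using det_nonzero_iff_inj[OF Y(1)] Y(2) by simp
    from arg_cong[OF this, of "\<lambda>v. v $ k"] show False using kr by simp
  qed
  then obtain \<iota> where \<iota>: "\<And>k. k < r \<Longrightarrow> \<iota> k < r \<and> (\<exists>l<r. Y $$ (\<iota> k * r + l, k) \<noteq> 0)" by metis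
  define \<Lambda> where "\<Lambda> = mat r r (\<lambda>(l, k). Y $$ (\<iota> k * r + l, k))"
  have \<Lambda>: "\<Lambda> \<in> carrier_mat r r" by (simp add: \<Lambda>_def)
  have H\<Lambda>: "H * \<Lambda> = \<Lambda> * mat_diag r \<nu>"
  proof (rule eq_matI)
    fix l k assume "l < dim_row (\<Lambda> * mat_diag r \<nu>)" "k < dim_col (\<Lambda> * mat_diag r \<nu>)"
    then have l: "l < r" and k: "k < r" using \<Lambda> by (auto simp: mat_diag_def)
    have kr: "k < r * r" using pair_index_less[of 0 r k] k by simp
    have "(H * \<Lambda>) $$ (l, k) = (kronecker (1\<^sub>m r) H * Y) $$ (\<iota> k * r + l, k)"
      unfolding mult_mat_entry[OF H \<Lambda> l k] kronecker_one_mult_entry[OF H Y(1) conjunct1[OF \<iota>[OF k]] l kr]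
      using k by (intro sum.cong) (auto simp: \<Lambda>_def)
    also have "\<dots> = (\<Lambda> * mat_diag r \<nu>) $$ (l, k)"
      unfolding HY mat_diag_mult_right[OF Y(1)] mat_diag_mult_right[OF \<Lambda>]
      using l k kr \<iota>[OF k] by (simp add: \<Lambda>_def pair_index_less)
    finally show "(H * \<Lambda>) $$ (l, k) = (\<Lambda> * mat_diag r \<nu>) $$ (l, k)" .
  qed (use H \<Lambda> in \<open>auto simp: mat_diag_def\<close>)
  have d\<Lambda>: "det \<Lambda> \<noteq> 0"
  proof (rule det_eigenvectors_nonzero[OF H \<Lambda> H\<Lambda> inj])
    fix k assume "k < r"
    then show "\<exists>l<r. \<Lambda> $$ (l, k) \<noteq> 0" using \<iota>[of k] by (auto simp: \<Lambda>_def)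
  qed
  note i = mat_inv[OF \<Lambda> d\<Lambda>]
  have k\<Lambda>: "kronecker (1\<^sub>m r) \<Lambda> \<in> carrier_mat (r * r) (r * r)" and ki: "kronecker (1\<^sub>m r) (mat_inv \<Lambda>) \<in> carrier_mat (r * r) (r * r)"
    and kH: "kronecker (1\<^sub>m r) H \<in> carrier_mat (r * r) (r * r)" and D: "?D \<in> carrier_mat (r * r) (r * r)"
    using \<Lambda> H i by (auto intro!: kronecker_carrier)
  define Z where "Z = kronecker (1\<^sub>m r) (mat_inv \<Lambda>) * Y"
  have Z: "Z \<in> carrier_mat (r * r) (r * r)" unfolding Z_def using ki Y by auto
  have YZ: "Y = kronecker (1\<^sub>m r) \<Lambda> * Z"
    unfolding Z_def using assoc_mult_mat[OF k\<Lambda> ki Y(1)] kronecker_mult[OF one_carrier_mat \<Lambda> one_carrier_mat i(1)] i Y(1)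
    by (simp add: kronecker_one)
  have dZ: "det Z \<noteq> 0" using det_mult[OF k\<Lambda> Z] YZ Y(2) by auto
  have "mat_inv \<Lambda> * H * \<Lambda> = mat_diag r \<nu>"
    using assoc_mult_mat[OF i(1) H \<Lambda>] assoc_mult_mat[OF i(1) \<Lambda> mat_diag_dim] H\<Lambda> i(3)
    by (simp add: left_mult_one_mat[OF mat_diag_dim])
  moreover have iH: "mat_inv \<Lambda> * H \<in> carrier_mat r r" using i H by auto
  ultimately have inter: "mat_inv \<Lambda> * H = mat_diag r \<nu> * mat_inv \<Lambda>"
    using assoc_mult_mat[OF iH \<Lambda> i(1)] i(2) by (simp add: right_mult_one_mat[OF iH])
  have "?D * Z = kronecker (1\<^sub>m r) (mat_diag r \<nu>) * kronecker (1\<^sub>m r) (mat_inv \<Lambda>) * Y"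
    unfolding Z_def kronecker_one_diag using assoc_mult_mat[OF D ki Y(1)] by simp
  also have "\<dots> = kronecker (1\<^sub>m r) (mat_inv \<Lambda>) * kronecker (1\<^sub>m r) H * Y"
    using kronecker_mult[OF one_carrier_mat mat_diag_dim one_carrier_mat i(1), of \<nu>]
      kronecker_mult[OF one_carrier_mat i(1) one_carrier_mat H] inter by simp
  also have "\<dots> = Z * ?D"
    unfolding Z_def using assoc_mult_mat[OF ki kH Y(1)] assoc_mult_mat[OF ki Y(1) D] HY by simp
  finally have "interleaved r Z" using interleaved_iff_commute[OF Z inj] by simp
  then show thesis by (rule that[OF \<Lambda> d\<Lambda> H\<Lambda> _ dZ YZ])
qed

subsection \<open>Matching the two stacks of eigenvectors\<close>

text \<open>Interleaved factors preserve the residue of an index modulo \<open>r\<close>, while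
  \<open>kronecker (1\<^sub>m r) G\<close> acts on the residues only. Fixing the row residue
  \<open>j\<close> and the column residue \<open>k\<close> therefore leaves one block of each
  interleaved factor and one scalar of \<open>G\<close>.\<close>

lemma block_F_interleaved:
  assumes W: "interleaved r W" and Z: "interleaved r Z" and G: "G \<in> carrier_mat r r" and j: "j < r" and k: "k < r"
  shows "block_F r (W * (kronecker (1\<^sub>m r) G * Z)) j k =
    G $$ (j, k) \<cdot>\<^sub>m (interleaved_block r W j * interleaved_block r Z k)"
proof (rule eq_matI)
  have Zc: "Z \<in> carrier_mat (r * r) (r * r)" using Z by (simp add: interleaved_def)
  have GZ: "kronecker (1\<^sub>m r) G * Z \<in> carrier_mat (r * r) (r * r)"
    by (rule mult_carrier_mat[OF kronecker_carrier[OF one_carrier_mat G] Zc])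
  fix p q assume "p < dim_row (G $$ (j, k) \<cdot>\<^sub>m (interleaved_block r W j * interleaved_block r Z k))"
    "q < dim_col (G $$ (j, k) \<cdot>\<^sub>m (interleaved_block r W j * interleaved_block r Z k))"
  then have pq: "p < r" "q < r" by (auto simp: interleaved_block_def)
  have e: "(kronecker (1\<^sub>m r) G * Z) $$ (i * r + j, q * r + k) = G $$ (j, k) * interleaved_block r Z k $$ (i, q)"
    if "i < r" for i
  proof -
    have "(kronecker (1\<^sub>m r) G * Z) $$ (i * r + j, q * r + k) = (\<Sum>l<r. G $$ (j, l) * Z $$ (i * r + l, q * r + k))"
      using that pq j k by (intro kronecker_one_mult_entry[OF G Zc]) (auto simp: pair_index_less)
    also have "\<dots> = (\<Sum>l<r. if l = k then G $$ (j, l) * interleaved_block r Z k $$ (i, q) else 0)"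
      using that pq k by (intro sum.cong refl) (simp add: interleaved_entry[OF Z])
    finally show ?thesis using k by simp
  qed
  have "block_F r (W * (kronecker (1\<^sub>m r) G * Z)) j k $$ (p, q) =
    (W * (kronecker (1\<^sub>m r) G * Z)) $$ (p * r + j, q * r + k)"
    using pq by (simp add: block_F_def)
  also have "\<dots> = (\<Sum>i<r. interleaved_block r W j $$ (p, i) * (G $$ (j, k) * interleaved_block r Z k $$ (i, q)))"
    using pq j k e by (simp add: interleaved_block_mult[OF W GZ])
  also have "\<dots> = G $$ (j, k) * (interleaved_block r W j * interleaved_block r Z k) $$ (p, q)"
    using pq by (subst mult_mat_entry[of _ r r _ r]) (auto simp: sum_distrib_left mult_ac)
  finally show "block_F r (W * (kronecker (1\<^sub>m r) G * Z)) j k $$ (p, q) =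
    (G $$ (j, k) \<cdot>\<^sub>m (interleaved_block r W j * interleaved_block r Z k)) $$ (p, q)"
    using pq by (simp add: interleaved_block_def)
qed (auto simp: block_F_def interleaved_block_def)

lemma diag_block_mat_upt:
  assumes "\<And>l. l < m \<Longrightarrow> f l \<in> carrier_mat r r"
  shows "diag_block_mat (map f [0..<m]) \<in> carrier_mat (m * r) (m * r) \<and>
    (\<forall>l<m. \<forall>k<m. \<forall>i<r. \<forall>j<r.
      diag_block_mat (map f [0..<m]) $$ (l * r + i, k * r + j) = (if l = k then f l $$ (i, j) else 0))"
  using assms
proof (induction m)
  case 0
  then show ?case by simp
next
  case (Suc m)
  let ?B = "diag_block_mat (map f [0..<m])"
  have "\<And>l. l < m \<Longrightarrow> f l \<in> carrier_mat r r" using Suc.prems by simp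
  note IH = Suc.IH[OF this]
  then have B: "?B \<in> carrier_mat (m * r) (m * r)" by simp
  have fm: "f m \<in> carrier_mat r r" using Suc.prems by simp
  have eq: "diag_block_mat (map f [0..<Suc m]) =
    four_block_mat ?B (0\<^sub>m (m * r) r) (0\<^sub>m r (m * r)) (f m)"
    using diag_block_mat_last[of "map f [0..<m]" "f m"] carrier_matD[OF B] carrier_matD[OF fm] by (simp add: Let_def)
  have less: "a * r + b < m * r \<longleftrightarrow> a < m" if "b < r" for a b
  proof
    assume "a * r + b < m * r"
    then have "a * r < m * r" by linarith
    then show "a < m" by simp
  next
    assume "a < m"
    then have "Suc a * r \<le> m * r" by (intro mult_le_mono1) simp
    then show "a * r + b < m * r" using that by simp
  qed
  have bound: "a * r + b < m * r + r" if "a < Suc m" "b < r" for a b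
  proof -
    have "a * r \<le> m * r" using that by (intro mult_le_mono1) simp
    then show ?thesis using that(2) by (rule add_le_less_mono)
  qed
  have "diag_block_mat (map f [0..<Suc m]) $$ (l * r + i, k * r + j) = (if l = k then f l $$ (i, j) else 0)"
    if ix: "l < Suc m" "k < Suc m" "i < r" "j < r" for l k i j
  proof -
    have "l < m \<or> l = m" "k < m \<or> k = m" using ix by auto
    moreover have e: "diag_block_mat (map f [0..<Suc m]) $$ (l * r + i, k * r + j) =
      (if l < m then if k < m then ?B $$ (l * r + i, k * r + j) else 0\<^sub>m (m * r) r $$ (l * r + i, k * r + j - m * r)
       else if k < m then 0\<^sub>m r (m * r) $$ (l * r + i - m * r, k * r + j) else f m $$ (l * r + i - m * r, k * r + j - m * r))"
      unfolding eq using bound[OF ix(1,3)] bound[OF ix(2,4)] carrier_matD[OF B] carrier_matD[OF fm]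
      by (simp add: less ix)
    moreover have "l * r + i < m * r" if "l < m" using less ix that by simp
    moreover have "k * r + j < m * r" if "k < m" using less ix that by simp
    ultimately show ?thesis using IH ix by (elim disjE) simp_all
  qed
  moreover have "diag_block_mat (map f [0..<Suc m]) \<in> carrier_mat (Suc m * r) (Suc m * r)"
    unfolding eq using four_block_carrier_mat[OF B fm] by (simp add: add.commute)
  ultimately show ?case by blast
qed

lemma Pi_K_hat:
  defines "f F r l \<equiv> if l = 0 then 1\<^sub>m r else block_F r F 0 0 * mat_inv (block_F r F l 0)"
  assumes c: "\<And>l. 0 < l \<Longrightarrow> l < r \<Longrightarrow> mat_inv (block_F r F l 0) \<in> carrier_mat r r"
  shows "interleaved r (Pi_perm r (K_hat r F))"
    "\<And>l. l < r \<Longrightarrow> interleaved_block r (Pi_perm r (K_hat r F)) l = f F r l"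
proof -
  have b: "block_F r F 0 0 \<in> carrier_mat r r" by (simp add: block_F_def)
  have f: "f F r l \<in> carrier_mat r r" if "l < r" for l
    unfolding f_def using mult_carrier_mat[OF b c[of l]] that by auto
  have K: "K_hat r F = diag_block_mat (map (f F r) [0..<r])" by (simp add: K_hat_def f_def[abs_def])
  have e: "Pi_perm r (K_hat r F) $$ (i * r + l, j * r + k) = (if l = k then f F r l $$ (i, j) else 0)"
    if "i < r" "l < r" "j < r" "k < r" for i l j k
    unfolding Pi_perm_def K using that diag_block_mat_upt[OF f, of r] by (simp add: pair_index_less)
  show "interleaved r (Pi_perm r (K_hat r F))" using e by (auto simp: interleaved_def Pi_perm_def)
  fix l assume "l < r"
  then show "interleaved_block r (Pi_perm r (K_hat r F)) l = f F r l"
    using f[of l] e by (intro eq_matI) (auto simp: interleaved_block_def)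
qed

lemma det_smult_mult_nonzero:
  assumes "A \<in> carrier_mat r r" "det A \<noteq> 0" "B \<in> carrier_mat r r" "det B \<noteq> 0" "x \<noteq> (0::complex)"
  shows "det (x \<cdot>\<^sub>m (A * B)) \<noteq> 0"
  using assms by (simp add: det_smult det_mult[of _ r])

lemma smult_mult_smult:
  assumes A: "A \<in> carrier_mat m n" and B: "B \<in> carrier_mat n k"
  shows "(x \<cdot>\<^sub>m A) * (y \<cdot>\<^sub>m B) = (x * y :: complex) \<cdot>\<^sub>m (A * B)"
proof -
  have "(x \<cdot>\<^sub>m A) * (y \<cdot>\<^sub>m B) = x \<cdot>\<^sub>m (A * (y \<cdot>\<^sub>m B))"
    using A B by (intro mult_smult_assoc_mat) auto
  also have "A * (y \<cdot>\<^sub>m B) = y \<cdot>\<^sub>m (A * B)" by (rule mult_smult_distrib[OF A B])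
  also have "x \<cdot>\<^sub>m (y \<cdot>\<^sub>m (A * B)) = (x * y) \<cdot>\<^sub>m (A * B)"
    by (rule eq_matI) (simp_all add: mult.assoc del: index_mult_mat(1))
  finally show ?thesis .
qed

lemma one_smult_mat [simp]: "(1 :: complex) \<cdot>\<^sub>m A = A"
  by (rule eq_matI) auto

lemma assoc_mult_mat4:
  assumes "X \<in> carrier_mat n n" "Y \<in> carrier_mat n n" "V \<in> carrier_mat n n" "W \<in> carrier_mat n n"
  shows "X * Y * (V * W) = X * (Y * V * W)"
  using assoc_mult_mat[OF assms(1,2) mult_carrier_mat[OF assms(3,4)]] assoc_mult_mat[OF assms(2-4)] by simp

text \<open>Write Z_l and Z'_0 for the blocks. Then F^(l,0) = G_l0 Z_l^-1 Z'_0, so in F^(0,0)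
  (F^(l,0))^-1 the factor Z'_0 cancels and (G_00 / G_l0) Z_0^-1 Z_l remains. Hence
  \<open>K_hat\<close> knows all blocks of \<open>Z\<close> up to the common factor Z_0 and one
  scalar per block; the Kronecker factor in the conclusion restores both.\<close>

lemma first_core_equation:
  fixes r :: nat and G Z Z' :: "complex mat"
  defines "F \<equiv> mat_inv Z * (kronecker (1\<^sub>m r) G * Z')"
  assumes Z: "interleaved r Z" "det Z \<noteq> 0" and Z': "interleaved r Z'" "det Z' \<noteq> 0" and G: "G \<in> carrier_mat r r"
    and G0: "\<And>l. l < r \<Longrightarrow> G $$ (l, 0) \<noteq> 0" and r: "0 < r"
  shows "\<And>l. l < r \<Longrightarrow> det (block_F r F l 0) \<noteq> 0"
    "kronecker (interleaved_block r Z 0) (mat_diag r (\<lambda>l. G $$ (l, 0) / G $$ (0, 0))) * Pi_perm r (K_hat r F) = Z"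
proof -
  let ?b = "interleaved_block r"
  let ?W = "mat_inv Z"
  note bi = interleaved_block_inverse[OF Z] and bi' = interleaved_block_inverse[OF Z']
  have F: "block_F r F l 0 = G $$ (l, 0) \<cdot>\<^sub>m (?b ?W l * ?b Z' 0)" if "l < r" for l
    unfolding F_def by (rule block_F_interleaved[OF interleaved_inverse[OF Z] Z'(1) G that r])
  have dW: "det (?b ?W l) \<noteq> 0" if "l < r" for l
    using det_nonzero_if_right_inverse[OF _ _ bi(1)[OF that]] by simp
  have dZ': "det (?b Z' 0) \<noteq> 0" using det_nonzero_if_right_inverse[OF _ _ bi'(2)[OF r]] by simp
  show det: "det (block_F r F l 0) \<noteq> 0" if "l < r" for l
    unfolding F[OF that] using dW[OF that] dZ' G0[OF that] 
    by (intro det_smult_mult_nonzero[OF interleaved_block_carrier _ interleaved_block_carrier])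
  have Fc: "block_F r F l 0 \<in> carrier_mat r r" for l by (simp add: block_F_def)
  have inv: "mat_inv (block_F r F l 0) = inverse (G $$ (l, 0)) \<cdot>\<^sub>m (?b (mat_inv Z') 0 * ?b Z l)" if l: "l < r" for l
  proof (rule mat_inv_eqI[OF Fc])
    have c: "?b ?W l * ?b Z' 0 \<in> carrier_mat r r" "?b (mat_inv Z') 0 * ?b Z l \<in> carrier_mat r r"
      by (auto intro!: mult_carrier_mat[OF interleaved_block_carrier interleaved_block_carrier])
    show "inverse (G $$ (l, 0)) \<cdot>\<^sub>m (?b (mat_inv Z') 0 * ?b Z l) \<in> carrier_mat r r" using c by simp
    have "?b ?W l * ?b Z' 0 * (?b (mat_inv Z') 0 * ?b Z l) = ?b ?W l * (?b Z' 0 * ?b (mat_inv Z') 0 * ?b Z l)"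
      by (intro assoc_mult_mat4[of _ r] interleaved_block_carrier)
    also have "\<dots> = 1\<^sub>m r" using bi(1)[OF l] bi'(2)[OF r] by (simp add: left_mult_one_mat[OF interleaved_block_carrier])
    finally show "block_F r F l 0 * (inverse (G $$ (l, 0)) \<cdot>\<^sub>m (?b (mat_inv Z') 0 * ?b Z l)) = 1\<^sub>m r"
      unfolding F[OF l] using G0[OF l] c
      unfolding smult_mult_smult[OF c] by (auto intro!: eq_matI)
  qed
  define Kh where "Kh l = (if l = 0 then 1\<^sub>m r else block_F r F 0 0 * mat_inv (block_F r F l 0))" for l
  have invc: "mat_inv (block_F r F l 0) \<in> carrier_mat r r" if "l < r" for l
    using mat_inv(1)[OF Fc det[OF that]] .
  have X: "interleaved r (Pi_perm r (K_hat r F))" "interleaved_block r (Pi_perm r (K_hat r F)) l = Kh l" if "l < r" for l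
    using Pi_K_hat[of r F] invc that by (auto simp: Kh_def)
  have K: "?b Z 0 * Kh l = (G $$ (0, 0) / G $$ (l, 0)) \<cdot>\<^sub>m ?b Z l" if l: "l < r" for l
  proof (cases "l = 0")
    case True
    then show ?thesis using G0[OF r] by (simp add: Kh_def right_mult_one_mat[OF interleaved_block_carrier])
  next
    case False
    have c: "?b ?W 0 * ?b Z' 0 \<in> carrier_mat r r" "?b (mat_inv Z') 0 * ?b Z l \<in> carrier_mat r r"
      by (auto intro!: mult_carrier_mat[OF interleaved_block_carrier interleaved_block_carrier])
    have "?b Z 0 * (?b ?W 0 * ?b Z' 0 * (?b (mat_inv Z') 0 * ?b Z l)) =
      ?b Z 0 * ?b ?W 0 * (?b Z' 0 * ?b (mat_inv Z') 0 * ?b Z l)"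
      using assoc_mult_mat4[OF interleaved_block_carrier interleaved_block_carrier
          interleaved_block_carrier interleaved_block_carrier, of r ?W 0 Z' 0 "mat_inv Z'" 0 Z l]
        assoc_mult_mat[OF interleaved_block_carrier[of r Z 0] interleaved_block_carrier[of r ?W 0]
          mult_carrier_mat[OF mult_carrier_mat[OF interleaved_block_carrier[of r Z' 0]
            interleaved_block_carrier[of r "mat_inv Z'" 0]] interleaved_block_carrier[of r Z l]]]
      by simp
    also have "\<dots> = ?b Z l" using bi(2)[OF r] bi'(2)[OF r] by (simp add: left_mult_one_mat[OF interleaved_block_carrier])
    finally have key: "?b Z 0 * (?b ?W 0 * ?b Z' 0 * (?b (mat_inv Z') 0 * ?b Z l)) = ?b Z l" .
    have cc: "?b ?W 0 * ?b Z' 0 * (?b (mat_inv Z') 0 * ?b Z l) \<in> carrier_mat r r" using c by auto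
    have "Kh l = (G $$ (0, 0) / G $$ (l, 0)) \<cdot>\<^sub>m (?b ?W 0 * ?b Z' 0 * (?b (mat_inv Z') 0 * ?b Z l))"
      unfolding Kh_def inv[OF l] F[OF r] smult_mult_smult[OF c] using False by (simp add: divide_inverse)
    then show ?thesis using key by (simp add: mult_smult_distrib[OF interleaved_block_carrier cc])
  qed
  let ?S = "mat_diag r (\<lambda>l. G $$ (l, 0) / G $$ (0, 0))"
  let ?X = "Pi_perm r (K_hat r F)"
  have kc: "kronecker (?b Z 0) ?S \<in> carrier_mat (r * r) (r * r)" by (auto intro!: kronecker_carrier)
  have Xc: "?X \<in> carrier_mat (r * r) (r * r)" using X(1)[OF r] by (simp add: interleaved_def)
  show "kronecker (?b Z 0) ?S * ?X = Z"
  proof (rule eq_mat_pair_index[of _ r])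
    fix i l j k assume ix: "i < r" "l < r" "j < r" "k < r"
    have Khc: "Kh k \<in> carrier_mat r r" using X(2)[OF ix(4)] by (metis interleaved_block_carrier)
    have "(kronecker (?b Z 0) ?S * ?X) $$ (i * r + l, j * r + k) =
      (\<Sum>p<r. \<Sum>q<r. kronecker (?b Z 0) ?S $$ (i * r + l, p * r + q) * ?X $$ (p * r + q, j * r + k))"
      using ix by (intro mult_mat_pair_entry[OF kc Xc]) (auto simp: pair_index_less)
    also have "\<dots> = (\<Sum>p<r. \<Sum>q<r. if q = k then ?b Z 0 $$ (i, p) * ?S $$ (l, k) * Kh k $$ (p, j) else 0)"
      using ix by (intro sum.cong refl)
        (auto simp: kronecker_entry[OF interleaved_block_carrier mat_diag_dim] interleaved_entry[OF X(1)[OF r]] X(2))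
    also have "\<dots> = (\<Sum>p<r. ?b Z 0 $$ (i, p) * Kh k $$ (p, j)) * ?S $$ (l, k)"
      using ix by (simp add: sum_distrib_left mult_ac)
    also have "(\<Sum>p<r. ?b Z 0 $$ (i, p) * Kh k $$ (p, j)) = (?b Z 0 * Kh k) $$ (i, j)"
      using mult_mat_entry[OF interleaved_block_carrier Khc] ix by simp
    also have "\<dots> = G $$ (0, 0) / G $$ (k, 0) * ?b Z k $$ (i, j)"
      unfolding K[OF ix(4)] using ix by (simp add: interleaved_block_def)
    also have "\<dots> * ?S $$ (l, k) = Z $$ (i * r + l, j * r + k)"
      using ix G0[OF r] G0[OF ix(4)] by (simp add: mat_diag_def interleaved_entry[OF Z(1)])
    finally show "(kronecker (?b Z 0) ?S * ?X) $$ (i * r + l, j * r + k) = Z $$ (i * r + l, j * r + k)" .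
  qed (use kc Xc Z in \<open>auto simp: interleaved_def intro!: mult_carrier_mat\<close>)
qed

text \<open>Converse direction: a zero entry G_l0 makes the block F^(l,0) zero. For positive
  \<open>l\<close> that block is itself inverted; for \<open>l = 0\<close> it is a factor of every
  later block of \<open>K_hat\<close>, which makes the permuted matrix singular.\<close>

lemma first_core_solvable_only_if:
  fixes r :: nat and G Z Z' :: "complex mat"
  defines "F \<equiv> mat_inv Z * (kronecker (1\<^sub>m r) G * Z')"
  assumes Z: "interleaved r Z" "det Z \<noteq> 0" and Z': "interleaved r Z'" and G: "G \<in> carrier_mat r r" and r: "2 \<le> r"
    and inv: "\<And>l. 0 < l \<Longrightarrow> l < r \<Longrightarrow> det (block_F r F l 0) \<noteq> 0" and P: "det (Pi_perm r (K_hat r F)) \<noteq> 0"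
    and l: "l < r"
  shows "G $$ (l, 0) \<noteq> 0"
proof
  assume 0: "G $$ (l, 0) = 0"
  let ?b = "interleaved_block r"
  have "block_F r F l 0 = G $$ (l, 0) \<cdot>\<^sub>m (?b (mat_inv Z) l * ?b Z' 0)"
    unfolding F_def by (rule block_F_interleaved[OF interleaved_inverse[OF Z] Z' G l]) (use r in simp)
  then have z: "block_F r F l 0 = 0\<^sub>m r r" unfolding 0 by (auto simp: interleaved_block_def)
  show False
  proof (cases "l = 0")
    case False
    have "det (block_F r F l 0) = 0" unfolding z using r by (simp add: det_zero)
    then show False using inv[of l] False l by simp
  next
    case True
    have Fc: "block_F r F l 0 \<in> carrier_mat r r" for l by (simp add: block_F_def)
    have ic: "mat_inv (block_F r F l 0) \<in> carrier_mat r r" if "0 < l" "l < r" for l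
      using mat_inv(1)[OF Fc inv[OF that]] .
    let ?X = "Pi_perm r (K_hat r F)"
    note X = Pi_K_hat[OF ic]
    have Xc: "?X \<in> carrier_mat (r * r) (r * r)" by (simp add: Pi_perm_def)
    \<comment> \<open>Block 1 exists because \<open>r\<close> is at least 2; when it vanishes, so
      does column 1 of \<open>?X\<close>.\<close>
    have "?b ?X 1 = 0\<^sub>m r r" using X(2)[of 1] z True r ic[of 1] by simp
    then have col0: "?X $$ (c, 1) = 0" if "c < r * r" for c
    proof -
      have "?X $$ (c div r * r + c mod r, 0 * r + 1) = (if c mod r = 1 then ?b ?X 1 $$ (c div r, 0) else 0)"
        using pair_index_div_less[OF that] r by (intro interleaved_entry[OF X(1)]) auto
      then show ?thesis using \<open>?b ?X 1 = _\<close> pair_index_div_less[OF that] r by simp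
    qed
    have 1: "1 < r * r" using pair_index_less[of 0 r 1] r by simp
    have "?X *\<^sub>v unit_vec (r * r) 1 = 0\<^sub>v (r * r)"
      using Xc col0 1 by (intro eq_vecI) (auto simp: mult_mat_vec_entry[OF Xc] unit_vec_def simp del: index_mult_mat_vec)
    then have "unit_vec (r * r) 1 = (0\<^sub>v (r * r) :: complex vec)"
      using det_nonzero_iff_inj[OF Xc] P by simp
    from arg_cong[OF this, of "\<lambda>v. v $ 1"] show False using 1 by simp
  qed
qed

subsection \<open>Correctness of the algorithm for generic cores\<close>

lemma mat_inv_mat_inv:
  assumes "A \<in> carrier_mat n n" "det A \<noteq> 0"
  shows "mat_inv (mat_inv A) = A"
  using mat_inv_eqI[OF mat_inv(1)[OF assms] assms(1) mat_inv(3)[OF assms]] .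

lemma mat_inv_mult:
  assumes A: "A \<in> carrier_mat n n" "det A \<noteq> 0" and B: "B \<in> carrier_mat n n" "det B \<noteq> 0"
  shows "mat_inv (A * B) = mat_inv B * mat_inv A"
proof (rule mat_inv_eqI)
  note a = mat_inv[OF A] and b = mat_inv[OF B]
  show "A * B \<in> carrier_mat n n" "mat_inv B * mat_inv A \<in> carrier_mat n n" using A B a b by auto
  have "A * B * (mat_inv B * mat_inv A) = A * (B * (mat_inv B * mat_inv A))"
    using assoc_mult_mat[OF A(1) B(1) mult_carrier_mat[OF b(1) a(1)]] .
  then show "A * B * (mat_inv B * mat_inv A) = 1\<^sub>m n"
    using mat_inv_mult_cancel(1)[OF B a(1)] a by simp
qed

lemma unfold_angle_mult_kronecker:
  assumes C: "\<And>a. a < m \<Longrightarrow> C a \<in> carrier_mat r r" and L: "L \<in> carrier_mat r r" and M: "M \<in> carrier_mat r r"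
  shows "unfold_angle m r C * kronecker L M = unfold_angle m r (\<lambda>a. transpose_mat L * C a * M)"
proof (rule eq_matI)
  let ?l = "unfold_angle m r C * kronecker L M" and ?r = "unfold_angle m r (\<lambda>a. transpose_mat L * C a * M)"
  have k: "kronecker L M \<in> carrier_mat (r * r) (r * r)" using L M by (rule kronecker_carrier)
  have l: "?l \<in> carrier_mat m (r * r)" by (rule mult_carrier_mat[OF unfold_angle_carrier k])
  have r: "?r \<in> carrier_mat m (r * r)" by simp
  show "dim_row ?l = dim_row ?r" "dim_col ?l = dim_col ?r"
    using carrier_matD[OF l] carrier_matD[OF r] by simp_all
  fix a c assume "a < dim_row ?r" "c < dim_col ?r"
  then have a: "a < m" and c: "c < r * r" unfolding carrier_matD[OF r] .
  from c show "?l $$ (a, c) = ?r $$ (a, c)"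
  proof (rule all_pair_indexI[of r "\<lambda>c. ?l $$ (a, c) = ?r $$ (a, c)", rotated])
    fix j q assume jq: "j < r" "q < r"
    have LT: "transpose_mat L \<in> carrier_mat r r" using L by simp
    have "?l $$ (a, j * r + q) = (\<Sum>i<r. \<Sum>l<r. unfold_angle m r C $$ (a, i * r + l) * kronecker L M $$ (i * r + l, j * r + q))"
      using jq a by (intro mult_mat_pair_entry[OF unfold_angle_carrier k]) (auto simp: pair_index_less)
    also have "\<dots> = (\<Sum>i<r. \<Sum>l<r. transpose_mat L $$ (j, i) * C a $$ (i, l) * M $$ (l, q))"
      using jq a L by (intro sum.cong refl) (auto simp: unfold_angle_entry kronecker_entry[OF L M])
    also have "\<dots> = (\<Sum>l<r. (\<Sum>i<r. transpose_mat L $$ (j, i) * C a $$ (i, l)) * M $$ (l, q))"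
      by (subst sum.swap) (simp add: sum_distrib_right)
    also have "\<dots> = (\<Sum>l<r. (transpose_mat L * C a) $$ (j, l) * M $$ (l, q))"
      using jq by (simp add: mult_mat_entry[OF LT C[OF a]] del: index_mult_mat)
    also have "\<dots> = ?r $$ (a, j * r + q)"
      using jq a mult_mat_entry[OF mult_carrier_mat[OF LT C[OF a]] M] by (simp add: unfold_angle_entry)
    finally show "?l $$ (a, j * r + q) = ?r $$ (a, j * r + q)" .
  qed
qed

section \<open>Quotient matrices, their stacks and the gauge\<close>

context tensor_ring
begin

abbreviation A :: "complex mat" where "A \<equiv> unfold_angle (n 1) r (Q 1)"

abbreviation M :: "(nat \<Rightarrow> nat) \<Rightarrow> complex mat" where "M \<alpha> \<equiv> slice_prod r Q \<alpha> [2..<d]"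

abbreviation J :: "(nat \<Rightarrow> nat) \<Rightarrow> nat set \<Rightarrow> complex mat" where
  "J \<alpha> G \<equiv> kronecker (1\<^sub>m r) (M \<alpha>) * slice_columns (n d) r (Q d) G"

lemma n1: "r * r \<le> n 1"
  using n[of 1] d by (simp add: power2_eq_square)

lemma top_A: "mat (r * r) (r * r) (\<lambda>(i, j). A $$ (i, j)) = unfold_angle (r * r) r (Q 1)"
  using n1 by (auto simp: unfold_angle_def)

text \<open>The inverse of the leading square block of \<open>A\<close>, padded with zero
  columns.\<close>

lemma A_left_inverse: "\<exists>Ai\<in>carrier_mat (r * r) (n 1). Ai * A = 1\<^sub>m (r * r)"
proof
  let ?U = "unfold_angle (r * r) r (Q 1)"
  note i = mat_inv[OF unfold_angle_carrier det_unfold_angle]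
  let ?Ai = "mat (r * r) (n 1) (\<lambda>(c, a). if a < r * r then mat_inv ?U $$ (c, a) else 0)"
  show Ai: "?Ai \<in> carrier_mat (r * r) (n 1)" by simp
  have AiA: "?Ai * A \<in> carrier_mat (r * r) (r * r)" by (rule mult_carrier_mat[OF Ai unfold_angle_carrier])
  show "?Ai * A = 1\<^sub>m (r * r)"
  proof (rule eq_matI)
    fix c c' assume "c < dim_row (1\<^sub>m (r * r))" "c' < dim_col (1\<^sub>m (r * r))"
    then have c: "c < r * r" "c' < r * r" by auto
    have "(?Ai * A) $$ (c, c') = (\<Sum>a<n 1. ?Ai $$ (c, a) * A $$ (a, c'))"
      by (rule mult_mat_entry[OF Ai unfold_angle_carrier c])
    also have "\<dots> = (\<Sum>a<r * r. ?Ai $$ (c, a) * A $$ (a, c'))"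
      by (rule sum.mono_neutral_right) (use n1 c in auto)
    also have "\<dots> = (\<Sum>a<r * r. mat_inv ?U $$ (c, a) * ?U $$ (a, c'))"
      using n1 c by (intro sum.cong refl) (auto simp: unfold_angle_def)
    also have "\<dots> = 1\<^sub>m (r * r) $$ (c, c')"
      unfolding mult_mat_entry[OF i(1) unfold_angle_carrier c, symmetric] i(3) ..
    finally show "(?Ai * A) $$ (c, c') = 1\<^sub>m (r * r) $$ (c, c')" .
  qed (use carrier_matD[OF AiA] in simp_all)
qed

lemma multi_index_less: "\<alpha> \<in> multi_indices {2..d-1} n \<Longrightarrow> k \<in> {2..<d} \<Longrightarrow> \<alpha> k < n k"
  by (auto simp: multi_indices_def PiE_iff)

lemma det_M: "\<alpha> \<in> multi_indices {2..d-1} n \<Longrightarrow> det (M \<alpha>) \<noteq> 0"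
  by (intro det_slice_prod_Q) (auto intro!: multi_index_less)

lemma J_carrier: "index_subset (n d) r G \<Longrightarrow> J \<alpha> G \<in> carrier_mat (r * r) (r * r)"
  by (intro mult_carrier_mat[OF kronecker_carrier[OF one_carrier_mat slice_prod_Q] slice_columns_carrier])

lemma det_J:
  assumes "\<alpha> \<in> multi_indices {2..d-1} n" "index_subset (n d) r G"
  shows "det (J \<alpha> G) \<noteq> 0"
proof -
  have "det (kronecker (1\<^sub>m r) (M \<alpha>)) \<noteq> 0"
    using det_M[OF assms(1)] by (intro det_kronecker_nonzero) auto
  moreover have "det (slice_columns (n d) r (Q d) G) \<noteq> 0"
    using d by (intro det_slice_columns assms) auto
  ultimately show ?thesis
    by (simp add: det_mult[OF kronecker_carrier[OF one_carrier_mat slice_prod_Q] slice_columns_carrier[OF assms(2)]])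
qed

text \<open>The matrix \<open>J \<beta> G'\<close> times the pseudoinverse of
  \<open>A * J \<beta> G'\<close> is a left inverse of \<open>A\<close>, which brings the quotient
  into the shape required by \<open>eigenvector_stackE\<close>. The two column sets may differ, as
  the exclusion of stacks for unequal sets also starts from this factorization.\<close>

lemma quotient_mat_factor:
  assumes \<beta>: "\<beta> \<in> multi_indices {2..d-1} n" and \<alpha>: "\<alpha> \<in> multi_indices {2..d-1} n"
    and G: "index_subset (n d) r G" "index_subset (n d) r G'"
  obtains Ap where "Ap \<in> carrier_mat (r * r) (n 1)" "Ap * A = 1\<^sub>m (r * r)"
    "quotient_mat d n T \<alpha> G \<beta> G' = A * (J \<alpha> G * mat_inv (J \<beta> G')) * Ap"
proof -
  note Jc = J_carrier[OF G(2), of \<beta>] and Jd = det_J[OF \<beta> G(2)] and Jc' = J_carrier[OF G(1), of \<alpha>]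
  note Ji = mat_inv[OF Jc Jd]
  note Ac = unfold_angle_carrier[of "n 1" r "Q 1"]
  have F: "A * J \<beta> G' \<in> carrier_mat (n 1) (r * r)" by (rule mult_carrier_mat[OF Ac Jc])
  obtain Ai where Ai: "Ai \<in> carrier_mat (r * r) (n 1)" "Ai * A = 1\<^sub>m (r * r)" using A_left_inverse by blast
  have AJ: "Ai * (A * J \<beta> G') = J \<beta> G'" using assoc_mult_mat[OF Ai(1) Ac Jc] Ai(2) left_mult_one_mat[OF Jc] by simp
  have "mat_inv (J \<beta> G') * Ai * (A * J \<beta> G') = 1\<^sub>m (r * r)"
    using assoc_mult_mat[OF Ji(1) Ai(1) F] AJ Ji(3) by simp
  note P = pinv_left_inverse[OF F mult_carrier_mat[OF Ji(1) Ai(1)] this]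
  let ?P = "pinv (A * J \<beta> G')"
  let ?Ap = "J \<beta> G' * ?P"
  have Ap: "?Ap \<in> carrier_mat (r * r) (n 1)" by (rule mult_carrier_mat[OF Jc P(1)])
  have PA: "?P * A \<in> carrier_mat (r * r) (r * r)" by (rule mult_carrier_mat[OF P(1) Ac])
  have "?P * A * J \<beta> G' = 1\<^sub>m (r * r)" using assoc_mult_mat[OF P(1) Ac Jc] P(2) by simp
  \<comment> \<open>A left inverse of a square matrix is also a right inverse; this moves
    \<open>J \<beta> G'\<close> to the front.\<close>
  then have "J \<beta> G' * (?P * A) = 1\<^sub>m (r * r)" by (rule mat_mult_left_right_inverse[OF PA Jc])
  then have ApA: "?Ap * A = 1\<^sub>m (r * r)" using assoc_mult_mat[OF Jc P(1) Ac] by simp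
  have JJ: "J \<alpha> G * mat_inv (J \<beta> G') \<in> carrier_mat (r * r) (r * r)" by (rule mult_carrier_mat[OF Jc' Ji(1)])
  have "A * (J \<alpha> G * mat_inv (J \<beta> G')) * ?Ap = A * (J \<alpha> G * (mat_inv (J \<beta> G') * ?Ap))"
    using assoc_mult_mat[OF Ac JJ Ap] assoc_mult_mat[OF Jc' Ji(1) Ap] by simp
  also have "mat_inv (J \<beta> G') * ?Ap = ?P" using mat_inv_mult_cancel(2)[OF Jc Jd P(1)] .
  also have "A * (J \<alpha> G * ?P) = quotient_mat d n T \<alpha> G \<beta> G'"
    unfolding quotient_mat_def fiber_mat_factor[OF \<alpha> G(1)] fiber_mat_factor[OF \<beta> G(2)]
    using assoc_mult_mat[OF Ac Jc' P(1)] by simp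
  finally show thesis using Ap ApA by (intro that[of ?Ap]) simp_all
qed

definition H :: "(nat \<Rightarrow> nat) \<Rightarrow> (nat \<Rightarrow> nat) \<Rightarrow> complex mat" where
  "H \<alpha> \<beta> = M \<alpha> * mat_inv (M \<beta>)"

lemma H_carrier: "\<beta> \<in> multi_indices {2..d-1} n \<Longrightarrow> H \<alpha> \<beta> \<in> carrier_mat r r"
  unfolding H_def by (intro mult_carrier_mat[OF slice_prod_Q] mat_inv(1) det_M slice_prod_Q)

text \<open>Equality of the column sets enters here: the factor contributed by the last core is the
  same in both matrices and cancels in the middle.\<close>

lemma J_quotient:
  assumes \<beta>: "\<beta> \<in> multi_indices {2..d-1} n" and G: "index_subset (n d) r G"
  shows "J \<alpha> G * mat_inv (J \<beta> G) = kronecker (1\<^sub>m r) (H \<alpha> \<beta>)"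
proof -
  let ?B = "slice_columns (n d) r (Q d) G"
  let ?k = "\<lambda>X. kronecker (1\<^sub>m r) X"
  note B = slice_columns_carrier[OF G, of "Q d"]
  have dB: "det ?B \<noteq> 0" using d by (intro det_slice_columns G) auto
  note k = kronecker_carrier[OF one_carrier_mat]
  note Mi = mat_inv[OF slice_prod_Q det_M[OF \<beta>]]
  note Mk = kronecker_carrier[OF one_carrier_mat slice_prod_Q]
  have dk: "det (?k (M \<beta>)) \<noteq> 0" using det_M[OF \<beta>] by (intro det_kronecker_nonzero) auto
  have ki: "mat_inv (?k (M \<beta>)) = ?k (mat_inv (M \<beta>))"
    using kronecker_mult[OF one_carrier_mat slice_prod_Q one_carrier_mat Mi(1)] Mi(2)
    by (intro mat_inv_eqI[OF Mk k[OF Mi(1)]]) (simp add: kronecker_one)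
  have "J \<alpha> G * mat_inv (J \<beta> G) = ?k (M \<alpha>) * (?B * (mat_inv ?B * mat_inv (?k (M \<beta>))))"
    unfolding mat_inv_mult[OF Mk dk B dB]
    by (rule assoc_mult_mat[OF Mk B mult_carrier_mat[OF mat_inv(1)[OF B dB] mat_inv(1)[OF Mk dk]]])
  also have "\<dots> = ?k (M \<alpha>) * ?k (mat_inv (M \<beta>))"
    using mat_inv_mult_cancel(1)[OF B dB mat_inv(1)[OF Mk dk]] unfolding ki by simp
  also have "\<dots> = ?k (H \<alpha> \<beta>)"
    unfolding H_def using kronecker_mult[OF one_carrier_mat slice_prod_Q one_carrier_mat Mi(1)] by simp
  finally show ?thesis .
qed

lemma stack_structure:
  assumes \<alpha>: "\<alpha> \<in> multi_indices {2..d-1} n" and \<beta>: "\<beta> \<in> multi_indices {2..d-1} n"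
    and G: "index_subset (n d) r G" and S: "eigenvector_stack r (quotient_mat d n T \<alpha> G \<beta> G) E"
  obtains \<Lambda> Z \<nu> where "\<Lambda> \<in> carrier_mat r r" "det \<Lambda> \<noteq> 0" "H \<alpha> \<beta> * \<Lambda> = \<Lambda> * mat_diag r \<nu>"
    "interleaved r Z" "det Z \<noteq> 0" "E = A * (kronecker (1\<^sub>m r) \<Lambda> * Z)"
proof -
  note Hc = H_carrier[OF \<beta>, of \<alpha>]
  obtain Ap where Ap: "Ap \<in> carrier_mat (r * r) (n 1)" "Ap * A = 1\<^sub>m (r * r)"
    "quotient_mat d n T \<alpha> G \<beta> G = A * kronecker (1\<^sub>m r) (H \<alpha> \<beta>) * Ap"
    using quotient_mat_factor[OF \<beta> \<alpha> G G] unfolding J_quotient[OF \<beta> G] by blast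
  obtain Y \<nu> where Y: "Y \<in> carrier_mat (r * r) (r * r)" "det Y \<noteq> 0" "E = A * Y"
    "kronecker (1\<^sub>m r) (H \<alpha> \<beta>) * Y = Y * mat_diag (r * r) (\<lambda>c. \<nu> (c mod r))" "inj_on \<nu> {..<r}"
    using eigenvector_stackE[OF unfold_angle_carrier Ap(1,2) kronecker_carrier[OF one_carrier_mat Hc] Ap(3) S] by metis
  show thesis
    using eigenvectors_of_kronecker_one[OF Hc Y(1,2,4,5)] that Y(3) by metis
qed

lemma eigenvector_stack_exists:
  assumes \<alpha>: "\<alpha> \<in> multi_indices {2..d-1} n" and \<beta>: "\<beta> \<in> multi_indices {2..d-1} n"
    and G: "index_subset (n d) r G"
    and \<Lambda>: "\<Lambda> \<in> carrier_mat r r" "det \<Lambda> \<noteq> 0" and H\<Lambda>: "H \<alpha> \<beta> * \<Lambda> = \<Lambda> * mat_diag r \<nu>"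
    and \<nu>: "inj_on \<nu> {..<r}" "\<And>k. k < r \<Longrightarrow> \<nu> k \<noteq> 0"
  shows "\<exists>E. eigenvector_stack r (quotient_mat d n T \<alpha> G \<beta> G) E"
proof -
  note Hc = H_carrier[OF \<beta>, of \<alpha>]
  obtain Ap where Ap: "Ap \<in> carrier_mat (r * r) (n 1)" "Ap * A = 1\<^sub>m (r * r)"
    "quotient_mat d n T \<alpha> G \<beta> G = A * kronecker (1\<^sub>m r) (H \<alpha> \<beta>) * Ap"
    using quotient_mat_factor[OF \<beta> \<alpha> G G] unfolding J_quotient[OF \<beta> G] by blast
  have kd: "det (kronecker (1\<^sub>m r) \<Lambda>) \<noteq> 0" using \<Lambda> by (intro det_kronecker_nonzero) auto
  have "kronecker (1\<^sub>m r) (H \<alpha> \<beta>) * kronecker (1\<^sub>m r) \<Lambda> = kronecker (1\<^sub>m r) \<Lambda> * kronecker (1\<^sub>m r) (mat_diag r \<nu>)"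
    using kronecker_mult[OF one_carrier_mat Hc one_carrier_mat \<Lambda>(1)]
      kronecker_mult[OF one_carrier_mat \<Lambda>(1) one_carrier_mat mat_diag_dim, of \<nu>] H\<Lambda> by simp
  note CY = this[unfolded kronecker_one_diag]
  have top: "det (mat (r * r) (r * r) (\<lambda>(i, j). A $$ (i, j))) \<noteq> 0"
    unfolding top_A by (rule det_unfold_angle)
  show ?thesis
    using eigenvector_stackI[OF unfold_angle_carrier Ap(1,2) n1 top kronecker_carrier[OF one_carrier_mat Hc] Ap(3)
        kronecker_carrier[OF one_carrier_mat \<Lambda>(1)] kd CY \<nu>] by blast
qed

text \<open>Both stacks span the range of \<open>A\<close>, so E' = E (Y^-1 Y') with Y and Y' their
  coordinates, and any left inverse of \<open>E\<close> extracts the second factor.\<close>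

lemma pinv_stack_mult:
  assumes E: "E = A * (kronecker (1\<^sub>m r) \<Lambda> * Z)" and E': "E' = A * (kronecker (1\<^sub>m r) \<Lambda>' * Z')"
    and \<Lambda>: "\<Lambda> \<in> carrier_mat r r" "det \<Lambda> \<noteq> 0" and \<Lambda>': "\<Lambda>' \<in> carrier_mat r r"
    and Z: "Z \<in> carrier_mat (r * r) (r * r)" "det Z \<noteq> 0" and Z': "Z' \<in> carrier_mat (r * r) (r * r)"
  shows "pinv E * E' = mat_inv Z * (kronecker (1\<^sub>m r) (mat_inv \<Lambda> * \<Lambda>') * Z')"
proof -
  let ?k = "\<lambda>X. kronecker (1\<^sub>m r) X"
  note k = kronecker_carrier[OF one_carrier_mat]
  note Ac = unfold_angle_carrier[of "n 1" r "Q 1"]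
  note li = mat_inv[OF \<Lambda>] and zi = mat_inv[OF Z]
  have kd: "det (?k \<Lambda>) \<noteq> 0" using \<Lambda> by (intro det_kronecker_nonzero) auto
  have ki: "mat_inv (?k \<Lambda>) = ?k (mat_inv \<Lambda>)"
    using kronecker_mult[OF one_carrier_mat \<Lambda>(1) one_carrier_mat li(1)] li(2)
    by (intro mat_inv_eqI[OF k[OF \<Lambda>(1)] k[OF li(1)]]) (simp add: kronecker_one)
  let ?Y = "?k \<Lambda> * Z" and ?Y' = "?k \<Lambda>' * Z'"
  have Y: "?Y \<in> carrier_mat (r * r) (r * r)" "det ?Y \<noteq> 0" and Y': "?Y' \<in> carrier_mat (r * r) (r * r)"
    using k \<Lambda> \<Lambda>' Z Z' kd by (auto simp: det_mult[of _ "r * r"] intro!: mult_carrier_mat)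
  note yi = mat_inv[OF Y]
  obtain Ai where Ai: "Ai \<in> carrier_mat (r * r) (n 1)" "Ai * A = 1\<^sub>m (r * r)" using A_left_inverse by blast
  have Ec: "E \<in> carrier_mat (n 1) (r * r)" unfolding E by (rule mult_carrier_mat[OF Ac Y(1)])
  have "Ai * E = ?Y" unfolding E using assoc_mult_mat[OF Ai(1) Ac Y(1)] Ai(2) left_mult_one_mat[OF Y(1)] by simp
  then have "mat_inv ?Y * Ai * E = 1\<^sub>m (r * r)" using assoc_mult_mat[OF yi(1) Ai(1) Ec] yi(3) by simp
  note P = pinv_left_inverse[OF Ec mult_carrier_mat[OF yi(1) Ai(1)] this]
  have YY: "mat_inv ?Y * ?Y' \<in> carrier_mat (r * r) (r * r)" by (rule mult_carrier_mat[OF yi(1) Y'])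
  have "E' = E * (mat_inv ?Y * ?Y')"
    unfolding E E' using assoc_mult_mat[OF Ac Y(1) YY] mat_inv_mult_cancel(1)[OF Y Y'] by simp
  then have "pinv E * E' = mat_inv ?Y * ?Y'"
    using assoc_mult_mat[OF P(1) Ec YY] P(2) left_mult_one_mat[OF YY] by simp
  also have "\<dots> = mat_inv Z * ?k (mat_inv \<Lambda>) * ?Y'" using mat_inv_mult[OF k[OF \<Lambda>(1)] kd Z] ki by simp
  also have "\<dots> = mat_inv Z * (?k (mat_inv \<Lambda>) * ?k \<Lambda>' * Z')"
    using assoc_mult_mat[OF zi(1) k[OF li(1)] Y'] assoc_mult_mat[OF k[OF li(1)] k[OF \<Lambda>'] Z'] by simp
  finally show ?thesis using kronecker_mult[OF one_carrier_mat li(1) one_carrier_mat \<Lambda>'] by simp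
qed

text \<open>By \<open>first_core_equation\<close>, E = A (Z_0 \<otimes> \<Lambda> S) Pi(K) with S
  the diagonal matrix of scalars. Dividing by Pi(K) leaves a Kronecker product acting on the
  unfolding, i.e. multiplication of every slice by Z_0^T on the left and \<Lambda> S on the right.
  These give L1^-1 and L2.\<close>

lemma first_core:
  fixes E E' :: "complex mat"
  defines "F \<equiv> pinv E * E'"
  assumes E: "E = A * (kronecker (1\<^sub>m r) \<Lambda> * Z)" and E': "E' = A * (kronecker (1\<^sub>m r) \<Lambda>' * Z')"
    and \<Lambda>: "\<Lambda> \<in> carrier_mat r r" "det \<Lambda> \<noteq> 0" and \<Lambda>': "\<Lambda>' \<in> carrier_mat r r"
    and Z: "interleaved r Z" "det Z \<noteq> 0" and Z': "interleaved r Z'" "det Z' \<noteq> 0"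
    and G0: "\<And>l. l < r \<Longrightarrow> (mat_inv \<Lambda> * \<Lambda>') $$ (l, 0) \<noteq> 0"
  obtains L1 L2 where "L1 \<in> carrier_mat r r" "det L1 \<noteq> 0" "L2 \<in> carrier_mat r r" "det L2 \<noteq> 0"
    "\<And>l. l < r \<Longrightarrow> det (block_F r F l 0) \<noteq> 0" "det (Pi_perm r (K_hat r F)) \<noteq> 0"
    "E * mat_inv (Pi_perm r (K_hat r F)) = unfold_angle (n 1) r (\<lambda>a. mat_inv L1 * Q 1 a * L2)"
proof -
  let ?k = "\<lambda>X. kronecker (1\<^sub>m r) X"
  let ?X = "Pi_perm r (K_hat r F)" and ?G = "mat_inv \<Lambda> * \<Lambda>'" and ?K = "interleaved_block r Z 0"
  let ?S = "mat_diag r (\<lambda>l. ?G $$ (l, 0) / ?G $$ (0, 0))"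
  have r0: "0 < r" using r by simp
  note Ac = unfold_angle_carrier[of "n 1" r "Q 1"]
  note li = mat_inv[OF \<Lambda>]
  have Zc: "Z \<in> carrier_mat (r * r) (r * r)" and Zc': "Z' \<in> carrier_mat (r * r) (r * r)"
    using Z Z' by (simp_all add: interleaved_def)
  have Gc: "?G \<in> carrier_mat r r" by (rule mult_carrier_mat[OF li(1) \<Lambda>'])
  have F: "F = mat_inv Z * (?k ?G * Z')" unfolding F_def by (rule pinv_stack_mult[OF E E' \<Lambda> \<Lambda>' Zc Z(2) Zc'])
  note fc = first_core_equation[OF Z Z' Gc G0 r0, folded F]
  have KS: "kronecker ?K ?S \<in> carrier_mat (r * r) (r * r)" by (auto intro!: kronecker_carrier)
  have X: "?X \<in> carrier_mat (r * r) (r * r)" by (simp add: Pi_perm_def)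
  have dX: "det ?X \<noteq> 0" using det_mult[OF KS X] fc(2) Z(2) by auto
  have dS: "det ?S \<noteq> 0"
  proof (rule det_nonzero_if_right_inverse[of _ r "mat_diag r (\<lambda>l. ?G $$ (0, 0) / ?G $$ (l, 0))"])
    show "?S * mat_diag r (\<lambda>l. ?G $$ (0, 0) / ?G $$ (l, 0)) = 1\<^sub>m r"
      unfolding mat_diag_diag using G0 r0 by (intro eq_matI) (auto simp: mat_diag_def simp del: index_mult_mat)
  qed simp_all
  have dK: "det ?K \<noteq> 0"
    using det_nonzero_if_right_inverse[OF interleaved_block_carrier interleaved_block_carrier interleaved_block_inverse(2)[OF Z r0]] .
  have dKT: "det (transpose_mat ?K) \<noteq> 0" using dK det_transpose[OF interleaved_block_carrier[of r Z 0]] by simp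
  have KT: "transpose_mat ?K \<in> carrier_mat r r" using interleaved_block_carrier[of r Z 0] by simp
  have LS: "\<Lambda> * ?S \<in> carrier_mat r r" by (rule mult_carrier_mat[OF \<Lambda>(1) mat_diag_dim])
  have dLS: "det (\<Lambda> * ?S) \<noteq> 0" using \<Lambda> dS by (simp add: det_mult[OF \<Lambda>(1) mat_diag_dim])
  have kl: "?k \<Lambda> \<in> carrier_mat (r * r) (r * r)" by (rule kronecker_carrier[OF one_carrier_mat \<Lambda>(1)])
  have kk: "kronecker ?K (\<Lambda> * ?S) \<in> carrier_mat (r * r) (r * r)"
    by (rule kronecker_carrier[OF interleaved_block_carrier LS])
  have "?k \<Lambda> * Z = ?k \<Lambda> * kronecker ?K ?S * ?X"
    using assoc_mult_mat[OF kl KS X] fc(2) by simp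
  also have "?k \<Lambda> * kronecker ?K ?S = kronecker ?K (\<Lambda> * ?S)"
    using kronecker_mult[OF one_carrier_mat \<Lambda>(1) interleaved_block_carrier mat_diag_dim, of Z 0]
    by (simp add: left_mult_one_mat[OF interleaved_block_carrier])
  finally have "E = A * kronecker ?K (\<Lambda> * ?S) * ?X"
    unfolding E using assoc_mult_mat[OF Ac kk X] by simp
  then have "E * mat_inv ?X = A * kronecker ?K (\<Lambda> * ?S) * (?X * mat_inv ?X)"
    by (simp only: assoc_mult_mat[OF mult_carrier_mat[OF Ac kk] X mat_inv(1)[OF X dX]])
  also have "\<dots> = A * kronecker ?K (\<Lambda> * ?S)"
    unfolding mat_inv(2)[OF X dX] by (rule right_mult_one_mat[OF mult_carrier_mat[OF Ac kk]])
  also have "\<dots> = unfold_angle (n 1) r (\<lambda>a. transpose_mat ?K * Q 1 a * (\<Lambda> * ?S))"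
    by (rule unfold_angle_mult_kronecker[OF Q interleaved_block_carrier LS])
  finally show thesis
    using that[OF mat_inv(1)[OF KT dKT] det_mat_inv[OF KT dKT] LS dLS fc(1) dX] mat_inv_mat_inv[OF KT dKT] by simp
qed

lemma gauge_equivalent_gauge:
  assumes \<gamma>: "\<gamma> \<in> multi_indices {1..d} n"
    and L1: "L1 \<in> carrier_mat r r" "det L1 \<noteq> 0" and L2: "L2 \<in> carrier_mat r r" "det L2 \<noteq> 0"
    and Qh: "\<And>k a. k \<in> {1..d} \<Longrightarrow> a < n k \<Longrightarrow> Qh k a = mat_inv (gauge \<gamma> L1 L2 k) * Q k a * gauge \<gamma> L1 L2 (Suc k)"
  shows "gauge_equivalent d n r Q Qh"
  unfolding gauge_equivalent_def
proof (intro exI[of _ "gauge \<gamma> L1 L2"] conjI ballI allI impI)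
  fix k show "gauge \<gamma> L1 L2 k \<in> carrier_mat r r" by (rule gauge_carrier[OF \<gamma> L1 L2])
  then show "invertible_mat (gauge \<gamma> L1 L2 k)"
    using invertible_mat_iff_det det_gauge[OF \<gamma> L1 L2] by blast
next
  show "gauge \<gamma> L1 L2 (d + 1) = gauge \<gamma> L1 L2 1"
    using gauge_end[OF \<gamma> L1 L2] by (simp add: gauge_def)
qed (use Qh in simp)

text \<open>The first core fixes \<open>L1\<close> and \<open>L2\<close>, and with them the whole
  gauge. The induction is a strong one because step \<open>k\<close> multiplies slices of all
  earlier recovered cores.\<close>

theorem blostr_gauge_equivalent:
  assumes idx: "\<alpha> \<in> multi_indices {2..d-1} n" "\<beta> \<in> multi_indices {2..d-1} n"
      "\<alpha>' \<in> multi_indices {2..d-1} n" "\<beta>' \<in> multi_indices {2..d-1} n" "\<gamma> \<in> multi_indices {1..d} n"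
    and G: "index_subset (n d) r G\<^sub>1" "index_subset (n d) r G\<^sub>2" "\<And>k. k \<in> {1..d-1} \<Longrightarrow> index_subset (n k) r (G k)"
    and S: "eigenvector_stack r (quotient_mat d n T \<alpha> G\<^sub>1 \<beta> G\<^sub>1) E"
      "eigenvector_stack r (quotient_mat d n T \<alpha>' G\<^sub>2 \<beta>' G\<^sub>2) E'"
    and B: "blostr_steps d n r T \<gamma> G E E' Qh"
  shows "gauge_equivalent d n r Q Qh"
proof -
  let ?F = "pinv E * E'"
  obtain \<Lambda> Z \<nu> where 1: "\<Lambda> \<in> carrier_mat r r" "det \<Lambda> \<noteq> 0" "interleaved r Z" "det Z \<noteq> 0"
    "E = A * (kronecker (1\<^sub>m r) \<Lambda> * Z)"
    using stack_structure[OF idx(1,2) G(1) S(1)] by metis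
  obtain \<Lambda>' Z' \<nu>' where 2: "\<Lambda>' \<in> carrier_mat r r" "interleaved r Z'" "det Z' \<noteq> 0"
    "E' = A * (kronecker (1\<^sub>m r) \<Lambda>' * Z')"
    using stack_structure[OF idx(3,4) G(2) S(2)] by metis
  have Zc: "Z \<in> carrier_mat (r * r) (r * r)" "Z' \<in> carrier_mat (r * r) (r * r)"
    using 1 2 by (simp_all add: interleaved_def)
  note F = pinv_stack_mult[OF 1(5) 2(4) 1(1,2) 2(1) Zc(1) 1(4) Zc(2)]
  have Qhc: "Qh k a \<in> carrier_mat r r" if "k \<in> {1..d}" "a < n k" for k a
    using B that by (simp add: blostr_steps_def)
  have bF: "invertible_mat (block_F r ?F l 0)" if "0 < l" "l < r" for l
    using B that by (simp add: blostr_steps_def Let_def)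
  have P: "invertible_mat (Pi_perm r (K_hat r ?F))"
    and first: "unfold_angle (n 1) r (Qh 1) = E * mat_inv (Pi_perm r (K_hat r ?F))"
    using B by (simp_all add: blostr_steps_def Let_def)
  have steps: "unfold_angle (n k) r (Qh k) = S_mat n T \<gamma> (G (k - 1)) k *
      pinv (kronecker (1\<^sub>m r) (slice_prod r Qh \<gamma> [1..<k - 1]) *
        slice_columns (n (k - 1)) r (Qh (k - 1)) (G (k - 1)))" if "k \<in> {2..d}" for k
    using B that by (simp add: blostr_steps_def)
  have Fc: "block_F r ?F l 0 \<in> carrier_mat r r" for l by (simp add: block_F_def)
  have Pc: "Pi_perm r (K_hat r ?F) \<in> carrier_mat (r * r) (r * r)" by (simp add: Pi_perm_def)
  have dF: "det (block_F r ?F l 0) \<noteq> 0" if "0 < l" "l < r" for l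
    using bF[OF that] invertible_mat_iff_det[OF Fc] by blast
  have dP: "det (Pi_perm r (K_hat r ?F)) \<noteq> 0" using P invertible_mat_iff_det[OF Pc] by blast
  have Gc: "mat_inv \<Lambda> * \<Lambda>' \<in> carrier_mat r r" by (rule mult_carrier_mat[OF mat_inv(1)[OF 1(1,2)] 2(1)])
  \<comment> \<open>Nonvanishing is read off from the run itself: the inverses that it takes
    exist.\<close>
  have G0: "(mat_inv \<Lambda> * \<Lambda>') $$ (l, 0) \<noteq> 0" if "l < r" for l
    by (rule first_core_solvable_only_if[OF 1(3,4) 2(2) Gc r dF[unfolded F] dP[unfolded F] that])
  obtain L1 L2 where L1: "L1 \<in> carrier_mat r r" "det L1 \<noteq> 0" and L2: "L2 \<in> carrier_mat r r" "det L2 \<noteq> 0"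
    and first': "E * mat_inv (Pi_perm r (K_hat r ?F)) = unfold_angle (n 1) r (\<lambda>a. mat_inv L1 * Q 1 a * L2)"
    using first_core[OF 1(5) 2(4) 1(1,2) 2(1) 1(3,4) 2(2,3) G0] by metis
  let ?L = "gauge \<gamma> L1 L2"
  note Lc = gauge_carrier[OF idx(5) L1 L2] and Ld = det_gauge[OF idx(5) L1 L2]
  have QL: "mat_inv (?L k) * Q k a * ?L (Suc k) \<in> carrier_mat r r" for k a
    by (rule mult_carrier_mat[OF mult_carrier_mat[OF mat_inv(1)[OF Lc Ld] Q] Lc])
  have "1 \<le> k \<Longrightarrow> k \<le> d \<Longrightarrow> a < n k \<Longrightarrow> Qh k a = mat_inv (?L k) * Q k a * ?L (Suc k)" for k a
  proof (induction k arbitrary: a rule: less_induct)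
    case (less k)
    have "unfold_angle (n k) r (Qh k) = unfold_angle (n k) r (\<lambda>a. mat_inv (?L k) * Q k a * ?L (Suc k))"
    proof (cases "k = 1")
      case True
      have "unfold_angle (n 1) r (Qh 1) = unfold_angle (n 1) r (\<lambda>a. mat_inv (?L 1) * Q 1 a * ?L (Suc 1))"
        unfolding first first' by (simp add: gauge_def)
      then show ?thesis unfolding True .
    next
      case False
      then have k: "k \<in> {2..d}" using less.prems by auto
      then have Gk: "index_subset (n (k - 1)) r (G (k - 1))" by (intro G(3)) auto
      show ?thesis unfolding steps[OF k]
        by (rule blostr_step[OF idx(5) L1 L2 k Gk]) (use less.IH less.prems in auto)
    qed
    then show ?case
      by (rule unfold_angle_eqD[OF _ less.prems(3) Qhc QL]) (use less.prems in auto)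
  qed
  then show ?thesis by (intro gauge_equivalent_gauge[OF idx(5) L1 L2]) auto
qed

text \<open>Entry (l, 0) of \<Lambda>^-1 \<Lambda>' is the product of row l of \<Lambda>^-1, a left
  eigenvector of the first quotient, with the first column of \<Lambda>', a right eigenvector of the
  second. The assumption \<open>indep\<close> makes all these entries nonzero, and the gauged cores
  are then an output.\<close>

theorem blostr_steps_exist:
  assumes idx: "\<alpha> \<in> multi_indices {2..d-1} n" "\<beta> \<in> multi_indices {2..d-1} n"
      "\<alpha>' \<in> multi_indices {2..d-1} n" "\<beta>' \<in> multi_indices {2..d-1} n" "\<gamma> \<in> multi_indices {1..d} n"
    and G: "index_subset (n d) r G\<^sub>1" "index_subset (n d) r G\<^sub>2" "\<And>k. k \<in> {1..d-1} \<Longrightarrow> index_subset (n k) r (G k)"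
    and S: "eigenvector_stack r (quotient_mat d n T \<alpha> G\<^sub>1 \<beta> G\<^sub>1) E"
      "eigenvector_stack r (quotient_mat d n T \<alpha>' G\<^sub>2 \<beta>' G\<^sub>2) E'"
    and indep: "\<And>u w x y. u \<in> carrier_vec r \<Longrightarrow> w \<in> carrier_vec r \<Longrightarrow> u \<noteq> 0\<^sub>v r \<Longrightarrow> w \<noteq> 0\<^sub>v r \<Longrightarrow>
      transpose_mat (H \<alpha> \<beta>) *\<^sub>v u = x \<cdot>\<^sub>v u \<Longrightarrow> H \<alpha>' \<beta>' *\<^sub>v w = y \<cdot>\<^sub>v w \<Longrightarrow> u \<bullet> w \<noteq> 0"
  shows "\<exists>Qh. blostr_steps d n r T \<gamma> G E E' Qh"
proof -
  let ?F = "pinv E * E'"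
  obtain \<Lambda> Z \<nu> where 1: "\<Lambda> \<in> carrier_mat r r" "det \<Lambda> \<noteq> 0" "interleaved r Z" "det Z \<noteq> 0"
    "E = A * (kronecker (1\<^sub>m r) \<Lambda> * Z)" and ev: "H \<alpha> \<beta> * \<Lambda> = \<Lambda> * mat_diag r \<nu>"
    using stack_structure[OF idx(1,2) G(1) S(1)] by metis
  obtain \<Lambda>' Z' \<nu>' where 2: "\<Lambda>' \<in> carrier_mat r r" "interleaved r Z'" "det Z' \<noteq> 0"
    "E' = A * (kronecker (1\<^sub>m r) \<Lambda>' * Z')" and d2: "det \<Lambda>' \<noteq> 0" and ev': "H \<alpha>' \<beta>' * \<Lambda>' = \<Lambda>' * mat_diag r \<nu>'"
    using stack_structure[OF idx(3,4) G(2) S(2)] by metis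
  note Hc = H_carrier[OF idx(2), of \<alpha>] and Hc' = H_carrier[OF idx(4), of \<alpha>']
  note li = mat_inv[OF 1(1,2)]
  have G0: "(mat_inv \<Lambda> * \<Lambda>') $$ (l, 0) \<noteq> 0" if l: "l < r" for l
  proof -
    let ?u = "row (mat_inv \<Lambda>) l" and ?w = "col \<Lambda>' 0"
    have r0: "0 < r" using r by simp
    have u: "?u \<in> carrier_vec r" and w: "?w \<in> carrier_vec r" using li(1) 2(1) by auto
    have "mat_inv \<Lambda> * H \<alpha> \<beta> * \<Lambda> = mat_diag r \<nu>"
      using assoc_mult_mat[OF li(1) Hc 1(1)] mat_inv_mult_cancel(2)[OF 1(1,2) mat_diag_dim] ev by simp
    moreover have iH: "mat_inv \<Lambda> * H \<alpha> \<beta> \<in> carrier_mat r r" by (rule mult_carrier_mat[OF li(1) Hc])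
    ultimately have left: "mat_inv \<Lambda> * H \<alpha> \<beta> = mat_diag r \<nu> * mat_inv \<Lambda>"
      using assoc_mult_mat[OF iH 1(1) li(1)] li(2) by (simp add: right_mult_one_mat[OF iH])
    have "transpose_mat (H \<alpha> \<beta>) *\<^sub>v ?u = \<nu> l \<cdot>\<^sub>v ?u"
    proof (rule eq_vecI)
      fix i assume "i < dim_vec (\<nu> l \<cdot>\<^sub>v ?u)"
      then have i: "i < r" using u li(1) by simp
      have "(transpose_mat (H \<alpha> \<beta>) *\<^sub>v ?u) $ i = (\<Sum>j<r. transpose_mat (H \<alpha> \<beta>) $$ (i, j) * ?u $ j)"
        using Hc by (intro mult_mat_vec_entry[OF _ u i]) simp
      also have "\<dots> = (\<Sum>j<r. mat_inv \<Lambda> $$ (l, j) * H \<alpha> \<beta> $$ (j, i))"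
        using Hc i l li(1) by (intro sum.cong refl) auto
      also have "\<dots> = (\<nu> l \<cdot>\<^sub>v ?u) $ i"
        unfolding mult_mat_entry[OF li(1) Hc l i, symmetric] left mat_diag_mult_left[OF li(1)]
        using l i li(1) by simp
      finally show "(transpose_mat (H \<alpha> \<beta>) *\<^sub>v ?u) $ i = (\<nu> l \<cdot>\<^sub>v ?u) $ i" .
    qed (use Hc li(1) in simp)
    moreover have "H \<alpha>' \<beta>' *\<^sub>v ?w = \<nu>' 0 \<cdot>\<^sub>v ?w"
    proof (rule eq_vecI)
      fix i assume "i < dim_vec (\<nu>' 0 \<cdot>\<^sub>v ?w)"
      then have i: "i < r" using 2(1) by simp
      have "(H \<alpha>' \<beta>' *\<^sub>v ?w) $ i = (\<Sum>j<r. H \<alpha>' \<beta>' $$ (i, j) * \<Lambda>' $$ (j, 0))"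
        unfolding mult_mat_vec_entry[OF Hc' w i] using 2(1) r0 by (intro sum.cong refl) auto
      also have "\<dots> = (\<nu>' 0 \<cdot>\<^sub>v ?w) $ i"
        unfolding mult_mat_entry[OF Hc' 2(1) i r0, symmetric] ev' mat_diag_mult_right[OF 2(1)]
        using i r0 2(1) by simp
      finally show "(H \<alpha>' \<beta>' *\<^sub>v ?w) $ i = (\<nu>' 0 \<cdot>\<^sub>v ?w) $ i" .
    qed (use Hc' 2(1) in simp)
    moreover have "?u \<noteq> 0\<^sub>v r"
    proof
      assume z: "?u = 0\<^sub>v r"
      have "(mat_inv \<Lambda> * \<Lambda>) $$ (l, l) = ?u \<bullet> col \<Lambda> l" using l li(1) 1(1) by simp
      then show False unfolding z li(3) using l 1(1) by simp
    qed
    moreover have "?w \<noteq> 0\<^sub>v r"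
    proof
      assume z: "?w = 0\<^sub>v r"
      note li' = mat_inv[OF 2(1) d2]
      have "(mat_inv \<Lambda>' * \<Lambda>') $$ (0, 0) = row (mat_inv \<Lambda>') 0 \<bullet> ?w" using r0 li'(1) 2(1) by simp
      then show False unfolding z li'(3) using r0 li'(1) by simp
    qed
    ultimately have "?u \<bullet> ?w \<noteq> 0" using indep[OF u w] by blast
    then show ?thesis using l r0 li(1) 2(1) by simp
  qed
  obtain L1 L2 where L1: "L1 \<in> carrier_mat r r" "det L1 \<noteq> 0" and L2: "L2 \<in> carrier_mat r r" "det L2 \<noteq> 0"
    and dF: "\<And>l. l < r \<Longrightarrow> det (block_F r ?F l 0) \<noteq> 0" and dP: "det (Pi_perm r (K_hat r ?F)) \<noteq> 0"
    and first: "E * mat_inv (Pi_perm r (K_hat r ?F)) = unfold_angle (n 1) r (\<lambda>a. mat_inv L1 * Q 1 a * L2)"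
    using first_core[OF 1(5) 2(4) 1(1,2) 2(1) 1(3,4) 2(2,3) G0] by metis
  let ?L = "gauge \<gamma> L1 L2"
  note Lc = gauge_carrier[OF idx(5) L1 L2] and Ld = det_gauge[OF idx(5) L1 L2]
  let ?Qh = "\<lambda>k a. mat_inv (?L k) * Q k a * ?L (Suc k)"
  have "blostr_steps d n r T \<gamma> G E E' ?Qh"
    unfolding blostr_steps_def Let_def
  proof (intro conjI ballI allI impI)
    fix k a show "?Qh k a \<in> carrier_mat r r"
      by (rule mult_carrier_mat[OF mult_carrier_mat[OF mat_inv(1)[OF Lc Ld] Q] Lc])
  next
    fix l assume "l \<in> {1..<r}"
    then show "invertible_mat (block_F r ?F l 0)"
      using dF[of l] by (subst invertible_mat_iff_det[of _ r]) (auto simp: block_F_def)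
  next
    show "invertible_mat (Pi_perm r (K_hat r ?F))"
      using dP by (subst invertible_mat_iff_det[of _ "r * r"]) (auto simp: Pi_perm_def)
    show "unfold_angle (n 1) r (?Qh 1) = E * mat_inv (Pi_perm r (K_hat r ?F))"
      unfolding first by (simp add: gauge_def)
  next
    fix k assume k: "k \<in> {2..d}"
    then have Gk: "index_subset (n (k - 1)) r (G (k - 1))" by (intro G(3)) auto
    show "unfold_angle (n k) r (?Qh k) = S_mat n T \<gamma> (G (k - 1)) k *
      pinv (kronecker (1\<^sub>m r) (slice_prod r ?Qh \<gamma> [1..<k - 1]) *
        slice_columns (n (k - 1)) r (?Qh (k - 1)) (G (k - 1)))"
      by (rule blostr_step[OF idx(5) L1 L2 k Gk, symmetric]) simp
  qed
  then show ?thesis by blast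
qed

end

subsection \<open>Distinct eigenvalues\<close>

lemma pderiv_simple_factor:
  "poly (pderiv ([:- a, 1:] * g)) a = poly g (a :: complex)"
  unfolding pderiv_mult by (simp add: pderiv_pCons)

text \<open>With p the characteristic polynomial, p'(A) acts on an eigenvector for a by the scalar
  p'(a). If p'(A) is invertible, no root is multiple. Unlike a choice of eigenvalues, this
  determinant is polynomial in the entries of \<open>A\<close>.\<close>

lemma diagonalizable_if_simple_roots:
  assumes A: "(A :: complex mat) \<in> carrier_mat r r"
    and d: "det (mat_poly r (pderiv (char_poly A)) A) \<noteq> 0"
  obtains \<Lambda> \<nu> where "\<Lambda> \<in> carrier_mat r r" "det \<Lambda> \<noteq> 0" "A * \<Lambda> = \<Lambda> * mat_diag r \<nu>" "inj_on \<nu> {..<r}"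
proof -
  let ?p = "char_poly A" and ?P = "mat_poly r (pderiv (char_poly A)) A"
  have P: "?P \<in> carrier_mat r r" using A by simp
  obtain as where as: "?p = (\<Prod>a\<leftarrow>as. [:- a, 1:])" "length as = r"
    using char_poly_factorized[OF A] by blast
  have deg: "degree (pderiv ?p) \<le> r" using degree_monic_char_poly[OF A] by (simp add: degree_pderiv)
  have ev: "\<exists>v. v \<in> carrier_vec r \<and> v \<noteq> 0\<^sub>v r \<and> A *\<^sub>v v = a \<cdot>\<^sub>v v" if "a \<in> set as" for a
  proof -
    have "poly ?p a = 0" using that by (auto simp: as poly_prod_list prod_list_zero_iff)
    then have "eigenvalue A a" using eigenvalue_root_char_poly[OF A] by simp
    then show ?thesis using A by (auto simp: eigenvalue_def eigenvector_def)
  qed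
  have simple: "poly (pderiv ?p) a \<noteq> 0" if a: "a \<in> set as" for a
  proof
    assume 0: "poly (pderiv ?p) a = 0"
    obtain v where v: "v \<in> carrier_vec r" "v \<noteq> 0\<^sub>v r" "A *\<^sub>v v = a \<cdot>\<^sub>v v" using ev[OF a] by blast
    have "?P *\<^sub>v v = 0\<^sub>v r" using mat_poly_eigenvector[OF A v(1,3) deg] 0 v(1) by (auto intro!: eq_vecI)
    then show False using d v det_nonzero_iff_inj[OF P] by blast
  qed
  have "distinct as"
  proof (rule ccontr)
    assume "\<not> distinct as"
    then obtain xs ys zs a where "as = xs @ [a] @ ys @ [a] @ zs" using not_distinct_decomp by blast
    then have "?p = [:- a, 1:] * ([:- a, 1:] * (\<Prod>b\<leftarrow>xs @ ys @ zs. [:- b, 1:]))" "a \<in> set as"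
      unfolding as(1) by (simp_all add: mult_ac del: mult_pCons_left mult_pCons_right)
    then show False using simple[of a] pderiv_simple_factor[of a "[:- a, 1:] * (\<Prod>b\<leftarrow>xs @ ys @ zs. [:- b, 1:])"] by simp
  qed
  then have inj: "inj_on ((!) as) {..<r}" using as(2) by (auto simp: inj_on_def nth_eq_iff_index_eq)
  have "\<forall>k. \<exists>v. k < r \<longrightarrow> v \<in> carrier_vec r \<and> v \<noteq> 0\<^sub>v r \<and> A *\<^sub>v v = as ! k \<cdot>\<^sub>v v"
    using ev as(2) by (metis nth_mem)
  then obtain V where V: "\<And>k. k < r \<Longrightarrow> V k \<in> carrier_vec r \<and> V k \<noteq> 0\<^sub>v r \<and> A *\<^sub>v V k = as ! k \<cdot>\<^sub>v V k"
    by metis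
  define \<Lambda> where "\<Lambda> = mat r r (\<lambda>(l, k). V k $ l)"
  have \<Lambda>: "\<Lambda> \<in> carrier_mat r r" by (simp add: \<Lambda>_def)
  have A\<Lambda>: "A * \<Lambda> = \<Lambda> * mat_diag r ((!) as)"
  proof (rule eq_matI)
    fix l k assume "l < dim_row (\<Lambda> * mat_diag r ((!) as))" "k < dim_col (\<Lambda> * mat_diag r ((!) as))"
    then have l: "l < r" and k: "k < r" using \<Lambda> by (auto simp: mat_diag_def)
    have "(A * \<Lambda>) $$ (l, k) = (\<Sum>j<r. A $$ (l, j) * V k $ j)"
      unfolding mult_mat_entry[OF A \<Lambda> l k] using k by (intro sum.cong) (auto simp: \<Lambda>_def)
    also have "\<dots> = (as ! k \<cdot>\<^sub>v V k) $ l"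
      using mult_mat_vec_entry[OF A _ l, of "V k"] V[OF k] by simp
    also have "\<dots> = (\<Lambda> * mat_diag r ((!) as)) $$ (l, k)"
      unfolding mat_diag_mult_right[OF \<Lambda>] using l k carrier_vecD[OF conjunct1[OF V[OF k]]] by (simp add: \<Lambda>_def)
    finally show "(A * \<Lambda>) $$ (l, k) = (\<Lambda> * mat_diag r ((!) as)) $$ (l, k)" .
  qed (use A \<Lambda> in \<open>auto simp: mat_diag_def\<close>)
  have "det \<Lambda> \<noteq> 0"
  proof (rule det_eigenvectors_nonzero[OF A \<Lambda> A\<Lambda> inj])
    fix k assume k: "k < r"
    show "\<exists>l<r. \<Lambda> $$ (l, k) \<noteq> 0"
    proof (rule ccontr)
      assume "\<not> ?thesis"
      then have "V k = 0\<^sub>v r" using V[OF k] k by (intro eq_vecI) (auto simp: \<Lambda>_def)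
      then show False using V[OF k] by simp
    qed
  qed
  then show thesis using that \<Lambda> A\<Lambda> inj by blast
qed

lemma mat_diag_mult_unit_vec:
  assumes "i < n" shows "mat_diag n f *\<^sub>v unit_vec n i = f i \<cdot>\<^sub>v (unit_vec n i :: complex vec)"
proof (rule eq_vecI)
  fix j assume "j < dim_vec (f i \<cdot>\<^sub>v (unit_vec n i :: complex vec))"
  then have j: "j < n" by simp
  show "(mat_diag n f *\<^sub>v unit_vec n i) $ j = (f i \<cdot>\<^sub>v unit_vec n i) $ j"
    unfolding mult_mat_vec_entry[OF mat_diag_dim unit_vec_carrier j]
    using assms j by (simp add: mat_diag_def unit_vec_def if_distrib[of "\<lambda>x. x * _"] cong: if_cong)
qed (simp add: mat_diag_def)

text \<open>Supplies the point at which that determinant does not vanish: p'(D) is diagonal, and its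
  \<open>k\<close>-th entry is the product of the differences between \<open>\<nu> k\<close> and the
  other eigenvalues.\<close>

lemma simple_roots_mat_diag:
  assumes inj: "inj_on \<nu> {..<r}"
  shows "det (mat_poly r (pderiv (char_poly (mat_diag r \<nu>))) (mat_diag r \<nu>)) \<noteq> (0 :: complex)"
proof -
  let ?D = "mat_diag r \<nu>" and ?p = "char_poly (mat_diag r \<nu>)"
  let ?P = "mat_poly r (pderiv ?p) ?D"
  have D: "?D \<in> carrier_mat r r" by simp
  have P: "?P \<in> carrier_mat r r" by simp
  have "diag_mat ?D = map \<nu> [0..<r]" by (auto simp: diag_mat_def mat_diag_def intro!: nth_equalityI)
  moreover have "upper_triangular ?D" by (auto simp: upper_triangular_def mat_diag_def)
  ultimately have "?p = (\<Prod>a\<leftarrow>map \<nu> [0..<r]. [:- a, 1:])"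
    using char_poly_upper_triangular[OF D] by simp
  also have "\<dots> = (\<Prod>k<r. [:- \<nu> k, 1:])"
    by (simp add: prod.list_conv_set_nth o_def atLeast0LessThan)
  finally have p: "?p = (\<Prod>k<r. [:- \<nu> k, 1:])" .
  have simple: "poly (pderiv ?p) (\<nu> k) \<noteq> 0" if k: "k < r" for k
  proof -
    have "?p = [:- \<nu> k, 1:] * (\<Prod>j\<in>{..<r} - {k}. [:- \<nu> j, 1:])"
      unfolding p using k by (intro prod.remove) auto
    then show ?thesis using k inj
      by (simp only: pderiv_simple_factor) (auto simp: poly_prod inj_on_def)
  qed
  have deg: "degree (pderiv ?p) \<le> r" using degree_monic_char_poly[OF D] by (simp add: degree_pderiv)
  have "?P = mat_diag r (\<lambda>k. poly (pderiv ?p) (\<nu> k))"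
  proof (rule eq_matI)
    fix i j assume "i < dim_row (mat_diag r (\<lambda>k. poly (pderiv ?p) (\<nu> k)))" "j < dim_col (mat_diag r (\<lambda>k. poly (pderiv ?p) (\<nu> k)))"
    then have ij: "i < r" "j < r" by (auto simp: mat_diag_def)
    have "?P $$ (i, j) = (?P *\<^sub>v unit_vec r j) $ i"
      unfolding mult_mat_vec_entry[OF P unit_vec_carrier ij(1)] using ij
      by (simp add: unit_vec_def if_distrib[of "\<lambda>x. _ * x"] cong: if_cong)
    also have "\<dots> = (poly (pderiv ?p) (\<nu> j) \<cdot>\<^sub>v unit_vec r j) $ i"
      by (simp only: mat_poly_eigenvector[OF D unit_vec_carrier mat_diag_mult_unit_vec[OF ij(2)] deg])
    finally show "?P $$ (i, j) = mat_diag r (\<lambda>k. poly (pderiv ?p) (\<nu> k)) $$ (i, j)"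
      using ij by (simp add: mat_diag_def unit_vec_def)
  qed (simp_all add: carrier_matD[OF P] carrier_matD[OF mat_diag_dim])
  moreover have "det (mat_diag r (\<lambda>k. poly (pderiv ?p) (\<nu> k))) \<noteq> 0"
  proof (rule det_nonzero_if_right_inverse[OF mat_diag_dim mat_diag_dim])
    show "mat_diag r (\<lambda>k. poly (pderiv ?p) (\<nu> k)) * mat_diag r (\<lambda>k. inverse (poly (pderiv ?p) (\<nu> k))) = 1\<^sub>m r"
      unfolding mat_diag_diag using simple by (intro eq_matI) (auto simp: mat_diag_def)
  qed
  ultimately show ?thesis by simp
qed

subsection \<open>Linear independence of the products of powers\<close>

text \<open>Row \<open>c\<close> is a product X^a Y^b written out row by row, with
  \<open>c = a * r + b\<close>. The determinant is nonzero exactly when these products form a basis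
  of the \<open>r\<close> by \<open>r\<close> matrices.\<close>

definition power_products :: "nat \<Rightarrow> complex mat \<Rightarrow> complex mat \<Rightarrow> complex mat" where
  "power_products r X Y = mat (r * r) (r * r)
     (\<lambda>(c, e). ((X ^\<^sub>m (c div r)) * (Y ^\<^sub>m (c mod r))) $$ (e div r, e mod r))"

lemma left_eigenvector_pow:
  assumes X: "(X :: complex mat) \<in> carrier_mat r r" and u: "u \<in> carrier_vec r" and e: "transpose_mat X *\<^sub>v u = x \<cdot>\<^sub>v u"
    and j: "j < r"
  shows "(\<Sum>i<r. u $ i * (X ^\<^sub>m a) $$ (i, j)) = x ^ a * u $ j"
  using j
proof (induction a arbitrary: j)
  case 0
  have "(\<Sum>i<r. u $ i * (X ^\<^sub>m 0) $$ (i, j)) = (\<Sum>i<r. if i = j then u $ i else 0)"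
    using X 0 by (intro sum.cong) auto
  then show ?case using 0 by simp
next
  case (Suc a)
  have Xa: "X ^\<^sub>m a \<in> carrier_mat r r" using X by simp
  have "(\<Sum>i<r. u $ i * (X ^\<^sub>m Suc a) $$ (i, j)) = (\<Sum>i<r. \<Sum>l<r. u $ i * (X ^\<^sub>m a) $$ (i, l) * X $$ (l, j))"
    using Suc.prems by (simp add: mult_mat_entry[OF Xa X] sum_distrib_left mult.assoc del: index_mult_mat)
  also have "\<dots> = (\<Sum>l<r. (\<Sum>i<r. u $ i * (X ^\<^sub>m a) $$ (i, l)) * X $$ (l, j))"
    by (subst sum.swap) (simp add: sum_distrib_right)
  also have "\<dots> = x ^ a * (\<Sum>l<r. transpose_mat X $$ (j, l) * u $ l)"
    using Suc X by (simp add: sum_distrib_left mult_ac)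
  also have "(\<Sum>l<r. transpose_mat X $$ (j, l) * u $ l) = (transpose_mat X *\<^sub>v u) $ j"
    using mult_mat_vec_entry[of "transpose_mat X" r r u j] X u Suc.prems by simp
  also have "\<dots> = x * u $ j" using e u Suc.prems by simp
  finally show ?case by simp
qed

text \<open>For a left eigenvector \<open>u\<close> of \<open>X\<close> and a right eigenvector
  \<open>w\<close> of \<open>Y\<close>, u^T X^a Y^b w = x^a y^b (u^T w). If u^T w were zero, the
  nonzero matrix u w^T would pair to zero with a whole basis.\<close>

lemma eigenvectors_not_orthogonal:
  assumes X: "X \<in> carrier_mat r r" and Y: "Y \<in> carrier_mat r r" and d: "det (power_products r X Y) \<noteq> 0"
    and u: "u \<in> carrier_vec r" "u \<noteq> 0\<^sub>v r" "transpose_mat X *\<^sub>v u = x \<cdot>\<^sub>v u"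
    and w: "w \<in> carrier_vec r" "w \<noteq> 0\<^sub>v r" "Y *\<^sub>v w = y \<cdot>\<^sub>v w"
  shows "u \<bullet> w \<noteq> 0"
proof
  assume 0: "u \<bullet> w = 0"
  let ?K = "power_products r X Y"
  have K: "?K \<in> carrier_mat (r * r) (r * r)" by (simp add: power_products_def)
  \<comment> \<open>The rank one matrix u w^T, written out row by row.\<close>
  define v where "v = vec (r * r) (\<lambda>e. u $ (e div r) * w $ (e mod r))"
  have v: "v \<in> carrier_vec (r * r)" by (simp add: v_def)
  have "?K *\<^sub>v v = 0\<^sub>v (r * r)"
  proof (rule eq_vecI)
    fix c assume "c < dim_vec (0\<^sub>v (r * r) :: complex vec)"
    then have c: "c < r * r" by simp
    let ?a = "c div r" and ?b = "c mod r"
    have Xa: "X ^\<^sub>m ?a \<in> carrier_mat r r" and Yb: "Y ^\<^sub>m ?b \<in> carrier_mat r r" using X Y by auto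
    have XY: "X ^\<^sub>m ?a * Y ^\<^sub>m ?b \<in> carrier_mat r r" using Xa Yb by auto
    have "(?K *\<^sub>v v) $ c = (\<Sum>i<r. \<Sum>j<r. ?K $$ (c, i * r + j) * v $ (i * r + j))"
      by (simp only: mult_mat_vec_entry[OF K v c] sum_pair_index)
    also have "\<dots> = (\<Sum>i<r. \<Sum>j<r. u $ i * ((X ^\<^sub>m ?a * Y ^\<^sub>m ?b) $$ (i, j) * w $ j))"
      using c by (intro sum.cong refl) (auto simp: power_products_def v_def pair_index_less)
    also have "\<dots> = (\<Sum>i<r. u $ i * ((X ^\<^sub>m ?a * Y ^\<^sub>m ?b) *\<^sub>v w) $ i)"
      by (intro sum.cong refl) (auto simp: sum_distrib_left[symmetric] mult_mat_vec_entry[OF XY w(1)] simp del: index_mult_mat_vec index_mult_mat)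
    also have "(X ^\<^sub>m ?a * Y ^\<^sub>m ?b) *\<^sub>v w = y ^ ?b \<cdot>\<^sub>v (X ^\<^sub>m ?a *\<^sub>v w)"
      using assoc_mult_mat_vec[OF Xa Yb w(1)] pow_mat_eigenvector[OF Y w(1,3), of ?b] mult_mat_vec[OF Xa w(1)] by simp
    also have "(\<Sum>i<r. u $ i * (y ^ ?b \<cdot>\<^sub>v (X ^\<^sub>m ?a *\<^sub>v w)) $ i) = y ^ ?b * (\<Sum>i<r. \<Sum>j<r. u $ i * (X ^\<^sub>m ?a) $$ (i, j) * w $ j)"
    proof -
      have "(y ^ ?b \<cdot>\<^sub>v (X ^\<^sub>m ?a *\<^sub>v w)) $ i = y ^ ?b * (\<Sum>j<r. (X ^\<^sub>m ?a) $$ (i, j) * w $ j)" if "i < r" for i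
        using that carrier_vecD[OF mult_mat_vec_carrier[OF Xa w(1)]] mult_mat_vec_entry[OF Xa w(1) that]
        by (simp del: index_mult_mat_vec dim_mult_mat_vec)
      then show ?thesis by (simp add: sum_distrib_left mult_ac)
    qed
    also have "(\<Sum>i<r. \<Sum>j<r. u $ i * (X ^\<^sub>m ?a) $$ (i, j) * w $ j) = (\<Sum>j<r. x ^ ?a * u $ j * w $ j)"
      by (subst sum.swap) (simp add: sum_distrib_right[symmetric] left_eigenvector_pow[OF X u(1,3)])
    also have "\<dots> = x ^ ?a * (u \<bullet> w)"
      using w(1) by (simp add: scalar_prod_def sum_distrib_left mult.assoc atLeast0LessThan)
    finally show "(?K *\<^sub>v v) $ c = 0\<^sub>v (r * r) $ c" using 0 c by simp
  qed (use K in simp)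
  then have z: "v = 0\<^sub>v (r * r)" using d det_nonzero_iff_inj[OF K] v by blast
  have "\<exists>i<r. u $ i \<noteq> 0" "\<exists>j<r. w $ j \<noteq> 0" using u w by (metis carrier_vecD eq_vecI index_zero_vec)+
  then obtain i j where ij: "i < r" "j < r" "u $ i \<noteq> 0" "w $ j \<noteq> 0" by blast
  have "v $ (i * r + j) = 0" unfolding z using ij by (simp add: pair_index_less)
  then show False using ij by (simp add: v_def pair_index_less)
qed

lemma mat_diag_pow: "(mat_diag r \<nu> :: complex mat) ^\<^sub>m k = mat_diag r (\<lambda>i. \<nu> i ^ k)"
proof (induction k)
  case 0
  then show ?case by (simp add: mat_diag_def)
next
  case (Suc k)
  then show ?case by (simp add: mult.commute)
qed

lemma conjugate_pow:
  assumes D: "D \<in> carrier_mat r r" "D * D = 1\<^sub>m r" and X: "X \<in> carrier_mat r r"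
  shows "(D * X * D) ^\<^sub>m k = D * (X ^\<^sub>m k) * (D :: complex mat)"
proof (induction k)
  case 0
  have "dim_row (D * X * D) = r" using D by simp
  then show ?case using D X by simp
next
  case (Suc k)
  have Xk: "X ^\<^sub>m k \<in> carrier_mat r r" using X by simp
  have DX: "D * X ^\<^sub>m k \<in> carrier_mat r r" and XD: "X * D \<in> carrier_mat r r" using D X Xk by auto
  have "(D * X * D) ^\<^sub>m Suc k = (D * X ^\<^sub>m k) * D * (D * (X * D))"
    using Suc assoc_mult_mat[OF D(1) X D(1)] by simp
  also have "\<dots> = (D * X ^\<^sub>m k) * (D * D * (X * D))" by (rule assoc_mult_mat4[OF DX D(1) D(1) XD])
  also have "\<dots> = D * (X ^\<^sub>m k * X) * D"
    using D(2) assoc_mult_mat[OF D(1) Xk XD] assoc_mult_mat[OF Xk X D(1)]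
      assoc_mult_mat[OF D(1) mult_carrier_mat[OF Xk X] D(1)] left_mult_one_mat[OF XD] by simp
  finally show ?case by simp
qed

text \<open>A kernel vector satisfies equations weighted by \<open>\<nu> i ^ a\<close> and
  \<open>\<nu>' l ^ b\<close>; one Vandermonde argument for each family of nodes separates them into
  \<open>D $$ (i, l) * g i l = 0\<close>. As \<open>D\<close> has no zero entry, \<open>g\<close>
  vanishes, and invertibility of \<open>D\<close> finishes.\<close>

lemma power_products_independent:
  assumes D: "D \<in> carrier_mat r r" "D * D = 1\<^sub>m r" "\<And>i j. i < r \<Longrightarrow> j < r \<Longrightarrow> D $$ (i, j) \<noteq> 0"
    and \<nu>: "inj_on \<nu> {..<r}" and \<nu>': "inj_on \<nu>' {..<r}"
  shows "det (power_products r (mat_diag r \<nu>) (D * mat_diag r \<nu>' * D)) \<noteq> 0"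
proof -
  let ?K = "power_products r (mat_diag r \<nu>) (D * mat_diag r \<nu>' * D)"
  have K: "?K \<in> carrier_mat (r * r) (r * r)" by (simp add: power_products_def)
  show ?thesis
    unfolding det_nonzero_iff_inj[OF K]
  proof (intro ballI impI)
    fix v assume v: "v \<in> carrier_vec (r * r)" and z: "?K *\<^sub>v v = 0\<^sub>v (r * r)"
    \<comment> \<open>\<open>g i\<close> is \<open>D\<close> applied to the \<open>i\<close>-th
      segment of \<open>v\<close>.\<close>
    define g where "g i l = (\<Sum>j<r. D $$ (l, j) * v $ (i * r + j))" for i l
    have "(\<Sum>i<r. (\<Sum>l<r. D $$ (i, l) * g i l * \<nu>' l ^ b) * \<nu> i ^ a) = 0" if a: "a < r" and b: "b < r" for a b
    proof -
      have c: "a * r + b < r * r" using a b by (rule pair_index_less)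
      have entry: "?K $$ (a * r + b, i * r + j) = \<nu> i ^ a * (\<Sum>l<r. D $$ (i, l) * \<nu>' l ^ b * D $$ (l, j))"
        if "i < r" "j < r" for i j
      proof -
        have Dd: "D * mat_diag r (\<lambda>i. \<nu>' i ^ b) \<in> carrier_mat r r" using D by auto
        have "?K $$ (a * r + b, i * r + j) =
          (mat_diag r (\<lambda>i. \<nu> i ^ a) * (D * mat_diag r (\<lambda>i. \<nu>' i ^ b) * D)) $$ (i, j)"
          using that b c by (simp add: power_products_def pair_index_less mat_diag_pow conjugate_pow[OF D(1,2) mat_diag_dim])
        also have "\<dots> = \<nu> i ^ a * (D * mat_diag r (\<lambda>i. \<nu>' i ^ b) * D) $$ (i, j)"
          using that mult_carrier_mat[OF Dd D(1)] by (subst mat_diag_mult_left[of _ r r]) auto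
        also have "(D * mat_diag r (\<lambda>i. \<nu>' i ^ b) * D) $$ (i, j) = (\<Sum>l<r. (D * mat_diag r (\<lambda>i. \<nu>' i ^ b)) $$ (i, l) * D $$ (l, j))"
          by (rule mult_mat_entry[OF Dd D(1) that])
        also have "\<dots> = (\<Sum>l<r. D $$ (i, l) * \<nu>' l ^ b * D $$ (l, j))"
          unfolding mat_diag_mult_right[OF D(1)] using that by (intro sum.cong) auto
        finally show ?thesis .
      qed
      have "(?K *\<^sub>v v) $ (a * r + b) = (\<Sum>i<r. \<Sum>j<r. ?K $$ (a * r + b, i * r + j) * v $ (i * r + j))"
        by (simp only: mult_mat_vec_entry[OF K v c] sum_pair_index)
      also have "\<dots> = (\<Sum>i<r. \<Sum>j<r. \<Sum>l<r. \<nu> i ^ a * (D $$ (i, l) * \<nu>' l ^ b * (D $$ (l, j) * v $ (i * r + j))))"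
        by (intro sum.cong refl) (simp add: entry sum_distrib_left sum_distrib_right mult.assoc)
      also have "\<dots> = (\<Sum>i<r. \<Sum>l<r. \<Sum>j<r. \<nu> i ^ a * (D $$ (i, l) * \<nu>' l ^ b * (D $$ (l, j) * v $ (i * r + j))))"
        by (intro sum.cong refl sum.swap)
      also have "\<dots> = (\<Sum>i<r. (\<Sum>l<r. D $$ (i, l) * g i l * \<nu>' l ^ b) * \<nu> i ^ a)"
        by (simp add: g_def sum_distrib_left sum_distrib_right mult_ac)
      finally show ?thesis using z c by simp
    qed
    then have "(\<Sum>l<r. D $$ (i, l) * g i l * \<nu>' l ^ b) = 0" if "i < r" "b < r" for i b
      using vandermonde_kernel[OF \<nu>, of "\<lambda>i. \<Sum>l<r. D $$ (i, l) * g i l * \<nu>' l ^ b" i] that by blast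
    then have "D $$ (i, l) * g i l = 0" if "i < r" "l < r" for i l
      using vandermonde_kernel[OF \<nu>', of "\<lambda>l. D $$ (i, l) * g i l" l] that by blast
    then have g0: "g i l = 0" if "i < r" "l < r" for i l using D(3) that by (metis mult_eq_0_iff)
    have dD: "det D \<noteq> 0" using det_nonzero_if_right_inverse[OF D(1,1,2)] .
    have row: "vec r (\<lambda>j. v $ (i * r + j)) = 0\<^sub>v r" if i: "i < r" for i
    proof -
      let ?w = "vec r (\<lambda>j. v $ (i * r + j))"
      have w: "?w \<in> carrier_vec r" by simp
      have "D *\<^sub>v ?w = 0\<^sub>v r"
      proof (rule eq_vecI)
        fix l assume "l < dim_vec (0\<^sub>v r :: complex vec)"
        then have l: "l < r" by simp
        have "(D *\<^sub>v ?w) $ l = g i l"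
          unfolding mult_mat_vec_entry[OF D(1) w l] g_def by (intro sum.cong) auto
        then show "(D *\<^sub>v ?w) $ l = 0\<^sub>v r $ l" using g0[OF i l] l by simp
      qed (use D in simp)
      then show ?thesis using dD det_nonzero_iff_inj[OF D(1)] w by blast
    qed
    show "v = 0\<^sub>v (r * r)"
    proof (rule eq_vecI)
      fix c assume "c < dim_vec (0\<^sub>v (r * r) :: complex vec)"
      then have c: "c < r * r" by simp
      note less = pair_index_div_less[OF c]
      have "vec r (\<lambda>j. v $ (c div r * r + j)) $ (c mod r) = 0" unfolding row[OF less(1)] using less by simp
      then show "v $ c = 0\<^sub>v (r * r) $ c" using c less by simp
    qed (use v in simp)
  qed
qed

text \<open>The involution \<open>I - 2 w v\<^sup>T\<close> with \<open>v = (1, \<dots>, 1)\<close> and \<open>w = (r, -1, \<dots>, -1)\<close>, where \<open>v\<^sup>T w = 1\<close>; an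
  orthogonal reflection along \<open>v\<close> would have zero entries for \<open>r = 2\<close>.\<close>

definition reflection :: "nat \<Rightarrow> complex mat" where
  "reflection r = mat r r (\<lambda>(i, j). (if i = j then 1 else 0) - 2 * (if i = 0 then of_nat r else - 1))"

lemma reflection_carrier [simp]: "reflection r \<in> carrier_mat r r"
  by (simp add: reflection_def)

lemma reflection_involution:
  assumes r: "0 < r" shows "reflection r * reflection r = 1\<^sub>m r"
proof (rule eq_matI)
  fix i j assume "i < dim_row (1\<^sub>m r)" "j < dim_col (1\<^sub>m r)"
  then have ij: "i < r" "j < r" by auto
  define w :: "nat \<Rightarrow> complex" where "w i = (if i = 0 then of_nat r else - 1)" for i
  have "(\<Sum>k<r. w k) = w 0 + (\<Sum>k\<in>{..<r} - {0}. w k)" using r by (intro sum.remove) auto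
  also have "(\<Sum>k\<in>{..<r} - {0}. w k) = (\<Sum>k\<in>{..<r} - {0}. - 1)" by (intro sum.cong) (auto simp: w_def)
  finally have w1: "(\<Sum>k<r. w k) = 1" using r by (simp add: w_def card_Diff_singleton of_nat_diff)
  have e: "reflection r $$ (i, j) = (if i = j then 1 else 0) - 2 * w i" if "i < r" "j < r" for i j
    using that by (simp add: reflection_def w_def)
  have "(reflection r * reflection r) $$ (i, j) =
    (\<Sum>k<r. ((if i = k then 1 else 0) - 2 * w i) * ((if k = j then 1 else 0) - 2 * w k))"
    unfolding mult_mat_entry[OF reflection_carrier reflection_carrier ij] using ij by (intro sum.cong) (auto simp: e)
  also have "\<dots> = (\<Sum>k<r. (if i = k then if k = j then 1 else 0 else 0) - (if i = k then 2 * w k else 0)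
      - (if k = j then 2 * w i else 0) + 4 * w i * w k)"
    by (intro sum.cong) (auto simp: algebra_simps)
  also have "\<dots> = (if i = j then 1 else 0) - 2 * w i - 2 * w i + 4 * w i * (\<Sum>k<r. w k)"
    using ij by (simp add: sum.distrib sum_subtractf sum_distrib_left)
  finally show "(reflection r * reflection r) $$ (i, j) = 1\<^sub>m r $$ (i, j)" using w1 ij by simp
qed (simp_all add: reflection_def)

text \<open>The entries are 1 - 2 r and - 2 r in the first row, 3 and 2 below it. Only the first
  needs an argument: 2 r is not 1, by parity.\<close>

lemma reflection_entry_nonzero:
  assumes "2 \<le> r" "i < r" "j < r" shows "reflection r $$ (i, j) \<noteq> 0"
proof -
  have "2 * complex_of_nat r \<noteq> 1"
  proof
    assume "2 * complex_of_nat r = 1"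
    then have "complex_of_nat (2 * r) = complex_of_nat 1" by simp
    then show False unfolding of_nat_eq_iff by simp
  qed
  then show ?thesis using assms by (auto simp: reflection_def)
qed

subsection \<open>Quotients with different column sets\<close>

text \<open>For an eigenvalue of multiplicity at least two, some eigenvector is annihilated by the functional that
  multiplies column \<open>p\<close>, so the eigenvalue does not depend on that column.\<close>

lemma char_poly_rank_one_change:
  assumes Ja: "Ja \<in> carrier_mat (r * r) (r * r)" and J0: "J0 \<in> carrier_mat (r * r) (r * r)"
    and B: "B \<in> carrier_mat (r * r) (r * r)" and p: "p < r * r" and r: "2 \<le> r"
    and same: "\<And>i q. i < r * r \<Longrightarrow> q < r * r \<Longrightarrow> q \<noteq> p \<Longrightarrow> Ja $$ (i, q) = J0 $$ (i, q)"
    and Y: "Y \<in> carrier_mat (r * r) (r * r)" "det Y \<noteq> 0"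
    and ev: "Ja * B * Y = Y * mat_diag (r * r) (\<lambda>c. \<nu> (c mod r))"
  shows "mat_poly (r * r) (char_poly (J0 * B)) (Ja * B) = 0\<^sub>m (r * r) (r * r)"
proof -
  define s where "s = r * r"
  note [simp] = s_def[symmetric]
  note Ja = Ja[simplified] and J0 = J0[simplified] and B = B[simplified] and p = p[simplified]
    and same = same[simplified] and Y = Y[simplified] and ev = ev[simplified]
  let ?C = "Ja * B" and ?N = "J0 * B" and ?\<chi> = "char_poly (J0 * B)"
  have C: "?C \<in> carrier_mat s s" and C0: "?N \<in> carrier_mat s s" using Ja J0 B by auto
  have colY: "?C *\<^sub>v col Y c = \<nu> (c mod r) \<cdot>\<^sub>v col Y c" if c: "c < s" for c
  proof (rule eq_vecI)
    fix i assume "i < dim_vec (\<nu> (c mod r) \<cdot>\<^sub>v col Y c)"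
    then have i: "i < s" using Y by simp
    have y: "col Y c \<in> carrier_vec s" using Y by auto
    have "(?C *\<^sub>v col Y c) $ i = (?C * Y) $$ (i, c)"
      unfolding mult_mat_vec_entry[OF C y i] mult_mat_entry[OF C Y(1) i c] using Y c by (intro sum.cong) auto
    then show "(?C *\<^sub>v col Y c) $ i = (\<nu> (c mod r) \<cdot>\<^sub>v col Y c) $ i"
      unfolding ev mat_diag_mult_right[OF Y(1)] using i c Y by simp
  qed (use Ja Y in simp)
  have root: "poly ?\<chi> (\<nu> k) = 0" if k: "k < r" for k
  proof -
    \<comment> \<open>Columns \<open>k\<close> and \<open>r + k\<close> of \<open>Y\<close> both
      belong to \<open>\<nu> k\<close>, and the second one exists because \<open>r\<close> is at
      least 2. A nontrivial combination \<open>v\<close> of the two can be chosen with coordinate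
      \<open>p\<close> of \<open>B v\<close> equal to zero; \<open>Ja\<close> and \<open>J0\<close>
      then agree on \<open>B v\<close>.\<close>
    have ks: "k < s" "r + k < s" "k \<noteq> r + k"
      using pair_index_less[of 0 r k] pair_index_less[of 1 r k] k r by auto
    define x where "x c = (B *\<^sub>v col Y c) $ p" for c
    obtain c1 c2 where c: "c1 \<noteq> 0 \<or> c2 \<noteq> 0" "c1 * x k + c2 * x (r + k) = 0"
    proof (cases "x k = 0")
      case True then show thesis by (intro that[of 1 0]) auto
    next
      case False then show thesis by (intro that[of "x (r + k)" "- x k"]) auto
    qed
    define v where "v = c1 \<cdot>\<^sub>v col Y k + c2 \<cdot>\<^sub>v col Y (r + k)"
    have y: "col Y k \<in> carrier_vec s" "col Y (r + k) \<in> carrier_vec s" using Y by auto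
    have v: "v \<in> carrier_vec s" using y by (auto simp: v_def)
    have lin: "X *\<^sub>v v = c1 \<cdot>\<^sub>v (X *\<^sub>v col Y k) + c2 \<cdot>\<^sub>v (X *\<^sub>v col Y (r + k))" if X: "X \<in> carrier_mat s s" for X
      unfolding v_def using mult_add_distrib_mat_vec[OF X, of "c1 \<cdot>\<^sub>v col Y k" "c2 \<cdot>\<^sub>v col Y (r + k)"]
        mult_mat_vec[OF X y(1), of c1] mult_mat_vec[OF X y(2), of c2] y by simp
    have Cv: "?C *\<^sub>v v = \<nu> k \<cdot>\<^sub>v v"
      unfolding lin[OF C] colY[OF ks(1)] colY[OF ks(2)] using k y
      by (intro eq_vecI) (auto simp: v_def algebra_simps)
    have Bv: "B *\<^sub>v v \<in> carrier_vec s" using B by (intro mult_mat_vec_carrier[OF B v])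
    have Bp: "(B *\<^sub>v v) $ p = 0"
      unfolding lin[OF B] using c(2) p carrier_vecD[OF mult_mat_vec_carrier[OF B y(1)]]
        carrier_vecD[OF mult_mat_vec_carrier[OF B y(2)]]
      by (simp add: x_def del: index_mult_mat_vec dim_mult_mat_vec)
    have "?N *\<^sub>v v = ?C *\<^sub>v v"
      unfolding assoc_mult_mat_vec[OF J0 B v] assoc_mult_mat_vec[OF Ja B v]
    proof (rule eq_vecI)
      fix i assume "i < dim_vec (Ja *\<^sub>v (B *\<^sub>v v))"
      then have i: "i < s" using Ja by simp
      have "J0 $$ (i, q) * (B *\<^sub>v v) $ q = Ja $$ (i, q) * (B *\<^sub>v v) $ q" if "q < s" for q
        using same[OF i that] Bp by (cases "q = p") auto
      then show "(J0 *\<^sub>v (B *\<^sub>v v)) $ i = (Ja *\<^sub>v (B *\<^sub>v v)) $ i"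
        unfolding mult_mat_vec_entry[OF J0 Bv i] mult_mat_vec_entry[OF Ja Bv i] by (intro sum.cong) auto
    qed (use Ja J0 in simp)
    then have C0v: "?N *\<^sub>v v = \<nu> k \<cdot>\<^sub>v v" unfolding Cv .
    have "v \<noteq> 0\<^sub>v s"
    proof
      assume z: "v = 0\<^sub>v s"
      define e where "e = vec s (\<lambda>i. if i = k then c1 else if i = r + k then c2 else 0)"
      have ec: "e \<in> carrier_vec s" by (simp add: e_def)
      have "Y *\<^sub>v e = v"
      proof (rule eq_vecI)
        fix i assume "i < dim_vec v"
        then have i: "i < s" using v by simp
        have "(Y *\<^sub>v e) $ i = (\<Sum>l<s. (if l = k then c1 * Y $$ (i, l) else 0) + (if l = r + k then c2 * Y $$ (i, l) else 0))"
          unfolding mult_mat_vec_entry[OF Y(1) ec i] using ks by (intro sum.cong) (auto simp: e_def)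
        then show "(Y *\<^sub>v e) $ i = v $ i" using i ks Y by (simp add: sum.distrib v_def)
      qed (use Y v in simp)
      then have "e = 0\<^sub>v s" using z Y det_nonzero_iff_inj[OF Y(1)] ec by simp
      then have "e $ k = 0" "e $ (r + k) = 0" using ks by simp_all
      then show False using c(1) ks by (auto simp: e_def)
    qed
    then have "eigenvector ?N v (\<nu> k)" unfolding eigenvector_def carrier_matD(1)[OF C0] using C0v v by blast
    then have "eigenvalue ?N (\<nu> k)" unfolding eigenvalue_def by blast
    then show ?thesis using eigenvalue_root_char_poly[OF C0] by simp
  qed
  let ?P = "mat_poly s ?\<chi> ?C"
  have P: "?P \<in> carrier_mat s s" using C by simp
  have deg: "degree ?\<chi> \<le> s" using degree_monic_char_poly[OF C0] by simp
  \<comment> \<open>All eigenvalues of \<open>?C\<close> are roots of the characteristic polynomial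
    of \<open>?N\<close>, and the columns of \<open>Y\<close> are a basis of eigenvectors, so that
    polynomial annihilates \<open>?C\<close>.\<close>
  have PY: "?P * Y = 0\<^sub>m s s"
  proof (rule eq_matI)
    fix i c assume "i < dim_row (0\<^sub>m s s :: complex mat)" "c < dim_col (0\<^sub>m s s :: complex mat)"
    then have i: "i < s" and c: "c < s" by auto
    have y: "col Y c \<in> carrier_vec s" using Y by auto
    have "(?P * Y) $$ (i, c) = (?P *\<^sub>v col Y c) $ i"
      unfolding mult_mat_vec_entry[OF P y i] mult_mat_entry[OF P Y(1) i c] using Y c by (intro sum.cong) auto
    also have "\<dots> = (poly ?\<chi> (\<nu> (c mod r)) \<cdot>\<^sub>v col Y c) $ i"
      by (simp only: mat_poly_eigenvector[OF C y colY[OF c] deg])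
    also have "\<dots> = 0" using root[of "c mod r"] r i Y by simp
    finally show "(?P * Y) $$ (i, c) = 0\<^sub>m s s $$ (i, c)" using i c by simp
  qed (use P Y in auto)
  have "?P = ?P * (Y * mat_inv Y)" using mat_inv(2)[OF Y] P by simp
  also have "\<dots> = 0\<^sub>m s s"
    using assoc_mult_mat[OF P Y(1) mat_inv(1)[OF Y]] PY left_mult_zero_mat[OF mat_inv(1)[OF Y]] by simp
  finally show ?thesis by simp
qed

subsection \<open>Witnesses for independent index pairs\<close>

lemma slice_prod_one:
  "(\<And>k. k \<in> set ks \<Longrightarrow> q k (\<gamma> k) = 1\<^sub>m r) \<Longrightarrow> slice_prod r q \<gamma> ks = 1\<^sub>m r"
  by (induction ks) auto

lemma slice_prod_split:
  assumes q: "\<And>k. q k (\<gamma> k) \<in> carrier_mat r r" and m: "a \<le> m" "m < b"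
  shows "slice_prod r q \<gamma> [a..<b] = slice_prod r q \<gamma> [a..<m] * (q m (\<gamma> m) * slice_prod r q \<gamma> [Suc m..<b])"
proof -
  have "[a..<b] = [a..<m] @ m # [Suc m..<b]"
    using m upt_add_eq_append[of a m "b - m"] by (simp add: upt_conv_Cons)
  then show ?thesis using q by (simp add: slice_prod_append)
qed

lemma slice_prod_single:
  assumes q: "\<And>k. q k (\<gamma> k) \<in> carrier_mat r r" and m: "a \<le> m" "m < b"
    and one: "\<And>k. k \<noteq> m \<Longrightarrow> q k (\<gamma> k) = 1\<^sub>m r"
  shows "slice_prod r q \<gamma> [a..<b] = q m (\<gamma> m)"
proof -
  have "slice_prod r q \<gamma> [a..<m] = 1\<^sub>m r" "slice_prod r q \<gamma> [Suc m..<b] = 1\<^sub>m r"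
    by (auto intro!: slice_prod_one one)
  then show ?thesis unfolding slice_prod_split[where q = q and \<gamma> = \<gamma>, OF q m] using q[of m] by simp
qed

lemma slice_prod_two:
  assumes q: "\<And>k. q k (\<gamma> k) \<in> carrier_mat r r" and m: "a \<le> m" "m < m'" "m' < b"
    and one: "\<And>k. k \<noteq> m \<Longrightarrow> k \<noteq> m' \<Longrightarrow> q k (\<gamma> k) = 1\<^sub>m r"
  shows "slice_prod r q \<gamma> [a..<b] = q m (\<gamma> m) * q m' (\<gamma> m')"
proof -
  have "slice_prod r q \<gamma> [a..<m] = 1\<^sub>m r" using m by (auto intro!: slice_prod_one one)
  moreover have "slice_prod r q \<gamma> [Suc m..<m'] = 1\<^sub>m r" "slice_prod r q \<gamma> [Suc m'..<b] = 1\<^sub>m r"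
    using m by (auto intro!: slice_prod_one one)
  then have "slice_prod r q \<gamma> [Suc m..<b] = q m' (\<gamma> m')"
    using m q[of m'] slice_prod_split[where q = q and \<gamma> = \<gamma> and a = "Suc m" and m = m' and b = b, OF q] by simp
  moreover have "q m (\<gamma> m) * q m' (\<gamma> m') \<in> carrier_mat r r" by (rule mult_carrier_mat[OF q q])
  ultimately show ?thesis using slice_prod_split[where q = q and \<gamma> = \<gamma> and a = a and m = m and b = b, OF q] m
    by (simp add: left_mult_one_mat[of _ r r])
qed

text \<open>A diagonal matrix with distinct nonzero eigenvalues; its conjugate
  \<open>\<Delta>'\<close> by the reflection completes the pair to which
  \<open>power_products_independent\<close> applies.\<close>

definition \<Delta> :: "nat \<Rightarrow> complex mat" where
  "\<Delta> r = mat_diag r (\<lambda>i. of_nat (Suc i))"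

definition \<Delta>' :: "nat \<Rightarrow> complex mat" where
  "\<Delta>' r = reflection r * \<Delta> r * reflection r"

lemma mat_diag_nonzero:
  assumes "\<And>i. i < r \<Longrightarrow> \<nu> i \<noteq> (0 :: complex)"
  shows "det (mat_diag r \<nu>) \<noteq> 0" "mat_diag r (\<lambda>i. inverse (\<nu> i)) * mat_diag r \<nu> = 1\<^sub>m r"
proof -
  show 1: "mat_diag r (\<lambda>i. inverse (\<nu> i)) * mat_diag r \<nu> = 1\<^sub>m r"
    unfolding mat_diag_diag using assms by (intro eq_matI) (auto simp: mat_diag_def)
  show "det (mat_diag r \<nu>) \<noteq> 0" by (rule det_nonzero_if_left_inverse[OF mat_diag_dim mat_diag_dim 1])
qed

lemma \<Delta>_carrier [simp]: "\<Delta> r \<in> carrier_mat r r"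
  by (simp add: \<Delta>_def)

lemma \<Delta>'_carrier: "\<Delta>' r \<in> carrier_mat r r"
  unfolding \<Delta>'_def by (rule mult_carrier_mat[OF mult_carrier_mat[OF reflection_carrier \<Delta>_carrier] reflection_carrier])

lemma det_\<Delta>: "det (\<Delta> r) \<noteq> 0"
  unfolding \<Delta>_def by (rule mat_diag_nonzero(1)) (simp add: of_nat_neq_0 del: of_nat_Suc)

lemma det_reflection: "0 < r \<Longrightarrow> det (reflection r) \<noteq> 0"
  using det_nonzero_if_right_inverse[OF reflection_carrier reflection_carrier reflection_involution] .

lemma det_\<Delta>': "0 < r \<Longrightarrow> det (\<Delta>' r) \<noteq> 0"
  using det_\<Delta> det_reflection
  by (simp add: \<Delta>'_def det_mult[OF mult_carrier_mat[OF reflection_carrier \<Delta>_carrier] reflection_carrier]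
      det_mult[OF reflection_carrier \<Delta>_carrier])

text \<open>The quotients can be given the shape in \<open>power_products_independent\<close>; the disjunctions make the
  notion symmetric under exchanging the two indices of a pair.\<close>

definition separable :: "nat \<Rightarrow> nat \<Rightarrow> (nat \<Rightarrow> nat) \<Rightarrow> (nat \<Rightarrow> nat) \<Rightarrow> (nat \<Rightarrow> nat) \<Rightarrow> (nat \<Rightarrow> nat) \<Rightarrow> bool" where
  "separable d r \<alpha> \<beta> \<alpha>' \<beta>' \<longleftrightarrow> (\<exists>q. (\<forall>k a. q k a \<in> carrier_mat r r \<and> det (q k a) \<noteq> 0) \<and>
     (let M = \<lambda>\<alpha>. slice_prod r q \<alpha> [2..<d] in
       (M \<alpha> = \<Delta> r * M \<beta> \<or> M \<beta> = \<Delta> r * M \<alpha>) \<and> (M \<alpha>' = \<Delta>' r * M \<beta>' \<or> M \<beta>' = \<Delta>' r * M \<alpha>')))"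

lemma separable_swap:
  "separable d r \<beta> \<alpha> \<alpha>' \<beta>' \<Longrightarrow> separable d r \<alpha> \<beta> \<alpha>' \<beta>'"
  "separable d r \<alpha> \<beta> \<beta>' \<alpha>' \<Longrightarrow> separable d r \<alpha> \<beta> \<alpha>' \<beta>'"
  unfolding separable_def Let_def by blast+

text \<open>\<open>separable\<close> assigns \<Delta> to one pair and \<Delta>' to the other.
  Conjugating every slice by the reflection, an involution, conjugates all products and swaps the
  two roles.\<close>

lemma separable_exchange:
  assumes r: "0 < r" and S: "separable d r \<alpha>' \<beta>' \<alpha> \<beta>"
  shows "separable d r \<alpha> \<beta> \<alpha>' \<beta>'"
proof -
  let ?D = "reflection r"
  note D = reflection_carrier[of r] and DD = reflection_involution[OF r]
  obtain q where q: "\<And>k a. q k a \<in> carrier_mat r r" "\<And>k a. det (q k a) \<noteq> 0"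
    and 1: "slice_prod r q \<alpha>' [2..<d] = \<Delta> r * slice_prod r q \<beta>' [2..<d] \<or>
      slice_prod r q \<beta>' [2..<d] = \<Delta> r * slice_prod r q \<alpha>' [2..<d]"
    and 2: "slice_prod r q \<alpha> [2..<d] = \<Delta>' r * slice_prod r q \<beta> [2..<d] \<or>
      slice_prod r q \<beta> [2..<d] = \<Delta>' r * slice_prod r q \<alpha> [2..<d]"
    using S unfolding separable_def Let_def by blast
  define q' where "q' k a = ?D * q k a * ?D" for k a
  have q': "q' k a \<in> carrier_mat r r" "det (q' k a) \<noteq> 0" for k a
    unfolding q'_def using det_reflection[OF r] q
    by (auto simp: det_mult[OF mult_carrier_mat[OF D q(1)] D] det_mult[OF D q(1)] intro!: mult_carrier_mat[OF mult_carrier_mat[OF D q(1)] D])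
  have Mc: "slice_prod r q \<gamma> ks \<in> carrier_mat r r" for \<gamma> ks by (intro slice_prod_carrier q)
  have conj: "?D * (X * Y) * ?D = ?D * X * ?D * (?D * Y * ?D)" if "X \<in> carrier_mat r r" "Y \<in> carrier_mat r r" for X Y
  proof -
    have YD: "Y * ?D \<in> carrier_mat r r" using that D by auto
    have "?D * X * ?D * (?D * Y * ?D) = ?D * X * ?D * (?D * (Y * ?D))" using assoc_mult_mat[OF D that(2) D] by simp
    also have "\<dots> = ?D * X * (?D * ?D * (Y * ?D))" by (rule assoc_mult_mat4[OF mult_carrier_mat[OF D that(1)] D D YD])
    also have "\<dots> = ?D * (X * Y) * ?D"
      unfolding DD using left_mult_one_mat[OF YD] assoc_mult_mat[OF mult_carrier_mat[OF D that(1)] that(2) D]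
        assoc_mult_mat[OF D that] by simp
    finally show ?thesis by simp
  qed
  have M: "slice_prod r q' \<gamma> ks = ?D * slice_prod r q \<gamma> ks * ?D" for \<gamma> ks
  proof (induction ks)
    case Nil then show ?case using DD by (simp add: right_mult_one_mat[OF D])
  next
    case (Cons k ks)
    then show ?case using conj[OF q(1) Mc] by (simp add: q'_def)
  qed
  have "?D * \<Delta>' r * ?D = \<Delta> r"
  proof -
    note c = mult_carrier_mat[OF D \<Delta>_carrier]
    have "?D * \<Delta>' r * ?D = ?D * ?D * \<Delta> r * (?D * ?D)"
      using assoc_mult_mat[OF D c D] assoc_mult_mat[OF D D \<Delta>_carrier]
        assoc_mult_mat[OF mult_carrier_mat[OF D c] D D]
      by (simp add: \<Delta>'_def)
    then show ?thesis unfolding DD by (simp add: left_mult_one_mat[OF \<Delta>_carrier] right_mult_one_mat[OF \<Delta>_carrier])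
  qed
  then have e: "?D * (\<Delta>' r * X) * ?D = \<Delta> r * (?D * X * ?D)" if "X \<in> carrier_mat r r" for X
    using conj[OF \<Delta>'_carrier that] by simp
  show ?thesis
    unfolding separable_def Let_def
  proof (intro exI[of _ q'] conjI allI)
    show "slice_prod r q' \<alpha> [2..<d] = \<Delta> r * slice_prod r q' \<beta> [2..<d] \<or>
      slice_prod r q' \<beta> [2..<d] = \<Delta> r * slice_prod r q' \<alpha> [2..<d]"
      using 2 unfolding M e[OF Mc, symmetric] by auto
    show "slice_prod r q' \<alpha>' [2..<d] = \<Delta>' r * slice_prod r q' \<beta>' [2..<d] \<or>
      slice_prod r q' \<beta>' [2..<d] = \<Delta>' r * slice_prod r q' \<alpha>' [2..<d]"
      using 1 unfolding M \<Delta>'_def conj[OF \<Delta>_carrier Mc, symmetric] by auto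
  qed (use q' in auto)
qed

lemma separableI:
  assumes "\<And>k a. q k a \<in> carrier_mat r r" "\<And>k a. det (q k a) \<noteq> 0"
    and "slice_prod r q \<alpha> [2..<d] = \<Delta> r * slice_prod r q \<beta> [2..<d]"
    and "slice_prod r q \<alpha>' [2..<d] = \<Delta>' r * slice_prod r q \<beta>' [2..<d]"
  shows "separable d r \<alpha> \<beta> \<alpha>' \<beta>'"
  unfolding separable_def Let_def using assms by blast

text \<open>Only the modes \<open>m\<close> and \<open>m'\<close> carry nontrivial slices. The
  letter \<open>\<alpha> m\<close> gives the first pair its quotient \<Delta>, since the slices at
  \<open>m'\<close> agree for \<alpha> and \<beta>. The slice for \<open>\<alpha>' m'\<close> is
  still free to correct the second pair: \<open>Z\<close> solves X(\<alpha>' m) Z = \<Delta>'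
  X(\<beta>' m).\<close>

lemma separable_different_last:
  assumes r: "0 < r" and m: "2 \<le> m" "m < m'" "m' < d" and "\<alpha> m \<noteq> \<beta> m" "\<alpha>' m' \<noteq> \<beta>' m'" "\<alpha> m' = \<beta> m'"
  shows "separable d r \<alpha> \<beta> \<alpha>' \<beta>'"
proof -
  define X where "X a = (if a = \<alpha> m then \<Delta> r else 1\<^sub>m r)" for a
  have X: "X a \<in> carrier_mat r r" "det (X a) \<noteq> 0" for a using det_\<Delta> by (auto simp: X_def)
  note Xi = mat_inv[OF X]
  define Z where "Z = mat_inv (X (\<alpha>' m)) * (\<Delta>' r * X (\<beta>' m))"
  have \<Delta>X: "\<Delta>' r * X (\<beta>' m) \<in> carrier_mat r r" by (rule mult_carrier_mat[OF \<Delta>'_carrier X(1)])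
  have Z: "Z \<in> carrier_mat r r" "det Z \<noteq> 0"
    unfolding Z_def using det_\<Delta>'[OF r] X det_mat_inv[OF X]
    by (auto simp: det_mult[OF Xi(1) \<Delta>X] det_mult[OF \<Delta>'_carrier X(1)] intro!: mult_carrier_mat[OF Xi(1) \<Delta>X])
  define q where "q k a = (if k = m then X a else if k = m' \<and> a = \<alpha>' m' then Z else 1\<^sub>m r)" for k a
  have q: "q k a \<in> carrier_mat r r" "det (q k a) \<noteq> 0" for k a using X Z by (auto simp: q_def)
  have M: "slice_prod r q \<gamma> [2..<d] = X (\<gamma> m) * q m' (\<gamma> m')" for \<gamma>
    using slice_prod_two[where q = q and \<gamma> = \<gamma>, OF q(1) m] by (simp add: q_def)
  show ?thesis
  proof (rule separableI[of q, OF q])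
    show "slice_prod r q \<alpha> [2..<d] = \<Delta> r * slice_prod r q \<beta> [2..<d]"
      unfolding M using assms q[of m' "\<beta> m'"] by (simp add: X_def)
    have "slice_prod r q \<alpha>' [2..<d] = \<Delta>' r * X (\<beta>' m)"
      unfolding M using m mat_inv_mult_cancel(1)[OF X \<Delta>X] by (simp add: q_def Z_def)
    then show "slice_prod r q \<alpha>' [2..<d] = \<Delta>' r * slice_prod r q \<beta>' [2..<d]"
      unfolding M using m assms right_mult_one_mat[OF X(1)] by (simp add: q_def)
  qed
qed

text \<open>A single mode suffices, since each pair has a letter at \<open>m\<close> that is foreign
  to the other pair and can be given its matrix independently.\<close>

lemma separable_different_letters:
  assumes r: "0 < r" and m: "2 \<le> m" "m < d" and "\<alpha> m \<noteq> \<beta> m" "\<alpha>' m \<noteq> \<beta>' m"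
    "\<alpha> m \<notin> {\<alpha>' m, \<beta>' m}" "\<alpha>' m \<notin> {\<alpha> m, \<beta> m}"
  shows "separable d r \<alpha> \<beta> \<alpha>' \<beta>'"
proof -
  define q where "q k a = (if k = m then if a = \<alpha> m then \<Delta> r else if a = \<alpha>' m then \<Delta>' r else 1\<^sub>m r else 1\<^sub>m r)" for k a
  have q: "q k a \<in> carrier_mat r r" "det (q k a) \<noteq> 0" for k a
    using det_\<Delta> det_\<Delta>'[OF r] \<Delta>'_carrier[of r] by (auto simp: q_def)
  have M: "slice_prod r q \<gamma> [2..<d] = q m (\<gamma> m)" for \<gamma>
    using slice_prod_single[where q = q and \<gamma> = \<gamma>, OF q(1) m] by (simp add: q_def)
  show ?thesis
  proof (rule separableI[of q, OF q])
    show "slice_prod r q \<alpha> [2..<d] = \<Delta> r * slice_prod r q \<beta> [2..<d]"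
      unfolding M using assms right_mult_one_mat[OF \<Delta>_carrier] by (simp add: q_def)
    show "slice_prod r q \<alpha>' [2..<d] = \<Delta>' r * slice_prod r q \<beta>' [2..<d]"
      unfolding M using assms right_mult_one_mat[OF \<Delta>'_carrier] by (auto simp: q_def)
  qed
qed

text \<open>The last letters do not distinguish the two pairs, so an earlier mode \<open>k\<close>
  must. Only the letter \<open>\<alpha>' k\<close> receives a nontrivial slice \<open>U\<close>
  there, and only \<open>\<alpha> m\<close> receives one, \<open>Z\<close>, at the last mode; the
  two are then adjusted to each other.\<close>

lemma separable_equal_letters:
  assumes r: "0 < r" and m: "2 \<le> k" "k < m" "m < d" and "\<alpha> m \<noteq> \<beta> m" "\<alpha>' m = \<alpha> m" "\<beta>' m = \<beta> m" "\<alpha> k \<noteq> \<alpha>' k"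
  shows "separable d r \<alpha> \<beta> \<alpha>' \<beta>'"
proof -
  let ?D = "reflection r"
  note D = reflection_carrier[of r] and DD = reflection_involution[OF r]
  note \<Delta>c = \<Delta>_carrier[of r] and \<Delta>i = mat_inv[OF \<Delta>_carrier det_\<Delta>]
  text \<open>With \<open>Z = \<Delta> B(\<beta>\<^sub>k)\<close> the second quotient requires \<open>U Z = \<Delta>' B(\<beta>'\<^sub>k)\<close>, where \<open>U\<close> may also occur in \<open>B(\<beta>\<^sub>k)\<close> and
    \<open>B(\<beta>'\<^sub>k)\<close>.\<close>
  define U where "U = (if (\<beta> k = \<alpha>' k) = (\<beta>' k = \<alpha>' k) then \<Delta>' r * mat_inv (\<Delta> r) else ?D)"
  have U: "U \<in> carrier_mat r r" "det U \<noteq> 0"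
    using D det_reflection[OF r] det_\<Delta>'[OF r] det_mat_inv[OF \<Delta>_carrier det_\<Delta>]
    by (auto simp: U_def det_mult[OF \<Delta>'_carrier \<Delta>i(1)] intro!: mult_carrier_mat[OF \<Delta>'_carrier \<Delta>i(1)])
  define B where "B a = (if a = \<alpha>' k then U else 1\<^sub>m r)" for a
  have B: "B a \<in> carrier_mat r r" "det (B a) \<noteq> 0" for a using U by (auto simp: B_def)
  define Z where "Z = \<Delta> r * B (\<beta> k)"
  have Z: "Z \<in> carrier_mat r r" "det Z \<noteq> 0"
    using B det_\<Delta> by (auto simp: Z_def det_mult[OF \<Delta>_carrier B(1)] intro!: mult_carrier_mat[OF \<Delta>_carrier B(1)])
  define q where "q l a = (if l = k then B a else if l = m \<and> a = \<alpha> m then Z else 1\<^sub>m r)" for l a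
  have q: "q l a \<in> carrier_mat r r" "det (q l a) \<noteq> 0" for l a using B Z by (auto simp: q_def)
  have M: "slice_prod r q \<gamma> [2..<d] = B (\<gamma> k) * q m (\<gamma> m)" for \<gamma>
    using slice_prod_two[where q = q and \<gamma> = \<gamma>, OF q(1) m] by (simp add: q_def)
  have e1: "\<Delta>' r * mat_inv (\<Delta> r) * \<Delta> r = \<Delta>' r"
    using assoc_mult_mat[OF \<Delta>'_carrier \<Delta>i(1) \<Delta>c] \<Delta>i(3) right_mult_one_mat[OF \<Delta>'_carrier] by simp
  have e2: "?D * \<Delta> r = \<Delta>' r * ?D"
    using assoc_mult_mat[OF mult_carrier_mat[OF D \<Delta>c] D D] DD right_mult_one_mat[OF mult_carrier_mat[OF D \<Delta>c]] by (simp add: \<Delta>'_def)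
  \<comment> \<open>If \<open>U\<close> occurs in both or in neither of B(\<beta> k) and B(\<beta>'
    k), the equation reduces to U \<Delta> = \<Delta>'. In the mixed cases it reads U \<Delta> U =
    \<Delta>' or U \<Delta> = \<Delta>' U, and the reflection solves both because it is an
    involution.\<close>
  have UZ: "U * Z = \<Delta>' r * B (\<beta>' k)"
  proof (cases "\<beta> k = \<alpha>' k"; cases "\<beta>' k = \<alpha>' k")
    assume "\<beta> k = \<alpha>' k" "\<beta>' k = \<alpha>' k"
    then show ?thesis using e1 assoc_mult_mat[OF U(1) \<Delta>c U(1)] by (simp add: Z_def B_def U_def)
  next
    assume "\<beta> k = \<alpha>' k" "\<beta>' k \<noteq> \<alpha>' k"
    then show ?thesis using assoc_mult_mat[OF D \<Delta>c D] right_mult_one_mat[OF \<Delta>'_carrier[of r]]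
      by (simp add: Z_def B_def U_def \<Delta>'_def)
  next
    assume "\<beta> k \<noteq> \<alpha>' k" "\<beta>' k = \<alpha>' k"
    then show ?thesis using e2 right_mult_one_mat[OF \<Delta>c] by (simp add: Z_def B_def U_def)
  next
    assume "\<beta> k \<noteq> \<alpha>' k" "\<beta>' k \<noteq> \<alpha>' k"
    then show ?thesis using e1 right_mult_one_mat[OF \<Delta>c] right_mult_one_mat[OF \<Delta>'_carrier] by (simp add: Z_def B_def U_def)
  qed
  show ?thesis
  proof (rule separableI[of q, OF q])
    show "slice_prod r q \<alpha> [2..<d] = \<Delta> r * slice_prod r q \<beta> [2..<d]"
      unfolding M using assms left_mult_one_mat[OF Z(1)] right_mult_one_mat[OF B(1)] by (simp add: q_def B_def[of "\<alpha> k"] Z_def)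
    show "slice_prod r q \<alpha>' [2..<d] = \<Delta>' r * slice_prod r q \<beta>' [2..<d]"
      unfolding M using assms UZ right_mult_one_mat[OF B(1)] by (simp add: q_def B_def[of "\<alpha>' k"])
  qed
qed

section \<open>Combinatorics of independent index pairs\<close>

lemma last_difference:
  assumes \<alpha>: "\<alpha> \<in> multi_indices {2..d-1} n" and \<beta>: "\<beta> \<in> multi_indices {2..d-1} n" and "\<alpha> \<noteq> \<beta>"
  obtains m where "2 \<le> m" "m < d" "\<alpha> m \<noteq> \<beta> m" "\<And>k. m < k \<Longrightarrow> k < d \<Longrightarrow> \<alpha> k = \<beta> k"
    "strip_common d \<alpha> \<beta> = map \<alpha> [2..<Suc m]" "strip_common d \<beta> \<alpha> = map \<beta> [2..<Suc m]"
proof -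
  let ?S = "{k \<in> {2..d-1}. \<alpha> k \<noteq> \<beta> k}"
  have "?S \<noteq> {}"
  proof
    assume "?S = {}"
    then have "\<alpha> k = \<beta> k" if "k \<in> {2..d-1}" for k using that by blast
    then have "\<alpha> = \<beta>" using \<alpha> \<beta> unfolding multi_indices_def by (intro PiE_ext[of \<alpha> "{2..d-1}" _ \<beta>]) auto
    then show False using \<open>\<alpha> \<noteq> \<beta>\<close> by simp
  qed
  have fin: "finite ?S" by simp
  have max: "Max ?S \<in> ?S" by (rule Max_in[OF fin \<open>?S \<noteq> {}\<close>])
  have above: "\<alpha> k = \<beta> k" if "Max ?S < k" "k < d" for k
  proof (rule ccontr)
    assume "\<alpha> k \<noteq> \<beta> k"
    moreover have "2 \<le> k" using that(1) max by (metis (no_types, lifting) CollectD atLeastAtMost_iff less_imp_le order_trans)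
    ultimately have "k \<in> ?S" using that by auto
    then show False using Max_ge[OF fin] that(1) by (meson leD)
  qed
  have sym: "{k \<in> {2..d-1}. \<beta> k \<noteq> \<alpha> k} = ?S" by (simp only: eq_commute)
  define m where "m = Max ?S"
  have "2 \<le> m" "m < d" "\<alpha> m \<noteq> \<beta> m" using max unfolding m_def[symmetric] by auto
  moreover have "strip_common d \<alpha> \<beta> = map \<alpha> [2..<Suc m]" unfolding strip_common_def m_def ..
  moreover have "strip_common d \<beta> \<alpha> = map \<beta> [2..<Suc m]" unfolding strip_common_def m_def sym ..
  ultimately show thesis using above unfolding m_def[symmetric] by (intro that)
qed

text \<open>The cases compare the last modes at which the two indices of a pair differ, then the
  letters there. Independence enters only when the last modes and the unordered letters at them
  coincide: the truncated words must then differ at an earlier mode.\<close>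

lemma separable_if_independent:
  assumes r: "0 < r"
    and idx: "\<alpha> \<in> multi_indices {2..d-1} n" "\<beta> \<in> multi_indices {2..d-1} n"
      "\<alpha>' \<in> multi_indices {2..d-1} n" "\<beta>' \<in> multi_indices {2..d-1} n"
    and ne: "\<alpha> \<noteq> \<beta>" "\<alpha>' \<noteq> \<beta>'" and indep: "independent_pairs d \<alpha> \<beta> \<alpha>' \<beta>'"
  shows "separable d r \<alpha> \<beta> \<alpha>' \<beta>'"
proof -
  obtain m where m: "2 \<le> m" "m < d" "\<alpha> m \<noteq> \<beta> m" "\<And>k. m < k \<Longrightarrow> k < d \<Longrightarrow> \<alpha> k = \<beta> k"
    "strip_common d \<alpha> \<beta> = map \<alpha> [2..<Suc m]" "strip_common d \<beta> \<alpha> = map \<beta> [2..<Suc m]"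
    using last_difference[OF idx(1,2) ne(1)] by metis
  obtain m' where m': "2 \<le> m'" "m' < d" "\<alpha>' m' \<noteq> \<beta>' m'" "\<And>k. m' < k \<Longrightarrow> k < d \<Longrightarrow> \<alpha>' k = \<beta>' k"
    "strip_common d \<alpha>' \<beta>' = map \<alpha>' [2..<Suc m']" "strip_common d \<beta>' \<alpha>' = map \<beta>' [2..<Suc m']"
    using last_difference[OF idx(3,4) ne(2)] by metis
  \<comment> \<open>Stated for arbitrary words since it is applied with the second pair in either
    order. The difference sits at some \<open>k\<close> below \<open>m\<close>, in the first or in
    the second words; swapping within both pairs reduces the latter case to the former.\<close>
  have same_order: "separable d r a b a' b'"
    if "{map a [2..<Suc m], map b [2..<Suc m]} \<noteq> {map a' [2..<Suc m], map b' [2..<Suc m]}"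
      "a m = a' m" "b m = b' m" "a m \<noteq> b m" for a b a' b' :: "nat \<Rightarrow> nat"
  proof -
    have "map a [2..<Suc m] \<noteq> map a' [2..<Suc m] \<or> map b [2..<Suc m] \<noteq> map b' [2..<Suc m]"
      using that(1) by metis
    then obtain k where "k \<in> set [2..<Suc m]" and k3: "a k \<noteq> a' k \<or> b k \<noteq> b' k"
      unfolding map_eq_conv by blast
    then have k: "2 \<le> k" "k \<le> m" unfolding set_upt by simp_all
    have "k \<noteq> m" using k3 that(2,3) by auto
    then have km: "k < m" using k(2) by simp
    from k3 show ?thesis
    proof
      assume "a k \<noteq> a' k"
      then show ?thesis using that k km m by (intro separable_equal_letters[OF r, of k m]) auto
    next
      assume "b k \<noteq> b' k"
      then have "separable d r b a b' a'" using that k km m by (intro separable_equal_letters[OF r, of k m]) auto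
      then show ?thesis by (rule separable_swap(1)[OF separable_swap(2)])
    qed
  qed
  consider "m < m'" | "m' < m" | "m = m'" by linarith
  then show ?thesis
  proof cases
    case 1
    then show ?thesis using m(1,3,4) m'(2,3) by (intro separable_different_last[OF r m(1) 1]) auto
  next
    case 2
    then have "separable d r \<alpha>' \<beta>' \<alpha> \<beta>" using m m' by (intro separable_different_last[OF r m'(1) 2]) auto
    then show ?thesis by (rule separable_exchange[OF r])
  next
    case 3
    have strip: "{map \<alpha> [2..<Suc m], map \<beta> [2..<Suc m]} \<noteq> {map \<alpha>' [2..<Suc m], map \<beta>' [2..<Suc m]}"
      using indep unfolding independent_pairs_def m(5,6) m'(5,6) 3 .
    note nd = m(3) m'(3)[folded 3]
    consider "\<alpha> m = \<alpha>' m" "\<beta> m = \<beta>' m" | "\<alpha> m = \<beta>' m" "\<beta> m = \<alpha>' m" | "{\<alpha> m, \<beta> m} \<noteq> {\<alpha>' m, \<beta>' m}"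
      by (auto simp: doubleton_eq_iff)
    then show ?thesis
    proof cases
      case 1
      then show ?thesis using same_order[OF strip] nd by blast
    next
      case 2
      then have "separable d r \<alpha> \<beta> \<beta>' \<alpha>'" using same_order[of \<alpha> \<beta> \<beta>' \<alpha>'] strip nd by (simp add: insert_commute)
      then show ?thesis by (rule separable_swap(2))
    next
      case 3
      note d = separable_different_letters[OF r m(1,2)]
      \<comment> \<open>Two different sets of two elements each contain an element outside the
        other.\<close>
      have "(\<alpha> m \<notin> {\<alpha>' m, \<beta>' m} \<or> \<beta> m \<notin> {\<alpha>' m, \<beta>' m}) \<and> (\<alpha>' m \<notin> {\<alpha> m, \<beta> m} \<or> \<beta>' m \<notin> {\<alpha> m, \<beta> m})"
        using 3 nd by auto
      then show ?thesis
        using d[of \<alpha> \<beta> \<alpha>' \<beta>'] d[of \<beta> \<alpha> \<alpha>' \<beta>'] d[of \<alpha> \<beta> \<beta>' \<alpha>'] d[of \<beta> \<alpha> \<beta>' \<alpha>'] nd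
          separable_swap by (smt (verit) insert_commute)
    qed
  qed
qed

text \<open>The adjugate in place of the inverse keeps the entries polynomial.\<close>

definition adj_quotient :: "nat \<Rightarrow> nat \<Rightarrow> (nat \<Rightarrow> core) \<Rightarrow> (nat \<Rightarrow> nat) \<Rightarrow> (nat \<Rightarrow> nat) \<Rightarrow> complex mat" where
  "adj_quotient d r Q \<alpha> \<beta> = slice_prod r Q \<alpha> [2..<d] * adj_mat (slice_prod r Q \<beta> [2..<d])"

lemma mult_adj_mat:
  assumes X: "X \<in> carrier_mat r r" and B: "B \<in> carrier_mat r r"
  shows "(X * B) * adj_mat B = (det B :: complex) \<cdot>\<^sub>m X"
proof -
  have "(X * B) * adj_mat B = X * (det B \<cdot>\<^sub>m 1\<^sub>m r)"
    using assoc_mult_mat[OF X B adj_mat(1)[OF B]] adj_mat(2)[OF B] by simp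
  also have "\<dots> = det B \<cdot>\<^sub>m X" using mult_smult_distrib[OF X one_carrier_mat] right_mult_one_mat[OF X] by simp
  finally show ?thesis .
qed

lemma adj_mat_eq_smult_mat_inv:
  assumes B: "B \<in> carrier_mat r r" "det B \<noteq> 0"
  shows "adj_mat B = det B \<cdot>\<^sub>m mat_inv B"
proof -
  note i = mat_inv[OF B]
  have "adj_mat B = (mat_inv B * B) * adj_mat B" using i(3) left_mult_one_mat[OF adj_mat(1)[OF B(1)]] by simp
  also have "\<dots> = det B \<cdot>\<^sub>m mat_inv B" by (rule mult_adj_mat[OF i(1) B(1)])
  finally show ?thesis .
qed

lemma smult_mat_diag: "x \<cdot>\<^sub>m mat_diag r f = mat_diag r (\<lambda>i. x * f i :: complex)"
  by (rule eq_matI) (auto simp: mat_diag_def)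

text \<open>In the reversed alternative of \<open>separable\<close> the quotient is the inverse of V
  \<Delta> V, again with distinct eigenvalues. The adjugate only contributes a common nonzero
  factor, the determinant, which keeps them distinct.\<close>

lemma adj_quotient_cases:
  assumes q: "\<And>k a. q k a \<in> carrier_mat r r" "\<And>k a. det (q k a) \<noteq> 0"
    and V: "V \<in> carrier_mat r r" "V * V = 1\<^sub>m r"
    and M: "slice_prod r q \<alpha> [2..<d] = (V * \<Delta> r * V) * slice_prod r q \<beta> [2..<d] \<or>
      slice_prod r q \<beta> [2..<d] = (V * \<Delta> r * V) * slice_prod r q \<alpha> [2..<d]"
  obtains \<sigma> where "inj_on \<sigma> {..<r}" "adj_quotient d r q \<alpha> \<beta> = V * mat_diag r \<sigma> * V"
proof -
  let ?M = "\<lambda>\<alpha>. slice_prod r q \<alpha> [2..<d]"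
  have Mc: "?M \<gamma> \<in> carrier_mat r r" for \<gamma> by (intro slice_prod_carrier q)
  have dM: "det (?M \<gamma>) \<noteq> 0" for \<gamma> by (rule det_slice_prod[of _ q \<gamma> r]) (use q in auto)
  have c: "V * mat_diag r f * V \<in> carrier_mat r r" "V * mat_diag r f \<in> carrier_mat r r" for f
    using V by auto
  have prod: "V * mat_diag r f * V * (V * mat_diag r g * V) = V * mat_diag r (\<lambda>i. f i * g i) * V" for f g
  proof -
    have gV: "mat_diag r g * V \<in> carrier_mat r r" by (rule mult_carrier_mat[OF mat_diag_dim V(1)])
    have "V * mat_diag r f * V * (V * mat_diag r g * V) = V * mat_diag r f * (V * V * (mat_diag r g * V))"
      using assoc_mult_mat[OF V(1) mat_diag_dim V(1), of g] assoc_mult_mat4[OF c(2) V(1) V(1) gV, of f] by simp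
    also have "\<dots> = V * (mat_diag r f * mat_diag r g) * V"
      unfolding V(2) using left_mult_one_mat[OF gV] assoc_mult_mat[OF c(2) mat_diag_dim V(1), of f g]
        assoc_mult_mat[OF V(1) mat_diag_dim mat_diag_dim, of f g] by simp
    finally show ?thesis by simp
  qed
  obtain f where f: "inj_on f {..<r}" "?M \<alpha> = (V * mat_diag r f * V) * ?M \<beta>"
    using M
  proof
    assume "?M \<alpha> = (V * \<Delta> r * V) * ?M \<beta>"
    then show thesis by (intro that[of "\<lambda>i. of_nat (Suc i)"]) (auto simp: inj_on_def \<Delta>_def)
  next
    assume eq: "?M \<beta> = (V * \<Delta> r * V) * ?M \<alpha>"
    let ?f = "\<lambda>i. inverse (complex_of_nat (Suc i))"
    have "(V * mat_diag r ?f * V) * ?M \<beta> = (V * mat_diag r ?f * V) * (V * \<Delta> r * V) * ?M \<alpha>"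
      unfolding eq \<Delta>_def by (rule assoc_mult_mat[OF c(1) c(1) Mc, symmetric])
    also have "(V * mat_diag r ?f * V) * (V * \<Delta> r * V) = 1\<^sub>m r"
    proof -
      have "mat_diag r (\<lambda>i. ?f i * of_nat (Suc i)) = 1\<^sub>m r"
        by (rule eq_matI) (auto simp: mat_diag_def of_nat_neq_0 simp del: of_nat_Suc)
      then show ?thesis unfolding \<Delta>_def prod using V by (simp add: right_mult_one_mat[OF V(1)])
    qed
    finally have "?M \<alpha> = (V * mat_diag r ?f * V) * ?M \<beta>" using left_mult_one_mat[OF Mc] by simp
    then show thesis by (intro that[of ?f]) (auto simp: inj_on_def simp del: of_nat_Suc)
  qed
  have "adj_quotient d r q \<alpha> \<beta> = det (?M \<beta>) \<cdot>\<^sub>m (V * mat_diag r f * V)"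
    unfolding adj_quotient_def f(2) by (rule mult_adj_mat[OF c(1) Mc])
  also have "\<dots> = V * mat_diag r (\<lambda>i. det (?M \<beta>) * f i) * V"
    unfolding smult_mat_diag[symmetric] using mult_smult_distrib[OF V(1) mat_diag_dim] mult_smult_assoc_mat[OF c(2) V(1)] by simp
  finally show thesis using f(1) dM by (intro that[of "\<lambda>i. det (?M \<beta>) * f i"]) (auto simp: inj_on_def)
qed

lemma power_products_witness:
  assumes r: "2 \<le> r" and S: "separable d r \<alpha> \<beta> \<alpha>' \<beta>'"
  obtains q where "\<And>k a. q k a \<in> carrier_mat r r"
    "det (power_products r (adj_quotient d r q \<alpha> \<beta>) (adj_quotient d r q \<alpha>' \<beta>')) \<noteq> 0"
proof -
  have r0: "0 < r" using r by simp
  obtain q where q: "\<And>k a. q k a \<in> carrier_mat r r" "\<And>k a. det (q k a) \<noteq> 0"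
    and 1: "slice_prod r q \<alpha> [2..<d] = \<Delta> r * slice_prod r q \<beta> [2..<d] \<or>
      slice_prod r q \<beta> [2..<d] = \<Delta> r * slice_prod r q \<alpha> [2..<d]"
    and 2: "slice_prod r q \<alpha>' [2..<d] = \<Delta>' r * slice_prod r q \<beta>' [2..<d] \<or>
      slice_prod r q \<beta>' [2..<d] = \<Delta>' r * slice_prod r q \<alpha>' [2..<d]"
    using S unfolding separable_def Let_def by blast
  have one: "1\<^sub>m r * mat_diag r f * 1\<^sub>m r = mat_diag r f" for f :: "nat \<Rightarrow> complex"
    by (simp add: left_mult_one_mat[OF mat_diag_dim] right_mult_one_mat[OF mat_diag_dim])
  have one': "1\<^sub>m r * \<Delta> r * 1\<^sub>m r = \<Delta> r" unfolding \<Delta>_def by (rule one)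
  obtain \<sigma> where \<sigma>: "inj_on \<sigma> {..<r}" "adj_quotient d r q \<alpha> \<beta> = mat_diag r \<sigma>"
    using adj_quotient_cases[where q = q and V = "1\<^sub>m r" and \<alpha> = \<alpha> and \<beta> = \<beta>, OF q one_carrier_mat left_mult_one_mat[OF one_carrier_mat]]
    using 1 unfolding one one' by metis
  obtain \<sigma>' where \<sigma>': "inj_on \<sigma>' {..<r}" "adj_quotient d r q \<alpha>' \<beta>' = reflection r * mat_diag r \<sigma>' * reflection r"
    using adj_quotient_cases[where q = q, OF q reflection_carrier reflection_involution[OF r0] 2[unfolded \<Delta>'_def]] by metis
  have "det (power_products r (adj_quotient d r q \<alpha> \<beta>) (adj_quotient d r q \<alpha>' \<beta>')) \<noteq> 0"
    unfolding \<sigma>(2) \<sigma>'(2)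
    by (rule power_products_independent[OF reflection_carrier reflection_involution[OF r0] reflection_entry_nonzero[OF r] \<sigma>(1) \<sigma>'(1)])
  with q(1) show thesis by (rule that)
qed

text \<open>One nontrivial slice \<Delta>, at a mode where the indices differ, turns the quotient
  into \<Delta> itself.\<close>

lemma simple_roots_witness:
  assumes m: "2 \<le> m" "m < d" "\<alpha> m \<noteq> \<beta> m"
  obtains q where "\<And>k a. q k a \<in> carrier_mat r r"
    "det (mat_poly r (pderiv (char_poly (adj_quotient d r q \<alpha> \<beta>))) (adj_quotient d r q \<alpha> \<beta>)) \<noteq> 0"
proof -
  define q where "q k a = (if k = m \<and> a = \<alpha> m then \<Delta> r else 1\<^sub>m r)" for k a
  have q: "q k a \<in> carrier_mat r r" for k a by (auto simp: q_def)
  have M: "slice_prod r q \<gamma> [2..<d] = q m (\<gamma> m)" for \<gamma>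
    using slice_prod_single[where q = q and \<gamma> = \<gamma>, OF q m(1,2)] by (simp add: q_def)
  have "adj_quotient d r q \<alpha> \<beta> = \<Delta> r * 1\<^sub>m r * adj_mat (1\<^sub>m r)"
    unfolding adj_quotient_def M using m right_mult_one_mat[OF \<Delta>_carrier] by (simp add: q_def)
  also have "\<dots> = \<Delta> r" unfolding mult_adj_mat[OF \<Delta>_carrier one_carrier_mat] by simp
  finally have e: "adj_quotient d r q \<alpha> \<beta> = \<Delta> r" .
  have "inj_on (\<lambda>i. complex_of_nat (Suc i)) {..<r}" by (auto simp: inj_on_def)
  from simple_roots_mat_diag[OF this] show thesis using that[of q] q unfolding e \<Delta>_def by blast
qed

subsection \<open>Genericity\<close>

definition entries_of :: "(nat \<Rightarrow> core) \<Rightarrow> nat \<times> nat \<times> nat \<times> nat \<Rightarrow> complex" where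
  "entries_of q = (\<lambda>(k, a, i, j). q k a $$ (i, j))"

lemma cores_of_entries_of:
  assumes "\<And>k a. q k a \<in> carrier_mat r r" shows "cores_of r (entries_of q) = q"
proof (intro ext)
  fix k a show "cores_of r (entries_of q) k a = q k a"
    using assms[of k a] by (intro eq_matI) (auto simp: cores_of_def entries_of_def)
qed

lemma cores_of_carrier [simp]: "cores_of r w k a \<in> carrier_mat r r"
  by (simp add: cores_of_def)

lemma finite_entry_index: "finite (entry_index d n r)"
  by (rule finite_subset[of _ "SIGMA k:{1..d}. {..<n k} \<times> {..<r} \<times> {..<r}"]) (auto simp: entry_index_def)

lemma AE_entry_lebesgue_nonzero:
  assumes "polyfun (entry_index d n r) f" "f (entries_of q) \<noteq> 0"
  shows "AE w in entry_lebesgue d n r. f w \<noteq> 0"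
  unfolding entry_lebesgue_def by (rule AE_polyfun_nonzero[OF finite_entry_index assms])

lemma polymat_cores_of:
  assumes "k \<in> {1..d}" "a < n k"
  shows "polymat (entry_index d n r) r r (\<lambda>w. cores_of r w k a)"
  using assms by (intro polymatI) (auto simp: cores_of_def entry_index_def intro!: polyfun.coord)

lemma polymat_slice_prod:
  assumes "\<And>k. k \<in> set ks \<Longrightarrow> k \<in> {1..d} \<and> \<gamma> k < n k"
  shows "polymat (entry_index d n r) r r (\<lambda>w. slice_prod r (cores_of r w) \<gamma> ks)"
  using assms
proof (induction ks)
  case (Cons k ks)
  have "k \<in> {1..d}" "\<gamma> k < n k" using Cons.prems[of k] by auto
  moreover have "polymat (entry_index d n r) r r (\<lambda>w. slice_prod r (cores_of r w) \<gamma> ks)"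
    using Cons.prems by (intro Cons.IH) auto
  ultimately show ?case unfolding slice_prod_Cons by (intro polymat_mult[OF polymat_cores_of])
qed (simp add: polymat_const)

lemma polymat_slice_columns:
  assumes G: "index_subset m r G"
    and c: "\<And>a i j. a < m \<Longrightarrow> i < r \<Longrightarrow> j < r \<Longrightarrow> polyfun I (\<lambda>w. C w a $$ (i, j))"
  shows "polymat I (r * r) (r * r) (\<lambda>w. slice_columns m r (C w) G)"
proof (rule polymatI)
  fix e q assume e: "e < r * r" and q: "q < r * r"
  have "slice_columns m r (C w) G $$ (e, q) = C w (pick G q) $$ (e mod r, e div r)" for w
    using slice_columns_entry[OF G pair_index_div_less[OF e] q, of "C w"] by simp
  then show "polyfun I (\<lambda>w. slice_columns m r (C w) G $$ (e, q))"
    using c pick_index_subset[OF G q] pair_index_div_less[OF e] by simp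
qed (rule slice_columns_carrier[OF G])

text \<open>\<open>card {a \<in> G. a < b}\<close> is the position of \<open>b\<close> in the
  increasing enumeration of \<open>G\<close>, so it inverts \<open>pick G\<close>. The slices
  selected by \<open>G\<close> are thus the matrix units in the order of vec, and they form the
  identity matrix.\<close>

lemma unit_slices:
  assumes G: "index_subset m r G"
    and C: "\<And>b i j. b \<in> G \<Longrightarrow> i < r \<Longrightarrow> j < r \<Longrightarrow> C b $$ (j, i) = (if card {a \<in> G. a < b} = i * r + j then 1 else 0)"
  shows "slice_columns m r C G = 1\<^sub>m (r * r)"
proof (rule eq_matI)
  fix e q assume "e < dim_row (1\<^sub>m (r * r))" "q < dim_col (1\<^sub>m (r * r))"
  then have e: "e < r * r" and q: "q < r * r" by auto
  note less = pair_index_div_less[OF e]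
  have "card {a \<in> G. a < pick G q} = q"
    using q G by (intro card_pick_le) (simp add: index_subset_def power2_eq_square)
  then show "slice_columns m r C G $$ (e, q) = 1\<^sub>m (r * r) $$ (e, q)"
    using slice_columns_entry[OF G less q, of C] C[OF pick_index_subset(1)[OF G q] less] e q by simp
qed (use slice_columns_carrier[OF G, of C] in auto)

lemma position_less:
  assumes G: "index_subset m r G" and b: "b \<in> G"
  shows "card {a \<in> G. a < b} < r * r"
proof -
  have "finite G" using G finite_subset by (auto simp: index_subset_def)
  moreover have "{a \<in> G. a < b} \<subset> G" using b by blast
  ultimately have "card {a \<in> G. a < b} < card G" by (rule psubset_card_mono)
  then show ?thesis using G by (simp add: index_subset_def power2_eq_square)
qed

lemma finite_multi_indices: "finite K \<Longrightarrow> finite (multi_indices K n)"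
  unfolding multi_indices_def by (intro finite_PiE) auto

lemma finite_index_subsets: "finite {G. index_subset m r G}"
  by (rule finite_subset[of _ "Pow {..<m}"]) (auto simp: index_subset_def)

lemma generic_slices:
  "AE w in entry_lebesgue d n r. \<forall>k\<in>{1..d}. \<forall>a\<in>{..<n k}. det (cores_of r w k a) \<noteq> 0"
proof (intro AE_finite_allI)
  fix k a assume "k \<in> {1..d}" "a \<in> {..<n k}"
  then show "AE w in entry_lebesgue d n r. det (cores_of r w k a) \<noteq> 0"
    by (intro AE_entry_lebesgue_nonzero[where q = "\<lambda>_ _. 1\<^sub>m r"] polymat_det[OF polymat_cores_of])
      (auto simp: cores_of_entries_of)
qed auto

lemma generic_slice_columns:
  "AE w in entry_lebesgue d n r. \<forall>k\<in>{1..d}. \<forall>G\<in>{G. index_subset (n k) r G}.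
     det (slice_columns (n k) r (cores_of r w k) G) \<noteq> 0"
proof (intro AE_finite_allI finite_index_subsets)
  fix k G assume k: "k \<in> {1..d}" and "G \<in> {G. index_subset (n k) r G}"
  then have G: "index_subset (n k) r G" by simp
  let ?q = "\<lambda>_ b. mat r r (\<lambda>(j, i). if card {a \<in> G. a < b} = i * r + j then 1 else 0)"
  have "slice_columns (n k) r (cores_of r (entries_of ?q) k) G = 1\<^sub>m (r * r)"
    by (subst cores_of_entries_of) (auto intro!: unit_slices[OF G])
  moreover have "polyfun (entry_index d n r) (\<lambda>w. det (slice_columns (n k) r (cores_of r w k) G))"
    using k by (intro polymat_det[OF polymat_slice_columns[OF G]] polymatD(2)[OF polymat_cores_of]) auto
  ultimately show "AE w in entry_lebesgue d n r. det (slice_columns (n k) r (cores_of r w k) G) \<noteq> 0"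
    by (intro AE_entry_lebesgue_nonzero[where q = ?q]) simp_all
qed simp

lemma generic_unfold_angle:
  assumes "1 \<le> d" "r\<^sup>2 \<le> n 1"
  shows "AE w in entry_lebesgue d n r. det (unfold_angle (r * r) r (cores_of r w 1)) \<noteq> 0"
proof -
  let ?q = "\<lambda>_ a. mat r r (\<lambda>(i, j). if a = i * r + j then 1 else 0)"
  have "unfold_angle (r * r) r (cores_of r (entries_of ?q) 1) = 1\<^sub>m (r * r)"
    by (subst cores_of_entries_of) (auto simp: unfold_angle_def pair_index_div_less intro!: eq_matI)
  moreover have "polymat (entry_index d n r) (r * r) (r * r) (\<lambda>w. unfold_angle (r * r) r (cores_of r w 1))"
  proof (rule polymatI)
    fix a c assume "a < r * r" "c < r * r"
    then show "polyfun (entry_index d n r) (\<lambda>w. unfold_angle (r * r) r (cores_of r w 1) $$ (a, c))"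
      using assms pair_index_div_less[of c r]
      by (simp add: unfold_angle_def power2_eq_square polymatD(2)[OF polymat_cores_of])
  qed simp
  ultimately show ?thesis
    by (intro AE_entry_lebesgue_nonzero[where q = ?q] polymat_det) simp_all
qed

lemma polymat_middle_prod:
  assumes "\<alpha> \<in> multi_indices {2..d-1} n"
  shows "polymat (entry_index d n r) r r (\<lambda>w. slice_prod r (cores_of r w) \<alpha> [2..<d])"
  using assms by (intro polymat_slice_prod) (auto simp: multi_indices_def PiE_iff)

lemma polymat_adj_quotient:
  assumes "\<alpha> \<in> multi_indices {2..d-1} n" "\<beta> \<in> multi_indices {2..d-1} n"
  shows "polymat (entry_index d n r) r r (\<lambda>w. adj_quotient d r (cores_of r w) \<alpha> \<beta>)"
  unfolding adj_quotient_def
  by (intro polymat_mult[OF polymat_middle_prod[OF assms(1)]] polymat_adj polymat_middle_prod[OF assms(2)])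

lemma coeff_pderiv_polyfun:
  assumes "\<And>i. polyfun I (\<lambda>w. coeff (F w) i)" shows "polyfun I (\<lambda>w. coeff (pderiv (F w)) i)"
  unfolding coeff_pderiv by (intro polyfun.mult polyfun.const assms)

lemma generic_simple_roots:
  "AE w in entry_lebesgue d n r. \<forall>\<alpha>\<in>multi_indices {2..d-1} n. \<forall>\<beta>\<in>multi_indices {2..d-1} n - {\<alpha>}.
     det (mat_poly r (pderiv (char_poly (adj_quotient d r (cores_of r w) \<alpha> \<beta>))) (adj_quotient d r (cores_of r w) \<alpha> \<beta>)) \<noteq> 0"
proof (intro AE_finite_allI)
  fix \<alpha> \<beta> assume \<alpha>: "\<alpha> \<in> multi_indices {2..d-1} n" and "\<beta> \<in> multi_indices {2..d-1} n - {\<alpha>}"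
  then have \<beta>: "\<beta> \<in> multi_indices {2..d-1} n" "\<alpha> \<noteq> \<beta>" by auto
  obtain m where m: "2 \<le> m" "m < d" "\<alpha> m \<noteq> \<beta> m" using last_difference[OF \<alpha> \<beta>] by metis
  obtain q where q: "\<And>k a. q k a \<in> carrier_mat r r"
    "det (mat_poly r (pderiv (char_poly (adj_quotient d r q \<alpha> \<beta>))) (adj_quotient d r q \<alpha> \<beta>)) \<noteq> 0"
    using simple_roots_witness[where \<alpha> = \<alpha> and \<beta> = \<beta>, OF m, of r] by metis
  show "AE w in entry_lebesgue d n r.
     det (mat_poly r (pderiv (char_poly (adj_quotient d r (cores_of r w) \<alpha> \<beta>))) (adj_quotient d r (cores_of r w) \<alpha> \<beta>)) \<noteq> 0"
    using q(2) by (intro AE_entry_lebesgue_nonzero[where q = q] 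
        polymat_det[OF polymat_mat_poly[OF polymat_adj_quotient[OF \<alpha> \<beta>(1)]]] coeff_pderiv_polyfun coeff_char_poly_polyfun[OF polymat_adj_quotient[OF \<alpha> \<beta>(1)]])
      (simp_all add: cores_of_entries_of[OF q(1)])
qed (auto intro: finite_multi_indices)

lemma polymat_power_products:
  assumes "polymat I r r X" "polymat I r r Y"
  shows "polymat I (r * r) (r * r) (\<lambda>w. power_products r (X w) (Y w))"
proof (rule polymatI)
  fix c e assume "c < r * r" "e < r * r"
  then show "polyfun I (\<lambda>w. power_products r (X w) (Y w) $$ (c, e))"
    using polymatD(2)[OF polymat_mult[OF polymat_pow[OF assms(1)] polymat_pow[OF assms(2)]]]
      pair_index_div_less[of e r] by (simp add: power_products_def)
qed (simp add: power_products_def)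

lemma generic_power_products:
  assumes r: "2 \<le> r"
  shows "AE w in entry_lebesgue d n r. \<forall>\<alpha>\<in>multi_indices {2..d-1} n. \<forall>\<beta>\<in>multi_indices {2..d-1} n.
     \<forall>\<alpha>'\<in>multi_indices {2..d-1} n. \<forall>\<beta>'\<in>multi_indices {2..d-1} n.
     \<alpha> \<noteq> \<beta> \<and> \<alpha>' \<noteq> \<beta>' \<and> independent_pairs d \<alpha> \<beta> \<alpha>' \<beta>' \<longrightarrow>
     det (power_products r (adj_quotient d r (cores_of r w) \<alpha> \<beta>) (adj_quotient d r (cores_of r w) \<alpha>' \<beta>')) \<noteq> 0"
proof (intro AE_finite_allI)
  fix \<alpha> \<beta> \<alpha>' \<beta>' assume idx: "\<alpha> \<in> multi_indices {2..d-1} n" "\<beta> \<in> multi_indices {2..d-1} n"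
    "\<alpha>' \<in> multi_indices {2..d-1} n" "\<beta>' \<in> multi_indices {2..d-1} n"
  let ?f = "\<lambda>w. det (power_products r (adj_quotient d r (cores_of r w) \<alpha> \<beta>) (adj_quotient d r (cores_of r w) \<alpha>' \<beta>'))"
  show "AE w in entry_lebesgue d n r. \<alpha> \<noteq> \<beta> \<and> \<alpha>' \<noteq> \<beta>' \<and> independent_pairs d \<alpha> \<beta> \<alpha>' \<beta>' \<longrightarrow> ?f w \<noteq> 0"
  proof (cases "\<alpha> \<noteq> \<beta> \<and> \<alpha>' \<noteq> \<beta>' \<and> independent_pairs d \<alpha> \<beta> \<alpha>' \<beta>'")
    case True
    then have "separable d r \<alpha> \<beta> \<alpha>' \<beta>'" using r by (intro separable_if_independent[OF _ idx]) auto
    then obtain q where q: "\<And>k a. q k a \<in> carrier_mat r r"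
      "det (power_products r (adj_quotient d r q \<alpha> \<beta>) (adj_quotient d r q \<alpha>' \<beta>')) \<noteq> 0"
      using power_products_witness[OF r] by metis
    have "AE w in entry_lebesgue d n r. ?f w \<noteq> 0"
      using q(2) by (intro AE_entry_lebesgue_nonzero[where q = q] polymat_det[OF polymat_power_products] polymat_adj_quotient idx)
        (simp_all add: cores_of_entries_of[OF q(1)])
    then show ?thesis by eventually_elim simp
  next
    case False
    then show ?thesis by (intro AE_I2) blast
  qed
qed (auto intro: finite_multi_indices)

text \<open>Vanishes when the quotient for two different column sets has an admissible stack of eigenvectors;
  \<open>b\<close> is a column that occurs in the first set only.\<close>

definition stack_obstruction :: "nat \<Rightarrow> (nat \<Rightarrow> nat) \<Rightarrow> nat \<Rightarrow> (nat \<Rightarrow> core) \<Rightarrow> (nat \<Rightarrow> nat) \<Rightarrow> nat set \<Rightarrow>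
    (nat \<Rightarrow> nat) \<Rightarrow> nat set \<Rightarrow> nat \<Rightarrow> complex mat" where
  "stack_obstruction d n r Q \<alpha> G \<beta> G' b =
    (let J = \<lambda>\<alpha> C G. kronecker (1\<^sub>m r) (slice_prod r Q \<alpha> [2..<d]) * slice_columns (n d) r C G;
         B = adj_mat (J \<beta> (Q d) G')
     in mat_poly (r * r) (char_poly (J \<alpha> ((Q d)(b := 0\<^sub>m r r)) G * B)) (J \<alpha> (Q d) G * B))"

text \<open>The middle slices are identities and the slices in \<open>G'\<close> are matrix units,
  so the matrix for \<beta> is the identity. As \<open>b\<close> is not in \<open>G'\<close>, its
  slice can still be chosen freely as \<open>t\<close> times a matrix unit, which makes
  \<open>t\<close> an eigenvalue of the matrix for \<alpha>, while the matrix with slice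
  \<open>b\<close> removed does not depend on \<open>t\<close>.\<close>

lemma stack_obstruction_witness:
  fixes n :: "nat \<Rightarrow> nat"
  assumes G: "index_subset (n d) r G" and G': "index_subset (n d) r G'" and b: "b \<in> G" "b \<notin> G'"
  defines "p \<equiv> card {a \<in> G. a < b}"
  obtains q where "\<And>k a. q k a \<in> carrier_mat r r" "stack_obstruction d n r q \<alpha> G \<beta> G' b $$ (p, p) \<noteq> 0"
proof -
  define u where "u G b x = mat r r (\<lambda>(j, i). if card {a \<in> G. a < b} = i * r + j then x else (0 :: complex))" for G and b :: nat and x
  define q where "q t k a = (if k = d then if a \<in> G' then u G' a 1 else if a = b then u G b t else 0\<^sub>m r r else 1\<^sub>m r)" for t k a
  have q: "q t k a \<in> carrier_mat r r" for t k a by (simp add: q_def u_def)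
  have p: "p < r * r" "pick G p = b"
  proof -
    show "pick G p = b" unfolding p_def using b(1) by (rule pick_card_in_set)
    show "p < r * r" unfolding p_def using G b(1) by (rule position_less)
  qed
  have one: "slice_prod r (q t) \<gamma> [2..<d] = 1\<^sub>m r" for t \<gamma> by (intro slice_prod_one) (simp add: q_def)
  have B: "slice_columns (n d) r (q t d) G' = 1\<^sub>m (r * r)" for t
    by (rule unit_slices[OF G']) (simp add: q_def u_def)
  have adj1: "adj_mat (1\<^sub>m (r * r)) = (1\<^sub>m (r * r) :: complex mat)"
    using adj_mat(2)[of "1\<^sub>m (r * r) :: complex mat" "r * r"] left_mult_one_mat[OF adj_mat(1)[of "1\<^sub>m (r * r) :: complex mat" "r * r"]]
    by simp
  let ?P = "\<lambda>t. slice_columns (n d) r (q t d) G"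
  define c0 where "c0 = (q 0 d)(b := 0\<^sub>m r r)"
  define C0 where "C0 = slice_columns (n d) r c0 G"
  have upd: "(q t d)(b := 0\<^sub>m r r) = c0" for t by (auto simp: q_def c0_def)
  have P: "?P t \<in> carrier_mat (r * r) (r * r)" for t by (rule slice_columns_carrier[OF G])
  have C0: "C0 \<in> carrier_mat (r * r) (r * r)" unfolding C0_def by (rule slice_columns_carrier[OF G])
  have obs: "stack_obstruction d n r (q t) \<alpha> G \<beta> G' b = mat_poly (r * r) (char_poly C0) (?P t)" for t
    unfolding stack_obstruction_def Let_def one kronecker_one B upd C0_def[symmetric]
    by (simp add: adj1 left_mult_one_mat[OF P] left_mult_one_mat[OF C0] right_mult_one_mat[OF P] right_mult_one_mat[OF C0])
  note deg = degree_monic_char_poly[OF C0]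
  then have "char_poly C0 \<noteq> 0" by auto
  then have "finite {t. poly (char_poly C0) t = 0}" by (rule poly_roots_finite)
  \<comment> \<open>A polynomial that is not zero misses some complex number; taking it as the
    eigenvalue makes the diagonal entry at \<open>p\<close> nonzero.\<close>
  then obtain t where t: "poly (char_poly C0) t \<noteq> 0"
    using infinite_UNIV_char_0[where 'a = complex] by (metis (mono_tags, lifting) UNIV_eq_I mem_Collect_eq)
  have "?P t *\<^sub>v unit_vec (r * r) p = t \<cdot>\<^sub>v unit_vec (r * r) p"
  proof (rule eq_vecI)
    fix e assume "e < dim_vec (t \<cdot>\<^sub>v (unit_vec (r * r) p :: complex vec))"
    then have e: "e < r * r" by simp
    note less = pair_index_div_less[OF e]
    have "(?P t *\<^sub>v unit_vec (r * r) p) $ e = ?P t $$ (e, p)"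
      unfolding mult_mat_vec_entry[OF P unit_vec_carrier e] using p(1)
      by (simp add: unit_vec_def if_distrib[of "\<lambda>x. _ * x"] cong: if_cong)
    also have "\<dots> = u G b t $$ (e mod r, e div r)"
      using slice_columns_entry[OF G less p(1), of "q t d"] b unfolding p(2) by (simp add: q_def)
    also have "\<dots> = (t \<cdot>\<^sub>v unit_vec (r * r) p) $ e" using less e p(1) by (auto simp: u_def p_def[symmetric] unit_vec_def)
    finally show "(?P t *\<^sub>v unit_vec (r * r) p) $ e = (t \<cdot>\<^sub>v unit_vec (r * r) p) $ e" .
  qed (use P[of t] in simp)
  then have mp: "mat_poly (r * r) (char_poly C0) (?P t) *\<^sub>v unit_vec (r * r) p = poly (char_poly C0) t \<cdot>\<^sub>v unit_vec (r * r) p"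
    using deg by (intro mat_poly_eigenvector[OF P unit_vec_carrier]) auto
  have mc: "mat_poly (r * r) (char_poly C0) (?P t) \<in> carrier_mat (r * r) (r * r)" using P by simp
  have "mat_poly (r * r) (char_poly C0) (?P t) $$ (p, p) = (mat_poly (r * r) (char_poly C0) (?P t) *\<^sub>v unit_vec (r * r) p) $ p"
    unfolding mult_mat_vec_entry[OF mc unit_vec_carrier p(1)] using p(1)
    by (simp add: unit_vec_def if_distrib[of "\<lambda>x. _ * x"] cong: if_cong)
  also have "\<dots> = poly (char_poly C0) t" unfolding mp using p(1) by simp
  finally show thesis using t q obs by (intro that[of "q t"]) auto
qed

lemma generic_stack_obstruction:
  assumes d: "1 \<le> d"
  shows "AE w in entry_lebesgue d n r. \<forall>\<alpha>\<in>multi_indices {2..d-1} n. \<forall>\<beta>\<in>multi_indices {2..d-1} n.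
     \<forall>G\<in>{G. index_subset (n d) r G}. \<forall>G'\<in>{G. index_subset (n d) r G}. \<forall>b\<in>G - G'.
     stack_obstruction d n r (cores_of r w) \<alpha> G \<beta> G' b \<noteq> 0\<^sub>m (r * r) (r * r)"
proof (intro AE_finite_allI finite_index_subsets)
  fix \<alpha> \<beta> G G' b
  assume \<alpha>: "\<alpha> \<in> multi_indices {2..d-1} n" and \<beta>: "\<beta> \<in> multi_indices {2..d-1} n"
    and "G \<in> {G. index_subset (n d) r G}" "G' \<in> {G. index_subset (n d) r G}" and b: "b \<in> G - G'"
  then have G: "index_subset (n d) r G" and G': "index_subset (n d) r G'" by auto
  let ?p = "card {a \<in> G. a < b}"
  have p: "?p < r * r" using b by (intro position_less[OF G]) simp
  obtain q where q: "\<And>k a. q k a \<in> carrier_mat r r" "stack_obstruction d n r q \<alpha> G \<beta> G' b $$ (?p, ?p) \<noteq> 0"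
    using stack_obstruction_witness[where n = n and \<alpha> = \<alpha> and \<beta> = \<beta>, OF G G'] b by blast
  let ?I = "entry_index d n r"
  have entry: "polyfun ?I (\<lambda>w. cores_of r w d a $$ (i, j))" if "a < n d" "i < r" "j < r" for a i j
    using d that by (intro polymatD(2)[OF polymat_cores_of]) auto
  then have entry0: "polyfun ?I (\<lambda>w. ((cores_of r w d)(b := 0\<^sub>m r r)) a $$ (i, j))" if "a < n d" "i < r" "j < r" for a i j
    using that by (cases "a = b") (auto intro: polyfun.const)
  have k: "polymat ?I (r * r) (r * r) (\<lambda>w. kronecker (1\<^sub>m r) (slice_prod r (cores_of r w) \<gamma> [2..<d]))"
    if "\<gamma> \<in> multi_indices {2..d-1} n" for \<gamma>
    using polymat_kronecker[OF polymat_const[OF one_carrier_mat] polymat_middle_prod[OF that]] .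
  have B: "polymat ?I (r * r) (r * r) (\<lambda>w. adj_mat (kronecker (1\<^sub>m r) (slice_prod r (cores_of r w) \<beta> [2..<d]) * slice_columns (n d) r (cores_of r w d) G'))"
    by (intro polymat_adj polymat_mult[OF k[OF \<beta>]] polymat_slice_columns[OF G'] entry)
  have "polymat ?I (r * r) (r * r) (\<lambda>w. stack_obstruction d n r (cores_of r w) \<alpha> G \<beta> G' b)"
    unfolding stack_obstruction_def Let_def
    by (intro polymat_mat_poly coeff_char_poly_polyfun[OF polymat_mult[OF polymat_mult[OF k[OF \<alpha>]] B]]
        polymat_mult[OF polymat_mult[OF k[OF \<alpha>]] B] polymat_slice_columns[OF G] entry entry0)
  from polymatD(2)[OF this p p]
  have "AE w in entry_lebesgue d n r. stack_obstruction d n r (cores_of r w) \<alpha> G \<beta> G' b $$ (?p, ?p) \<noteq> 0"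
    using q by (intro AE_entry_lebesgue_nonzero[where q = q]) (simp_all add: cores_of_entries_of)
  then show "AE w in entry_lebesgue d n r. stack_obstruction d n r (cores_of r w) \<alpha> G \<beta> G' b \<noteq> 0\<^sub>m (r * r) (r * r)"
    by eventually_elim (use p in auto)
qed (auto intro: finite_multi_indices simp: index_subset_def finite_subset)

lemma smult_mat_mult_vec:
  assumes A: "(A :: complex mat) \<in> carrier_mat m n" and v: "v \<in> carrier_vec n"
  shows "(x \<cdot>\<^sub>m A) *\<^sub>v v = x \<cdot>\<^sub>v (A *\<^sub>v v)"
proof (rule eq_vecI)
  fix i assume "i < dim_vec (x \<cdot>\<^sub>v (A *\<^sub>v v))"
  then have i: "i < m" using A by simp
  have xA: "x \<cdot>\<^sub>m A \<in> carrier_mat m n" using A by simp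
  show "((x \<cdot>\<^sub>m A) *\<^sub>v v) $ i = (x \<cdot>\<^sub>v (A *\<^sub>v v)) $ i"
    using i A mult_mat_vec_entry[OF A v i] mult_mat_vec_entry[OF xA v i]
    by (simp add: sum_distrib_left mult.assoc del: index_mult_mat_vec)
qed (use A in simp)

section \<open>Consequences of the generic conditions at a fixed point\<close>

context tensor_ring
begin

lemma adj_quotient_eq:
  assumes \<beta>: "\<beta> \<in> multi_indices {2..d-1} n"
  shows "adj_quotient d r Q \<alpha> \<beta> = det (M \<beta>) \<cdot>\<^sub>m H \<alpha> \<beta>"
  unfolding adj_quotient_def H_def adj_mat_eq_smult_mat_inv[OF slice_prod_Q det_M[OF \<beta>]]
  by (rule mult_smult_distrib[OF slice_prod_Q mat_inv(1)[OF slice_prod_Q det_M[OF \<beta>]]])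

lemma stack_exists_if_simple_roots:
  assumes \<alpha>: "\<alpha> \<in> multi_indices {2..d-1} n" and \<beta>: "\<beta> \<in> multi_indices {2..d-1} n"
    and G: "index_subset (n d) r G"
    and simple: "det (mat_poly r (pderiv (char_poly (adj_quotient d r Q \<alpha> \<beta>))) (adj_quotient d r Q \<alpha> \<beta>)) \<noteq> 0"
  shows "\<exists>E. eigenvector_stack r (quotient_mat d n T \<alpha> G \<beta> G) E"
proof -
  let ?A = "adj_quotient d r Q \<alpha> \<beta>" and ?x = "det (M \<beta>)"
  note Hc = H_carrier[OF \<beta>, of \<alpha>] and x = det_M[OF \<beta>]
  have Ac: "?A \<in> carrier_mat r r" unfolding adj_quotient_eq[OF \<beta>] using Hc by simp
  obtain \<Lambda> \<nu> where \<Lambda>: "\<Lambda> \<in> carrier_mat r r" "det \<Lambda> \<noteq> 0" "?A * \<Lambda> = \<Lambda> * mat_diag r \<nu>" "inj_on \<nu> {..<r}"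
    using diagonalizable_if_simple_roots[OF Ac simple] by metis
  have H: "H \<alpha> \<beta> = inverse ?x \<cdot>\<^sub>m ?A"
    unfolding adj_quotient_eq[OF \<beta>] using x by (intro eq_matI) auto
  have H\<Lambda>: "H \<alpha> \<beta> * \<Lambda> = \<Lambda> * mat_diag r (\<lambda>k. inverse ?x * \<nu> k)"
    unfolding H mult_smult_assoc_mat[OF Ac \<Lambda>(1)] \<Lambda>(3) smult_mat_diag[symmetric]
    by (rule mult_smult_distrib[OF \<Lambda>(1) mat_diag_dim, symmetric])
  \<comment> \<open>Admissible stacks require nonzero eigenvalues; these come from the invertibility
    of the quotient.\<close>
  have dH: "det (H \<alpha> \<beta>) \<noteq> 0"
    unfolding H_def using det_M[OF \<alpha>] det_mat_inv[OF slice_prod_Q x]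
    by (simp add: det_mult[OF slice_prod_Q mat_inv(1)[OF slice_prod_Q x]])
  let ?D = "mat_diag r (\<lambda>k. inverse ?x * \<nu> k)"
  have "det (\<Lambda> * ?D) \<noteq> 0" unfolding H\<Lambda>[symmetric] using dH \<Lambda>(2) by (simp add: det_mult[OF Hc \<Lambda>(1)])
  then have dD: "det ?D \<noteq> 0" by (simp add: det_mult[OF \<Lambda>(1) mat_diag_dim])
  have "inverse ?x * \<nu> k \<noteq> 0" if k: "k < r" for k
  proof
    assume "inverse ?x * \<nu> k = 0"
    then have "?D *\<^sub>v unit_vec r k = 0\<^sub>v r" unfolding mat_diag_mult_unit_vec[OF k] by (intro eq_vecI) auto
    then have "unit_vec r k = (0\<^sub>v r :: complex vec)" 
      using dD det_nonzero_iff_inj[OF mat_diag_dim[of r "\<lambda>k. inverse ?x * \<nu> k"]] unit_vec_carrier[of r k] by blast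
    from arg_cong[OF this, of "\<lambda>v. v $ k"] show False using k by simp
  qed
  moreover have "inj_on (\<lambda>k. inverse ?x * \<nu> k) {..<r}" using \<Lambda>(4) x by (auto simp: inj_on_def)
  ultimately show ?thesis by (intro eigenvector_stack_exists[OF \<alpha> \<beta> G \<Lambda>(1,2) H\<Lambda>])
qed

lemma eigenvectors_of_quotients_not_orthogonal:
  assumes \<beta>: "\<beta> \<in> multi_indices {2..d-1} n" "\<beta>' \<in> multi_indices {2..d-1} n"
    and pp: "det (power_products r (adj_quotient d r Q \<alpha> \<beta>) (adj_quotient d r Q \<alpha>' \<beta>')) \<noteq> 0"
    and u: "u \<in> carrier_vec r" "u \<noteq> 0\<^sub>v r" "transpose_mat (H \<alpha> \<beta>) *\<^sub>v u = x \<cdot>\<^sub>v u"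
    and w: "w \<in> carrier_vec r" "w \<noteq> 0\<^sub>v r" "H \<alpha>' \<beta>' *\<^sub>v w = y \<cdot>\<^sub>v w"
  shows "u \<bullet> w \<noteq> 0"
proof (rule eigenvectors_not_orthogonal[OF _ _ pp u(1,2) _ w(1,2)])
  note H1 = H_carrier[OF \<beta>(1), of \<alpha>] and H2 = H_carrier[OF \<beta>(2), of \<alpha>']
  show "adj_quotient d r Q \<alpha> \<beta> \<in> carrier_mat r r" "adj_quotient d r Q \<alpha>' \<beta>' \<in> carrier_mat r r"
    unfolding adj_quotient_eq[OF \<beta>(1)] adj_quotient_eq[OF \<beta>(2)] using H1 H2 by simp_all
  have "transpose_mat (det (M \<beta>) \<cdot>\<^sub>m H \<alpha> \<beta>) = det (M \<beta>) \<cdot>\<^sub>m transpose_mat (H \<alpha> \<beta>)"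
    by (rule eq_matI) auto
  moreover have "(det (M \<beta>) \<cdot>\<^sub>m transpose_mat (H \<alpha> \<beta>)) *\<^sub>v u = (det (M \<beta>) * x) \<cdot>\<^sub>v u"
    using smult_mat_mult_vec[of "transpose_mat (H \<alpha> \<beta>)" r r u] H1 u by (simp add: smult_smult_assoc)
  ultimately show "transpose_mat (adj_quotient d r Q \<alpha> \<beta>) *\<^sub>v u = (det (M \<beta>) * x) \<cdot>\<^sub>v u"
    unfolding adj_quotient_eq[OF \<beta>(1)] by simp
  show "adj_quotient d r Q \<alpha>' \<beta>' *\<^sub>v w = (det (M \<beta>') * y) \<cdot>\<^sub>v w"
    unfolding adj_quotient_eq[OF \<beta>(2)] using smult_mat_mult_vec[OF H2 w(1)] w by (simp add: smult_smult_assoc)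
qed

text \<open>A stack would diagonalize \<open>?C\<close> with every eigenvalue repeated
  \<open>r\<close> times. Zeroing the slice \<open>b\<close> changes only the column at the position
  of \<open>b\<close>, so \<open>char_poly_rank_one_change\<close> would make the obstruction
  vanish. Since \<open>b\<close> is not in \<open>G'\<close>, the matrix for \<beta> is untouched by
  this change.\<close>

lemma no_stack_if_obstruction:
  assumes \<alpha>: "\<alpha> \<in> multi_indices {2..d-1} n" and \<beta>: "\<beta> \<in> multi_indices {2..d-1} n"
    and G: "index_subset (n d) r G" "index_subset (n d) r G'" and b: "b \<in> G" "b \<notin> G'"
    and obs: "stack_obstruction d n r Q \<alpha> G \<beta> G' b \<noteq> 0\<^sub>m (r * r) (r * r)"
  shows "\<not> eigenvector_stack r (quotient_mat d n T \<alpha> G \<beta> G') E"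
proof
  assume S: "eigenvector_stack r (quotient_mat d n T \<alpha> G \<beta> G') E"
  let ?s = "r * r"
  note Ja = J_carrier[OF G(1), of \<alpha>] and Jb = J_carrier[OF G(2), of \<beta>] and dJ = det_J[OF \<beta> G(2)]
  note Ji = mat_inv[OF Jb dJ]
  let ?C = "J \<alpha> G * mat_inv (J \<beta> G')" and ?x = "det (J \<beta> G')" and ?B = "adj_mat (J \<beta> G')"
  have C: "?C \<in> carrier_mat ?s ?s" by (rule mult_carrier_mat[OF Ja Ji(1)])
  obtain Ap where Ap: "Ap \<in> carrier_mat ?s (n 1)" "Ap * A = 1\<^sub>m ?s"
    "quotient_mat d n T \<alpha> G \<beta> G' = A * ?C * Ap"
    using quotient_mat_factor[OF \<beta> \<alpha> G] by metis
  obtain Y \<nu> where Y: "Y \<in> carrier_mat ?s ?s" "det Y \<noteq> 0"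
    "?C * Y = Y * mat_diag ?s (\<lambda>c. \<nu> (c mod r))"
    using eigenvector_stackE[OF unfold_angle_carrier Ap(1,2) C Ap(3) S] by metis
  have B: "?B \<in> carrier_mat ?s ?s" by (rule adj_mat(1)[OF Jb])
  have JB: "J \<alpha> G * ?B = ?x \<cdot>\<^sub>m ?C"
    unfolding adj_mat_eq_smult_mat_inv[OF Jb dJ] by (rule mult_smult_distrib[OF Ja Ji(1)])
  have ev: "J \<alpha> G * ?B * Y = Y * mat_diag ?s (\<lambda>c. (\<lambda>k. ?x * \<nu> k) (c mod r))"
    unfolding JB mult_smult_assoc_mat[OF C Y(1)] Y(3) smult_mat_diag[symmetric]
    by (rule mult_smult_distrib[OF Y(1) mat_diag_dim, symmetric])
  let ?Z = "slice_columns (n d) r ((Q d)(b := 0\<^sub>m r r)) G" and ?S = "slice_columns (n d) r (Q d) G"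
  let ?k = "kronecker (1\<^sub>m r) (M \<alpha>)"
  note k = kronecker_carrier[OF one_carrier_mat slice_prod_Q, of r \<alpha> "[2..<d]"]
  note Sc = slice_columns_carrier[OF G(1)]
  let ?p = "card {a \<in> G. a < b}"
  have p: "?p < ?s" using b(1) by (rule position_less[OF G(1)])
  have same: "J \<alpha> G $$ (i, q) = (?k * ?Z) $$ (i, q)" if i: "i < ?s" and q: "q < ?s" "q \<noteq> ?p" for i q
  proof -
    have "card {a \<in> G. a < pick G q} = q"
      using q G by (intro card_pick_le) (simp add: index_subset_def power2_eq_square)
    then have "pick G q \<noteq> b" using q(2) by auto
    then have "?S $$ (e, q) = ?Z $$ (e, q)" if e: "e < ?s" for e
      using slice_columns_entry[OF G(1) pair_index_div_less[OF e] q(1)] by simp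
    then show ?thesis unfolding mult_mat_entry[OF k Sc i q(1)] by (intro sum.cong) auto
  qed
  have "mat_poly ?s (char_poly (?k * ?Z * ?B)) (J \<alpha> G * ?B) = 0\<^sub>m ?s ?s"
    by (rule char_poly_rank_one_change[OF Ja mult_carrier_mat[OF k Sc] B p r same Y(1,2) ev])
  then show False using obs by (simp add: stack_obstruction_def Let_def)
qed

end

lemma index_subsets_differ:
  assumes "index_subset m r G" "index_subset m r G'" "G \<noteq> G'"
  obtains b where "b \<in> G" "b \<notin> G'"
proof -
  have "finite G'" using assms(2) finite_subset by (auto simp: index_subset_def)
  then have "\<not> G \<subseteq> G'" using assms card_subset_eq[of G' G] by (auto simp: index_subset_def)
  then show thesis using that by blast
qed

theorem theorem1:
  fixes d r :: nat and n :: "nat \<Rightarrow> nat"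
    and \<mu> :: "(nat \<times> nat \<times> nat \<times> nat \<Rightarrow> complex) measure"
  assumes "d \<ge> 3" and "r \<ge> 2" and "\<And>k. k \<in> {1..d} \<Longrightarrow> n k \<ge> r ^ 2"
    and "prob_space \<mu>" and "sets \<mu> = sets (entry_lebesgue d n r)"
    and "absolutely_continuous (entry_lebesgue d n r) \<mu>"
  shows "AE \<omega> in \<mu>.
    \<forall>T. (\<forall>\<delta>\<in>multi_indices {1..d} n. T \<delta> = tr_tensor d r (cores_of r \<omega>) \<delta>) \<longrightarrow>
    (\<forall>\<gamma>\<in>multi_indices {1..d} n.
     \<forall>\<alpha>\<in>multi_indices {2..d-1} n. \<forall>\<beta>\<in>multi_indices {2..d-1} n.
     \<forall>\<alpha>'\<in>multi_indices {2..d-1} n. \<forall>\<beta>'\<in>multi_indices {2..d-1} n.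
     \<forall>G\<^sub>\<alpha> G\<^sub>\<beta> G\<^sub>\<alpha>' G\<^sub>\<beta>' G.
       \<alpha> \<noteq> \<beta> \<and> \<alpha>' \<noteq> \<beta>' \<and> {\<alpha>, \<beta>} \<noteq> {\<alpha>', \<beta>'} \<and>
       index_subset (n d) r G\<^sub>\<alpha> \<and> index_subset (n d) r G\<^sub>\<beta> \<and>
       index_subset (n d) r G\<^sub>\<alpha>' \<and> index_subset (n d) r G\<^sub>\<beta>' \<and>
       (\<forall>k\<in>{1..d-1}. index_subset (n k) r (G k)) \<longrightarrow>
       (let N = quotient_mat d n T \<alpha> G\<^sub>\<alpha> \<beta> G\<^sub>\<beta>; N' = quotient_mat d n T \<alpha>' G\<^sub>\<alpha>' \<beta>' G\<^sub>\<beta>' in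
          (\<forall>E E' Qh. eigenvector_stack r N E \<and> eigenvector_stack r N' E' \<and>
             blostr_steps d n r T \<gamma> G E E' Qh \<longrightarrow>
             gauge_equivalent d n r (cores_of r \<omega>) Qh) \<and>
          (G\<^sub>\<alpha> = G\<^sub>\<beta> \<and> G\<^sub>\<alpha>' = G\<^sub>\<beta>' \<and> independent_pairs d \<alpha> \<beta> \<alpha>' \<beta>' \<longrightarrow>
             (\<exists>E. eigenvector_stack r N E) \<and> (\<exists>E'. eigenvector_stack r N' E') \<and>
             (\<forall>E E'. eigenvector_stack r N E \<and> eigenvector_stack r N' E' \<longrightarrow>
                (\<exists>Qh. blostr_steps d n r T \<gamma> G E E' Qh)))))"
proof -
  have n1: "r\<^sup>2 \<le> n 1" and d1: "1 \<le> d" using assms(1) assms(3)[of 1] by auto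
  \<comment> \<open>The finite quantifiers over indices and column sets stand inside these
    almost-sure statements. Their intersection is one set of full measure, on which all tensors,
    stacks and outputs are handled without further exceptions.\<close>
  note generic = generic_slices[of d n r] generic_slice_columns[of d n r] generic_unfold_angle[where n = n, OF d1 n1]
    generic_simple_roots[of d n r] generic_power_products[OF assms(2), of d n] generic_stack_obstruction[OF d1, of n r]
  show ?thesis
  proof (rule absolutely_continuous_AE[OF assms(5,6)], use generic in eventually_elim, intro allI impI ballI, goal_cases)
    case (1 w T \<gamma> \<alpha> \<beta> \<alpha>' \<beta>' G\<^sub>\<alpha> G\<^sub>\<beta> G\<^sub>\<alpha>' G\<^sub>\<beta>' G)
    note g4 = 1(4) and g5 = 1(5) and g6 = 1(6) and \<gamma> = 1(8) and \<alpha> = 1(9) and \<beta> = 1(10)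
      and \<alpha>' = 1(11) and \<beta>' = 1(12) and prem = 1(13)
    interpret tensor_ring d r n "cores_of r w" T
      using assms(1-3) 1(1-3,7) by unfold_locales auto
    have ne: "\<alpha> \<noteq> \<beta>" "\<alpha>' \<noteq> \<beta>'" and G: "index_subset (n d) r G\<^sub>\<alpha>" "index_subset (n d) r G\<^sub>\<beta>"
      "index_subset (n d) r G\<^sub>\<alpha>'" "index_subset (n d) r G\<^sub>\<beta>'" and Gk: "\<And>k. k \<in> {1..d-1} \<Longrightarrow> index_subset (n k) r (G k)"
      using prem by auto
    \<comment> \<open>A run that possesses both stacks must have used equal column sets in each
      pair; all other choices make the correctness claim vacuous.\<close>
    have no_stack: "g = g'" if st: "a \<in> multi_indices {2..d-1} n" "b \<in> multi_indices {2..d-1} n"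
      "index_subset (n d) r g" "index_subset (n d) r g'" "eigenvector_stack r (quotient_mat d n T a g b g') E"
      for a b g g' E
    proof (rule ccontr)
      assume "g \<noteq> g'"
      then obtain c where c: "c \<in> g" "c \<notin> g'" using index_subsets_differ[OF st(3,4)] by metis
      then have "stack_obstruction d n r (cores_of r w) a g b g' c \<noteq> 0\<^sub>m (r * r) (r * r)" using g6 st by blast
      then show False using no_stack_if_obstruction[OF st(1-4) c] st(5) by blast
    qed
    let ?N = "quotient_mat d n T \<alpha> G\<^sub>\<alpha> \<beta> G\<^sub>\<beta>" and ?N' = "quotient_mat d n T \<alpha>' G\<^sub>\<alpha>' \<beta>' G\<^sub>\<beta>'"
    have "gauge_equivalent d n r (cores_of r w) Qh"
      if S: "eigenvector_stack r ?N E" "eigenvector_stack r ?N' E'" and B: "blostr_steps d n r T \<gamma> G E E' Qh" for E E' Qh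
    proof -
      have eq: "G\<^sub>\<alpha> = G\<^sub>\<beta>" "G\<^sub>\<alpha>' = G\<^sub>\<beta>'"
        using no_stack[OF \<alpha> \<beta> G(1,2) S(1)] no_stack[OF \<alpha>' \<beta>' G(3,4) S(2)] .
      show ?thesis
        by (rule blostr_gauge_equivalent[OF \<alpha> \<beta> \<alpha>' \<beta>' \<gamma> G(2,4) Gk S[unfolded eq] B])
    qed
    moreover have "(\<exists>E. eigenvector_stack r ?N E) \<and> (\<exists>E'. eigenvector_stack r ?N' E') \<and>
       (\<forall>E E'. eigenvector_stack r ?N E \<and> eigenvector_stack r ?N' E' \<longrightarrow> (\<exists>Qh. blostr_steps d n r T \<gamma> G E E' Qh))"
      if eq: "G\<^sub>\<alpha> = G\<^sub>\<beta>" "G\<^sub>\<alpha>' = G\<^sub>\<beta>'" and ind: "independent_pairs d \<alpha> \<beta> \<alpha>' \<beta>'"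
    proof (intro conjI allI impI)
      show "\<exists>E. eigenvector_stack r ?N E"
        unfolding eq using g4 \<alpha> \<beta> ne by (intro stack_exists_if_simple_roots[OF \<alpha> \<beta> G(2)]) blast
      show "\<exists>E'. eigenvector_stack r ?N' E'"
        unfolding eq using g4 \<alpha>' \<beta>' ne by (intro stack_exists_if_simple_roots[OF \<alpha>' \<beta>' G(4)]) blast
      fix E E' assume "eigenvector_stack r ?N E \<and> eigenvector_stack r ?N' E'"
      then have S: "eigenvector_stack r ?N E" "eigenvector_stack r ?N' E'" by auto
      have pp: "det (power_products r (adj_quotient d r (cores_of r w) \<alpha> \<beta>) (adj_quotient d r (cores_of r w) \<alpha>' \<beta>')) \<noteq> 0"
        using g5 \<alpha> \<beta> \<alpha>' \<beta>' ne ind by blast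
      show "\<exists>Qh. blostr_steps d n r T \<gamma> G E E' Qh"
        by (rule blostr_steps_exist[OF \<alpha> \<beta> \<alpha>' \<beta>' \<gamma> G(2,4) Gk S[unfolded eq]
              eigenvectors_of_quotients_not_orthogonal[OF \<beta> \<beta>' pp]])
    qed
    ultimately show ?case unfolding Let_def by blast
  qed
qed

end
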